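(* Let $\mathbb{A}=\sum_{\alpha=1}^n \mathbb{A}_\alpha\partial_\alpha$ be a linear homogeneous first order differential operator on $\mathbb{R}^n$ with constant coefficients, where $\mathbb{A}_\alpha:\mathbb{R}^N\to\mathbb{R}^K$ are fixed linear maps. Then the following are equivalent: (a) For every open and bounded Lipschitz domain $\Omega\subset\mathbb{R}^n$ there exists a constant $c>0$ such that $$\|u\|_{L^1(\partial\Omega;\mathbb{R}^N)}\le c\,\big(\|u\|_{L^1(\Omega;\mathbb{R}^N)}+\|\mathbb{A}u\|_{L^1(\Omega;\mathbb{R}^K)}\big)$$ holds for all $u\in C(\overline{\Omega};\mathbb{R}^N)\cap C^1(\Omega;\mathbb{R}^N)$. (b) $\mathbb{A}$ is $\mathbb{C}$-elliptic.
   Context: For $\xi\in\mathbb{C}^n$ and $\eta\in\mathbb{C}^N$ put $\mathbb{A}[\xi]\eta:=\sum_{\alpha=1}^n\xi_\alpha\mathbb{A}_\alpha\eta\in\mathbb{C}^K$ (with $\mathbb{A}_\alpha$ extended complex-linearly). The operator $\mathbb{A}$ is called $\mathbb{C}$-elliptic if $\mathbb{A}[\xi]:\mathbb{C}^N\to\mathbb{C}^K$ is injective for all $\xi\in\mathbb{C}^n\setminus\{0\}$. The space $L^1(\partial\Omega;\mathbb{R}^N)$ is taken with respect to the $(n-1)$-dimensional Hausdorff measure $\mathcal{H}^{n-1}$ on $\partial\Omega$. *)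

theory Defs
  imports "HOL-Analysis.Analysis"
begin

section \<open>Hausdorff measure\<close>

text \<open>
  Covers by countably many sets are given as sequences, padded with empty sets if necessary. An
  empty set contributes 0 also for s = 0, where 0 ^ 0 = 1 makes a singleton contribute 1.
  Boundedness is required because the library's diameter is only meaningful for bounded sets.
\<close>

definition hausdorff_premeasure :: "nat \<Rightarrow> real \<Rightarrow> 'a::metric_space set \<Rightarrow> ennreal" where
  "hausdorff_premeasure s \<delta> E =
     (INF C \<in> {C :: nat \<Rightarrow> 'a set. E \<subseteq> (\<Union>i. C i) \<and> (\<forall>i. bounded (C i) \<and> diameter (C i) \<le> \<delta>)}.
        \<Sum>i. if C i = {} then 0
            else ennreal (unit_ball_vol (real s) * (diameter (C i) / 2) ^ s))"

definition hausdorff_outer :: "nat \<Rightarrow> 'a::metric_space set \<Rightarrow> ennreal" where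
  "hausdorff_outer s E = (SUP \<delta>\<in>{0<..}. hausdorff_premeasure s \<delta> E)"

text \<open>
  The restriction of the outer measure to the Borel sets. It is countably additive there, by
  Caratheodory's criterion for metric outer measures, so the Borel measure formed here takes
  the values of the outer measure.
\<close>

definition hausdorff_measure :: "nat \<Rightarrow> 'a::metric_space measure" where
  "hausdorff_measure s = measure_of UNIV (sets borel) (hausdorff_outer s)"


section \<open>Lipschitz domains\<close>

text \<open>
  Near each boundary point, and after a rotation of the coordinates, the domain is the strict
  epigraph of a Lipschitz function of n - 1 variables. The rotation is encoded by the unit
  vector \<open>\<nu>\<close> playing the role of the last coordinate direction: \<open>y \<bullet> \<nu>\<close> is the last coordinate
  of y, and the remaining n - 1 coordinates are the orthogonal projection of y to the
  hyperplane orthogonal to \<open>\<nu>\<close>, on which the function \<open>\<gamma>\<close> lives.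
\<close>

definition lipschitz_domain :: "'a::euclidean_space set \<Rightarrow> bool" where
  "lipschitz_domain \<Omega> \<longleftrightarrow> open \<Omega> \<and> connected \<Omega> \<and> \<Omega> \<noteq> {} \<and>
     (\<forall>x\<in>frontier \<Omega>. \<exists>r>0. \<exists>\<nu> \<gamma> L. norm \<nu> = 1 \<and> L-lipschitz_on {z. z \<bullet> \<nu> = 0} \<gamma> \<and>
        \<Omega> \<inter> ball x r = {y \<in> ball x r. \<gamma> (y - (y \<bullet> \<nu>) *\<^sub>R \<nu>) < y \<bullet> \<nu>})"


section \<open>First order operators\<close>

definition partial :: "'n \<Rightarrow> (real^'n \<Rightarrow> 'b::real_normed_vector) \<Rightarrow> real^'n \<Rightarrow> 'b" where
  "partial \<alpha> u x = frechet_derivative u (at x) (axis \<alpha> 1)"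

definition C1_on :: "(real^'n) set \<Rightarrow> (real^'n \<Rightarrow> 'b::real_normed_vector) \<Rightarrow> bool" where
  "C1_on \<Omega> u \<longleftrightarrow> (\<forall>x\<in>\<Omega>. u differentiable (at x)) \<and> (\<forall>\<alpha>. continuous_on \<Omega> (partial \<alpha> u))"

definition diff_op ::
  "('n \<Rightarrow> real^'N \<Rightarrow> real^'K) \<Rightarrow> (real^'n \<Rightarrow> real^'N) \<Rightarrow> real^'n \<Rightarrow> real^'K" where
  "diff_op A u x = (\<Sum>\<alpha>\<in>UNIV. A \<alpha> (partial \<alpha> u x))"

text \<open>The complex-linear extension, i.e. T (a + i b) = T a + i T b for real vectors a, b.\<close>

definition complexify :: "(real^'N \<Rightarrow> real^'K) \<Rightarrow> complex^'N \<Rightarrow> complex^'K" where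
  "complexify T \<eta> = (\<chi> k. Complex (T (\<chi> j. Re (\<eta> $ j)) $ k) (T (\<chi> j. Im (\<eta> $ j)) $ k))"

definition op_symbol ::
  "('n::finite \<Rightarrow> real^'N \<Rightarrow> real^'K) \<Rightarrow> complex^'n \<Rightarrow> complex^'N \<Rightarrow> complex^'K" where
  "op_symbol A \<xi> \<eta> = (\<Sum>\<alpha>\<in>UNIV. (\<xi> $ \<alpha>) *s complexify (A \<alpha>) \<eta>)"

definition C_elliptic :: "('n::finite \<Rightarrow> real^'N \<Rightarrow> real^'K) \<Rightarrow> bool" where
  "C_elliptic A \<longleftrightarrow> (\<forall>\<xi>. \<xi> \<noteq> 0 \<longrightarrow> inj (op_symbol A \<xi>))"


section \<open>Norms\<close>

text \<open>Extended-valued: the value is infinite if f is not integrable over S.\<close>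

definition L1_norm :: "'a measure \<Rightarrow> 'a set \<Rightarrow> ('a \<Rightarrow> 'b::real_normed_vector) \<Rightarrow> ennreal" where
  "L1_norm M S f = (\<integral>\<^sup>+x\<in>S. ennreal (norm (f x)) \<partial>M)"

end

theory Submission
  imports Defs "HOL-Library.Function_Algebras" "HOL-Computational_Algebra.Fundamental_Theorem_Algebra"
begin

text \<open>
  Ellipticity over the complex numbers is used through the Nullstellensatz: for some m, every
  derivative \<open>\<partial>\<^sub>i\<^sup>m u\<close> is a constant-coefficient operator applied to \<open>\<bbbA>u\<close>. Take a smooth kernel
  \<open>\<rho>\<close> of mass 1, supported in a small ball about the inner direction \<open>\<nu>\<close>, whose coordinate
  factors have vanishing moments up to order \<open>m - 1\<close>. The difference of \<open>\<rho>\<close> and its dilate by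
  \<open>\<mu>\<close> is then a sum of m-th derivatives, hence equals \<open>\<bbbA>\<^sup>*h\<close> with compactly supported h. So the
  averages of u over \<open>x + s supp \<rho>\<close> at consecutive scales \<open>s = s\<^sub>0 \<mu>\<^sup>-\<^sup>k\<close> differ by at most
  \<open>C s\<^sup>1\<^sup>-\<^sup>n \<integral> |\<bbbA>u|\<close> over \<open>x + s B\<close>, with B a ball containing the supports. The balls \<open>x + s B\<close> are
  nontangential, so a point y of \<open>\<Omega>\<close> is met only at boundedly many scales s, all comparable to its
  distance to the boundary, and there by boundary points in a set of measure at most \<open>C s\<^sup>n\<^sup>-\<^sup>1\<close>;
  integrating over the boundary, the sum of the increments is controlled by the norm of \<open>\<bbbA>u\<close>.

  Conversely, if \<open>\<bbbA>[\<xi>]\<eta> = 0\<close>, then the real and imaginary parts of \<open>exp (t \<xi>\<cdot>x) \<eta>\<close> are annihilated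
  by \<open>\<bbbA>\<close>. On the cube, with \<open>Re \<xi>\<^sub>i > 0\<close>, these functions concentrate at the face \<open>x\<^sub>i = 1\<close> as t
  grows, which contradicts the trace inequality.
\<close>


section \<open>The Nullstellensatz for commuting operators\<close>

text \<open>Injectivity at complex frequencies says that the module of polynomial vectors modulo the
  rows of the symbol has no projective point, which is what a Nullstellensatz turns into powers
  X_i^m annihilating it. Only pure powers are obtained, and this dictates the kernel: it is a tensor
  product, so that its difference with its dilate telescopes into terms that change in a single
  coordinate, and the vanishing moments make that one-variable factor an m-th derivative of a
  compactly supported function.

  The Hausdorff measure enters from opposite sides. Sufficiency needs upper bounds for pieces of a
  graph, which explicit covers provide. Necessity needs a lower bound for a face of the cube, and a
  measure formed by \<open>measure_of\<close> is zero unless the set function is countably additive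
  on the generated sets; hence Caratheodory's criterion has to be proved. The lower bound itself
  compares the measure of E with the Lebesgue measure of the points of the cube that project into
  E.\<close>

lemma (in vector_space) nontrivial_relation:
  assumes "finite T" "finite C" "card T < card C" "\<And>c. c \<in> C \<Longrightarrow> g c \<in> span T"
  shows "\<exists>a. (\<exists>c\<in>C. a c \<noteq> 0) \<and> (\<Sum>c\<in>C. scale (a c) (g c)) = 0"
proof (cases "inj_on g C")
  case True
  have "dependent (g ` C)"
  proof (rule ccontr)
    assume "independent (g ` C)"
    then have "card (g ` C) \<le> card T"
      using independent_span_bound[OF assms(1)] assms(4) by blast
    then show False using assms(3) card_image[OF True] by simp
  qed
  then obtain u where u: "\<exists>v\<in>g ` C. u v \<noteq> 0" "(\<Sum>v\<in>g ` C. scale (u v) v) = 0"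
    using dependent_finite[of "g ` C"] assms(2) by auto
  have "(\<Sum>c\<in>C. scale (u (g c)) (g c)) = 0"
    using u(2) by (simp add: sum.reindex[OF True])
  then show ?thesis using u(1) by (intro exI[of _ "u \<circ> g"]) auto
next
  case False
  then obtain x y where xy: "x \<in> C" "y \<in> C" "x \<noteq> y" "g x = g y" by (auto simp: inj_on_def)
  \<comment> \<open>Two indices with the same vector give a relation at once; linear dependence of
    the image set would not see it.\<close>
  define a :: "_ \<Rightarrow> 'a" where "a c = (if c = x then 1 else if c = y then -1 else 0)" for c
  have "(\<Sum>c\<in>C. scale (a c) (g c)) = (\<Sum>c\<in>{x,y}. scale (a c) (g c))"
    by (rule sum.mono_neutral_right) (use xy assms in \<open>auto simp: a_def\<close>)
  also have "\<dots> = 0" using xy by (simp add: a_def)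
  finally show ?thesis using xy(1) by (intro exI[of _ a]) (auto simp: a_def)
qed

text \<open>A module over the complex polynomial ring with variables indexed by \<open>'n\<close>,
  the l-th variable acting as \<open>D l\<close>.\<close>

locale commuting_ops = vector_space scale
  for scale :: "complex \<Rightarrow> 'm::ab_group_add \<Rightarrow> 'm" (infixr \<open>\<odot>\<close> 75) +
  fixes D :: "'n::finite \<Rightarrow> 'm \<Rightarrow> 'm"
  assumes D_add: "D l (x + y) = D l x + D l y"
    and D_scale: "D l (c \<odot> x) = c \<odot> D l x"
    and D_comm: "D l (D l' x) = D l' (D l x)"
begin

definition submod :: "'m set \<Rightarrow> bool" where
  "submod J \<longleftrightarrow> subspace J \<and> (\<forall>l. \<forall>x\<in>J. D l x \<in> J)"

lemma submodD:
  assumes "submod J"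
  shows "0 \<in> J" "x \<in> J \<Longrightarrow> y \<in> J \<Longrightarrow> x + y \<in> J" "x \<in> J \<Longrightarrow> c \<odot> x \<in> J" "x \<in> J \<Longrightarrow> D l x \<in> J"
    "x \<in> J \<Longrightarrow> y \<in> J \<Longrightarrow> x - y \<in> J"
  using assms by (auto simp: submod_def intro: subspace_0 subspace_add subspace_scale subspace_diff)

lemma D_0: "D l 0 = 0" using D_scale[of l 0 0] by simp
lemma D_sum: "D l (\<Sum>k\<in>K. f k) = (\<Sum>k\<in>K. D l (f k))" for K :: "nat set"
  by (induction K rule: infinite_finite_induct) (auto simp: D_0 D_add)

lemma D_diff: "D l (x - y) = D l x - D l y"
  using D_add[of l "x - y" y] by (simp add: algebra_simps)

lemma pow_D: "((D l) ^^ k) (x + y) = ((D l) ^^ k) x + ((D l) ^^ k) y"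
  "((D l) ^^ k) (c \<odot> x) = c \<odot> ((D l) ^^ k) x"
  "((D l) ^^ k) (D l' x) = D l' (((D l) ^^ k) x)"
  by (induction k) (auto simp: D_add D_scale D_comm)

lemma pow_D_0: "((D l) ^^ k) 0 = 0"
  using pow_D(2)[where c = 0 and x = 0] by simp

text \<open>A filtration by degree: for finite S each \<open>span (gens S d)\<close> is
  finite-dimensional, and \<open>generated S\<close> is a countable union of such spaces. Both facts
  drive the counting in \<open>pencil_root\<close>.\<close>

fun gens :: "'m set \<Rightarrow> nat \<Rightarrow> 'm set" where
  "gens S 0 = S"
| "gens S (Suc d) = gens S d \<union> (\<Union>l. D l ` gens S d)"

definition generated :: "'m set \<Rightarrow> 'm set" where
  "generated S = (\<Union>d. span (gens S d))"

lemma finite_gens: "finite S \<Longrightarrow> finite (gens S d)"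
  by (induction d) auto

lemma gens_mono: "d \<le> d' \<Longrightarrow> gens S d \<subseteq> gens S d'"
  by (induction rule: dec_induct) auto

lemma D_span_gens: "x \<in> span (gens S d) \<Longrightarrow> D l x \<in> span (gens S (Suc d))"
proof (induction rule: span_induct_alt)
  case base
  then show ?case by (simp add: D_0 span_zero)
next
  case (step c x y)
  have "D l x \<in> span (gens S (Suc d))" using step(1) by (intro span_base) auto
  then show ?case using step(2) by (simp only: D_add D_scale span_add span_scale)
qed

lemma submod_generated: "submod (generated S)"
  unfolding submod_def
proof (intro conjI allI ballI subspaceI)
  show "0 \<in> generated S" by (auto simp: generated_def span_zero)
  show "x + y \<in> generated S" if xy: "x \<in> generated S" "y \<in> generated S" for x y
  proof -
    obtain d d' where d: "x \<in> span (gens S d)" "y \<in> span (gens S d')"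
      using xy unfolding generated_def by blast
    have "x \<in> span (gens S (max d d'))" "y \<in> span (gens S (max d d'))"
      using d span_mono[OF gens_mono[of d "max d d'" S]] span_mono[OF gens_mono[of d' "max d d'" S]] by auto
    then show ?thesis unfolding generated_def by (blast intro: span_add)
  qed
  show "c \<odot> x \<in> generated S" if "x \<in> generated S" for c x
    using that by (auto simp: generated_def intro: span_scale)
  show "D l x \<in> generated S" if "x \<in> generated S" for l x
    using that D_span_gens unfolding generated_def by blast
qed

lemma generated_base: "S \<subseteq> generated S"
  unfolding generated_def using span_base[of _ "gens S 0"] by (auto intro!: exI[of _ 0])

lemma generated_least:
  assumes "submod J" "S \<subseteq> J" shows "generated S \<subseteq> J"
proof -
  have "gens S d \<subseteq> J" for d
    by (induction d) (use assms in \<open>auto simp: submod_def\<close>)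
  then show ?thesis
    using assms(1) span_minimal[of _ J] unfolding generated_def submod_def by blast
qed

text \<open>The form \<open>q(D\<^sub>l, D\<^sub>i)\<close>, homogenised to degree m; meaningful if \<open>degree q \<le> m\<close>.\<close>

definition form :: "'n \<Rightarrow> 'n \<Rightarrow> nat \<Rightarrow> complex poly \<Rightarrow> 'm \<Rightarrow> 'm" where
  "form l i m q x = (\<Sum>k\<le>m. coeff q k \<odot> ((D l) ^^ k) (((D i) ^^ (m - k)) x))"

lemma form_linear:
  "form l i m (p + q) x = form l i m p x + form l i m q x"
  "form l i m (smult c q) x = c \<odot> form l i m q x"
  "form l i m 0 x = 0"
  "form l i m q (x + y) = form l i m q x + form l i m q y"
  "form l i m q (c \<odot> x) = c \<odot> form l i m q x"
  "form l i m q (D l' x) = D l' (form l i m q x)"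
  "form l i m q (((D l') ^^ k) x) = ((D l') ^^ k) (form l i m q x)"
proof -
  show g: "form l i m q (D l' x) = D l' (form l i m q x)" for x
    by (simp add: form_def pow_D D_sum D_scale)
  show "form l i m q (((D l') ^^ k) x) = ((D l') ^^ k) (form l i m q x)"
    by (induction k) (auto simp: g)
qed (auto simp: form_def scale_left_distrib scale_right_distrib sum.distrib scale_sum_right pow_D mult.commute)

lemma form_0: "form l i m q 0 = 0"
  using form_linear(5)[of l i m q 0 0] by simp

lemma form_sum: "form l i m (\<Sum>c\<in>C. f c) x = (\<Sum>c\<in>C. form l i m (f c) x)"
  by (induction C rule: infinite_finite_induct) (auto simp: form_linear)

lemma form_pCons:
  "form l i (Suc m) (pCons a q) x = a \<odot> ((D i) ^^ Suc m) x + D l (form l i m q x)"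
  unfolding form_def by (subst sum.atMost_Suc_shift) (simp add: D_sum D_scale)

text \<open>All coefficients beyond m vanish, so homogenising to a larger degree only adds powers of
  the homogenising variable \<open>D i\<close>.\<close>

lemma form_raise:
  assumes "degree q \<le> m"
  shows "form l i (n + m) q x = ((D i) ^^ n) (form l i m q x)"
proof -
  have "form l i (n + m) q x = (\<Sum>k\<le>m. coeff q k \<odot> ((D l) ^^ k) (((D i) ^^ (n + m - k)) x))"
    unfolding form_def
    by (rule sum.mono_neutral_right) (use assms in \<open>auto simp: coeff_eq_0\<close>)
  also have "\<dots> = form l i m q (((D i) ^^ n) x)"
  proof -
    have "((D i) ^^ (n + m - k)) x = ((D i) ^^ (m - k)) (((D i) ^^ n) x)" if "k \<le> m" for k
    proof -
      have "n + m - k = (m - k) + n" using that by simp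
      then show ?thesis by (metis funpow_add comp_apply)
    qed
    then show ?thesis unfolding form_def by (intro sum.cong) auto
  qed
  finally show ?thesis by (simp add: form_linear)
qed

text \<open>The induction peels off the constant coefficient of p by \<open>form_pCons\<close>,
  which avoids rearranging a double sum.\<close>

lemma form_mult:
  assumes "degree p \<le> m" "degree q \<le> n"
  shows "form l i (m + n) (p * q) x = form l i m p (form l i n q x)"
  using assms(1)
proof (induction m arbitrary: p)
  case 0
  then obtain a where "p = [:a:]" using degree_eq_zeroE by blast
  then show ?case by (simp add: form_linear(2)) (simp add: form_def)
next
  case (Suc m)
  obtain a p' where p: "p = pCons a p'" by (cases p)
  have "degree p' \<le> m"
    using Suc.prems p by (cases "p' = 0") (auto simp: degree_pCons_eq)
  note IH = Suc.IH[OF this]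
  have "form l i (Suc m + n) (p * q) x =
      a \<odot> form l i (Suc m + n) q x + form l i (Suc m + n) (pCons 0 (p' * q)) x"
    by (simp add: p form_linear)
  also have "form l i (Suc m + n) (pCons 0 (p' * q)) x = D l (form l i m p' (form l i n q x))"
    using form_pCons[of l i "m + n" 0 "p' * q"] IH by simp
  also have "form l i (Suc m + n) q x = ((D i) ^^ Suc m) (form l i n q x)"
    using form_raise[OF assms(2)] by blast
  finally show ?case by (simp add: p form_pCons)
qed

text \<open>The form of a linear factor \<open>[:- c, 1:]\<close>. Over the complex numbers every
  nonzero form is a product of such factors, a power of \<open>D i\<close> and a scalar.\<close>

definition pencil :: "'n \<Rightarrow> 'n \<Rightarrow> complex \<Rightarrow> 'm \<Rightarrow> 'm" where
  "pencil l i c x = D l x - c \<odot> D i x"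

lemma form_linear_factor: "form l i (Suc 0) [:- c, 1:] x = pencil l i c x"
  by (simp add: form_def pencil_def)

lemma pencil_linear:
  "pencil l i c (x + y) = pencil l i c x + pencil l i c y"
  "pencil l i c (a \<odot> x) = a \<odot> pencil l i c x"
  "pencil l i c (D l' x) = D l' (pencil l i c x)"
  by (simp_all add: pencil_def D_add D_diff D_scale D_comm algebra_simps scale_right_distrib
      scale_right_diff_distrib scale_left_commute)

lemma pencil_0: "pencil l i c 0 = 0"
  using pencil_linear(2)[of l i c 0 0] by simp

lemma submod_plus_image:
  assumes "submod J" "submod G"
  shows "submod {j + pencil l i c g | j g. j \<in> J \<and> g \<in> G}"
  unfolding submod_def
proof (intro conjI allI ballI subspaceI)
  show "0 \<in> {j + pencil l i c g | j g. j \<in> J \<and> g \<in> G}"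
    using submodD(1)[OF assms(1)] submodD(1)[OF assms(2)] pencil_0[of l i c] by force
  fix x assume x: "x \<in> {j + pencil l i c g | j g. j \<in> J \<and> g \<in> G}"
  then obtain j g where jg: "x = j + pencil l i c g" "j \<in> J" "g \<in> G" by blast
  show "a \<odot> x \<in> {j + pencil l i c g | j g. j \<in> J \<and> g \<in> G}" for a
    using jg submodD[OF assms(1)] submodD[OF assms(2)]
    by (intro CollectI exI[of _ "a \<odot> j"] exI[of _ "a \<odot> g"]) (auto simp: pencil_linear scale_right_distrib)
  show "D l' x \<in> {j + pencil l i c g | j g. j \<in> J \<and> g \<in> G}" for l'
    using jg submodD[OF assms(1)] submodD[OF assms(2)]
    by (intro CollectI exI[of _ "D l' j"] exI[of _ "D l' g"]) (auto simp: pencil_linear D_add)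
  fix y assume "y \<in> {j + pencil l i c g | j g. j \<in> J \<and> g \<in> G}"
  then obtain j' g' where jg': "y = j' + pencil l i c g'" "j' \<in> J" "g' \<in> G" by blast
  show "x + y \<in> {j + pencil l i c g | j g. j \<in> J \<and> g \<in> G}"
    using jg jg' submodD[OF assms(1)] submodD[OF assms(2)]
    by (intro CollectI exI[of _ "j + j'"] exI[of _ "g + g'"]) (auto simp: pencil_linear)
qed

text \<open>In the quotient by J this says that \<open>D i\<close> is not nilpotent on the submodule
  generated by S. It is the obstruction for which J is chosen maximal.\<close>

definition nonnil :: "'n \<Rightarrow> 'm set \<Rightarrow> 'm set \<Rightarrow> bool" where
  "nonnil i S J \<longleftrightarrow> (\<forall>k. \<exists>s\<in>S. ((D i) ^^ k) s \<notin> J)"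

lemma submod_pow: "submod J \<Longrightarrow> x \<in> J \<Longrightarrow> ((D i) ^^ k) x \<in> J"
  by (induction k) (auto simp: submod_def)

lemma submod_form: "submod J \<Longrightarrow> x \<in> J \<Longrightarrow> form l i m q x \<in> J"
  unfolding form_def by (rule subspace_sum) (auto simp: submod_def intro: subspace_scale submod_pow[unfolded submod_def])

lemma maximal_nonnil:
  assumes "finite S" "submod J0" "nonnil i S J0"
  obtains J where "submod J" "J0 \<subseteq> J" "nonnil i S J"
    "\<And>J'. submod J' \<Longrightarrow> J \<subseteq> J' \<Longrightarrow> nonnil i S J' \<Longrightarrow> J' = J"
proof -
  let ?A = "{J. submod J \<and> J0 \<subseteq> J \<and> nonnil i S J}"
  have un: "\<Union>C \<in> ?A" if C: "C \<noteq> {}" "subset.chain ?A C" for C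
  proof -
    have CA: "C \<subseteq> ?A" and lin: "\<And>x y. x \<in> C \<Longrightarrow> y \<in> C \<Longrightarrow> x \<subseteq> y \<or> y \<subseteq> x"
      using C(2) by (auto simp: subset_chain_def)
    have "submod (\<Union>C)" unfolding submod_def
    proof (intro conjI allI ballI subspaceI)
      show "0 \<in> \<Union>C" using C(1) CA submodD(1) by blast
      show "x + y \<in> \<Union>C" if xy: "x \<in> \<Union>C" "y \<in> \<Union>C" for x y
      proof -
        obtain X Y where XY: "X \<in> C" "Y \<in> C" "x \<in> X" "y \<in> Y" using xy by blast
        then have "submod X" "submod Y" using CA by auto
        then show ?thesis using lin[of X Y] XY submodD(2)[of X x y] submodD(2)[of Y x y] by blast
      qed
      show "c \<odot> x \<in> \<Union>C" if x: "x \<in> \<Union>C" for c x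
      proof -
        obtain X where X: "X \<in> C" "x \<in> X" using x by blast
        then have "submod X" using CA by auto
        then show ?thesis using X submodD(3) by blast
      qed
      show "D l x \<in> \<Union>C" if x: "x \<in> \<Union>C" for l x
      proof -
        obtain X where X: "X \<in> C" "x \<in> X" using x by blast
        then have "submod X" using CA by auto
        then show ?thesis using X submodD(4) by blast
      qed
    qed
    \<comment> \<open>Finiteness of S enters here: a power of \<open>D i\<close> that maps S into
      the union of the chain already maps it into one member.\<close>
    moreover have "nonnil i S (\<Union>C)" unfolding nonnil_def
    proof (rule ccontr)
      assume "\<not> (\<forall>k. \<exists>s\<in>S. (D i ^^ k) s \<notin> \<Union>C)"
      then obtain k where "\<forall>s\<in>S. (D i ^^ k) s \<in> \<Union>C" by metis
      then have k: "(\<lambda>s. (D i ^^ k) s) ` S \<subseteq> \<Union>C" by (simp only: image_subset_iff)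
      obtain B where B: "B \<in> C" "(\<lambda>s. (D i ^^ k) s) ` S \<subseteq> B"
        by (rule finite_subset_Union_chain[OF _ k C(1) C(2)]) (use assms(1) in simp)
      have "nonnil i S B" using B(1) CA by auto
      then show False using B(2) by (auto simp: nonnil_def image_subset_iff)
    qed
    moreover have "J0 \<subseteq> \<Union>C" using C(1) CA by blast
    ultimately show ?thesis by blast
  qed
  have ne: "?A \<noteq> {}" using assms by auto
  obtain J where J: "J \<in> ?A" "\<forall>X\<in>?A. J \<subseteq> X \<longrightarrow> X = J"
    using subset_Zorn_nonempty[OF ne un] by (rule bexE)
  show ?thesis
  proof (rule that[of J])
    show J': "submod J" "J0 \<subseteq> J" "nonnil i S J" using J(1) by simp_all
    show "J' = J" if "submod J'" "J \<subseteq> J'" "nonnil i S J'" for J'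
    proof -
      have "J' \<in> ?A" using that J'(2) by simp
      then show ?thesis using J(2) that(2) by blast
    qed
  qed
qed

text \<open>A root d of q gives a pencil factor; \<open>inv\<close> trades a power of
  \<open>D i\<close> for this pencil modulo J, and the remaining factor has lower degree. At degree
  0 the form is a power of \<open>D i\<close> up to a scalar. The exponent K is arbitrary because
  every trade costs further powers of \<open>D i\<close>.\<close>

lemma form_not_nil:
  assumes J: "submod J" "nonnil i S J"
    and inv: "\<And>c. \<exists>k. \<forall>s\<in>S. \<exists>j\<in>J. \<exists>g\<in>generated S. ((D i) ^^ k) s = j + pencil l i c g"
  shows "q \<noteq> 0 \<Longrightarrow> degree q \<le> m \<Longrightarrow> \<exists>s\<in>S. form l i m q (((D i) ^^ K) s) \<notin> J"
proof (induction m arbitrary: q K)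
  case 0
  then obtain a where a: "q = [:a:]" "a \<noteq> 0" using degree_eq_zeroE[of q] by force
  obtain s where s: "s \<in> S" "(D i ^^ K) s \<notin> J" using J(2) by (auto simp: nonnil_def)
  have "a \<odot> (D i ^^ K) s \<notin> J"
  proof
    assume "a \<odot> (D i ^^ K) s \<in> J"
    then have "inverse a \<odot> (a \<odot> (D i ^^ K) s) \<in> J" by (rule submodD[OF J(1)])
    then show False using s a by simp
  qed
  then show ?case using s(1) by (intro bexI[of _ s]) (simp_all add: form_def a)
next
  case (Suc m)
  show ?case
  proof (cases "degree q = 0")
    case True
    then obtain a where a: "q = [:a:]" "a \<noteq> 0" using degree_eq_zeroE[of q] Suc.prems by force
    obtain s where s: "s \<in> S" "(D i ^^ (Suc m + K)) s \<notin> J" using J(2) unfolding nonnil_def by blast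
    have *: "form l i (Suc m) q x = a \<odot> (D i ^^ Suc m) x" for x
      using form_pCons[of l i m a 0 x] by (simp add: a form_linear D_0)
    have "a \<odot> (D i ^^ (Suc m + K)) s \<notin> J"
    proof
      assume "a \<odot> (D i ^^ (Suc m + K)) s \<in> J"
      then have "inverse a \<odot> (a \<odot> (D i ^^ (Suc m + K)) s) \<in> J" by (rule submodD[OF J(1)])
      then show False using s a by simp
    qed
    then show ?thesis using s(1)
      by (intro bexI[of _ s]) (simp_all only: * funpow_add comp_apply not_False_eq_True)
  next
    case False
    then obtain d where "poly q d = 0"
      using fundamental_theorem_of_algebra[of q] constant_degree[of q] by auto
    then obtain q' where q': "q = [:- d, 1:] * q'" by (auto simp: poly_eq_0_iff_dvd)
    have q0: "q' \<noteq> 0" using Suc.prems q' by auto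
    then have deg: "degree q' \<le> m"
      using Suc.prems(2) unfolding q' by (subst (asm) degree_mult_eq) auto
    obtain k where k: "\<forall>s\<in>S. \<exists>j\<in>J. \<exists>g\<in>generated S. ((D i) ^^ k) s = j + pencil l i d g"
      using inv by blast
    show ?thesis
    proof (rule ccontr)
      assume neg: "\<not> ?thesis"
      \<comment> \<open>This is a submodule containing S, so the assumption on the generators
        spreads to the elements g supplied by \<open>inv\<close>.\<close>
      let ?T = "{x. form l i (Suc m) q ((D i ^^ K) x) \<in> J}"
      have "submod ?T"
        unfolding submod_def
      proof (intro conjI allI ballI subspaceI)
        show "0 \<in> ?T" using submodD(1)[OF J(1)] by (simp add: pow_D_0 form_0)
      qed (use submodD[OF J(1)] in \<open>simp_all only: mem_Collect_eq pow_D form_linear\<close>)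
      then have T: "generated S \<subseteq> ?T" using neg by (intro generated_least) auto
      have "form l i m q' ((D i ^^ (K + k)) s) \<in> J" if s: "s \<in> S" for s
      proof -
        obtain j g where jg: "j \<in> J" "g \<in> generated S" "(D i ^^ k) s = j + pencil l i d g"
          using k s by blast
        have "form l i m q' ((D i ^^ K) (pencil l i d g)) = form l i (Suc m) q ((D i ^^ K) g)"
        proof -
          have "form l i (Suc m) q x = form l i m q' (pencil l i d x)" for x
            using form_mult[of q' m "[:- d, 1:]" "Suc 0" l i x] deg
            by (simp add: q' form_linear_factor mult.commute)
          moreover have "(D i ^^ K) (pencil l i d g) = pencil l i d ((D i ^^ K) g)"
            by (induction K) (auto simp: pencil_linear)
          ultimately show ?thesis by simp
        qed
        also have "\<dots> \<in> J" using T jg by blast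
        finally have "form l i m q' ((D i ^^ K) (pencil l i d g)) \<in> J" .
        moreover have "form l i m q' ((D i ^^ K) j) \<in> J"
          by (intro submod_form submod_pow J jg)
        ultimately show ?thesis
          using submodD(2)[OF J(1)] by (simp add: funpow_add jg pow_D form_linear)
      qed
      then show False using Suc.IH[OF q0 deg, of "K + k"] by blast
    qed
  qed
qed

text \<open>Amitsur's argument. Otherwise, by maximality of J, some power of \<open>D\<^sub>i\<close> factors modulo J through
  every pencil \<open>D\<^sub>l - c D\<^sub>i\<close>. There are uncountably many c, so infinitely many of the quotients lie in
  one finite-dimensional space. A linear relation among them gives a nonzero form in \<open>D\<^sub>l\<close> and
  \<open>D\<^sub>i\<close> that kills the generators, and this form splits into pencils.\<close>

lemma pencil_root:
  assumes S: "finite S" and J: "submod J" "nonnil i S J"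
    and max: "\<And>J'. submod J' \<Longrightarrow> J \<subseteq> J' \<Longrightarrow> nonnil i S J' \<Longrightarrow> J' = J"
  shows "\<exists>c. \<forall>s\<in>S. pencil l i c s \<in> J"
proof (rule ccontr)
  assume neg: "\<not> ?thesis"
  \<comment> \<open>J enlarged by the image of the pencil is again a submodule. Were it still
    \<open>nonnil\<close>, maximality would make it equal to J, and then the pencil would map S into
    J, against \<open>neg\<close>.\<close>
  have inv: "\<exists>k. \<forall>s\<in>S. \<exists>j\<in>J. \<exists>g\<in>generated S. ((D i) ^^ k) s = j + pencil l i c g" for c
  proof (rule ccontr)
    assume a: "\<not> ?thesis"
    let ?J = "{j + pencil l i c g | j g. j \<in> J \<and> g \<in> generated S}"
    have "J \<subseteq> ?J" using pencil_0[of l i c] submodD(1)[OF submod_generated] by force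
    moreover have "nonnil i S ?J" using a unfolding nonnil_def by blast
    ultimately have "?J = J" using max submod_plus_image[OF J(1) submod_generated] by blast
    moreover have "pencil l i c s \<in> ?J" if "s \<in> S" for s
      using that generated_base submodD(1)[OF J(1)] by force
    ultimately have "\<forall>s\<in>S. pencil l i c s \<in> J" by simp
    then show False using neg by blast
  qed
  have "\<exists>k d. \<forall>s\<in>S. \<exists>j\<in>J. \<exists>g\<in>span (gens S d). ((D i) ^^ k) s = j + pencil l i c g" for c
  proof -
    obtain k where "\<forall>s\<in>S. \<exists>j\<in>J. \<exists>g\<in>generated S. ((D i) ^^ k) s = j + pencil l i c g" using inv by blast
    then obtain jj g where g: "\<And>s. s \<in> S \<Longrightarrow> jj s \<in> J \<and> g s \<in> generated S \<and> ((D i) ^^ k) s = jj s + pencil l i c (g s)"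
      by metis
    then have "\<forall>s\<in>S. \<exists>d. g s \<in> span (gens S d)" by (auto simp: generated_def)
    then obtain dd where dd: "\<forall>s\<in>S. g s \<in> span (gens S (dd s))" by metis
    obtain d where "\<forall>s\<in>S. dd s \<le> d" using S by (meson finite_imageI finite_nat_set_iff_bounded_le imageI)
    then have "\<forall>s\<in>S. g s \<in> span (gens S d)" using dd span_mono[OF gens_mono] by blast
    then show ?thesis using g by blast
  qed
  then obtain kk dd where kd: "\<And>c. \<forall>s\<in>S. \<exists>j\<in>J. \<exists>g\<in>span (gens S (dd c)). ((D i) ^^ (kk c)) s = j + pencil l i c g"
    by metis
  \<comment> \<open>Countably many pairs (k, d) face uncountably many scalars c.\<close>
  have "\<exists>k d. infinite {c. kk c = k \<and> dd c = d}"
  proof (rule ccontr)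
    assume "\<not> ?thesis"
    then have "countable (\<Union>k. \<Union>d. {c. kk c = k \<and> dd c = d})"
      by (intro countable_UN) (auto intro: countable_finite)
    moreover have "(\<Union>k. \<Union>d. {c. kk c = k \<and> dd c = d}) = UNIV" by auto
    ultimately show False using uncountable_UNIV_complex by metis
  qed
  then obtain k d where inf: "infinite {c. kk c = k \<and> dd c = d}" by blast
  let ?M = "card (gens S d)"
  obtain C where C: "C \<subseteq> {c. kk c = k \<and> dd c = d}" "finite C" "card C = Suc ?M"
    using infinite_arbitrarily_large[OF inf] by metis
  have one: "\<exists>q. q \<noteq> 0 \<and> degree q \<le> ?M \<and> form l i ?M q ((D i ^^ k) s) \<in> J" if s: "s \<in> S" for s
  proof -
    have "\<forall>c\<in>C. \<exists>j g. j \<in> J \<and> g \<in> span (gens S d) \<and> ((D i) ^^ k) s = j + pencil l i c g"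
      using kd s C(1) by (metis (mono_tags, lifting) mem_Collect_eq subset_iff)
    then obtain j g where jg: "\<And>c. c \<in> C \<Longrightarrow> j c \<in> J \<and> g c \<in> span (gens S d) \<and> ((D i) ^^ k) s = j c + pencil l i c (g c)"
      by metis
    obtain a where a: "\<exists>c\<in>C. a c \<noteq> 0" "(\<Sum>c\<in>C. a c \<odot> g c) = 0"
      using nontrivial_relation[OF finite_gens[OF S] C(2), of d g] C(3) jg by auto
    \<comment> \<open>The product of all pencils is applied to the relation among the
      \<open>g c\<close>. In the term of c it leaves \<open>P c\<close> acting on
      \<open>pencil l i c (g c)\<close>, which modulo J is the same vector
      \<open>(D i ^^ k) s\<close> for every c.\<close>
    define P where "P c = (\<Prod>c'\<in>C - {c}. [:- c', 1:])" for c :: complex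
    define q where "q = (\<Sum>c\<in>C. smult (a c) (P c))"
    have degP: "degree (P c) \<le> ?M" if "c \<in> C" for c
    proof -
      have "degree (P c) \<le> (\<Sum>c'\<in>C - {c}. degree [:- c', 1:])" unfolding P_def
        using degree_prod_sum_le[of "C - {c}" "\<lambda>c'. [:- c', 1:]"] C(2) by (simp add: o_def)
      also have "\<dots> = ?M" using C that by simp
      finally show ?thesis .
    qed
    have fac: "form l i (Suc ?M) (\<Prod>c'\<in>C. [:- c', 1:]) x = form l i ?M (P c) (pencil l i c x)" if "c \<in> C" for c x
    proof -
      have "(\<Prod>c'\<in>C. [:- c', 1:]) = P c * [:- c, 1:]"
        unfolding P_def using C(2) that by (simp add: prod.remove mult.commute)
      then show ?thesis using form_mult[OF degP[OF that], of "[:- c, 1:]" "Suc 0" l i x]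
        by (simp add: form_linear_factor)
    qed
    have "0 = form l i (Suc ?M) (\<Prod>c'\<in>C. [:- c', 1:]) (\<Sum>c\<in>C. a c \<odot> g c)"
      unfolding a(2) by (simp add: form_0)
    also have "\<dots> = (\<Sum>c\<in>C. a c \<odot> form l i (Suc ?M) (\<Prod>c'\<in>C. [:- c', 1:]) (g c))"
    proof -
      have "form l i m p (\<Sum>c\<in>B. a c \<odot> g c) = (\<Sum>c\<in>B. a c \<odot> form l i m p (g c))" for m p B
        by (induction B rule: infinite_finite_induct) (auto simp: form_0 form_linear)
      then show ?thesis .
    qed
    also have "\<dots> = (\<Sum>c\<in>C. a c \<odot> form l i ?M (P c) ((D i ^^ k) s - j c))"
      by (intro sum.cong refl) (use jg fac in force)
    also have "\<dots> = (\<Sum>c\<in>C. a c \<odot> form l i ?M (P c) ((D i ^^ k) s)) - (\<Sum>c\<in>C. a c \<odot> form l i ?M (P c) (j c))"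
    proof -
      have "form l i m p (x - y) = form l i m p x - form l i m p y" for m p x y
        using form_linear(4)[of l i m p "x - y" y] by (simp add: algebra_simps)
      then show ?thesis by (simp add: scale_right_diff_distrib sum_subtractf)
    qed
    finally have "(\<Sum>c\<in>C. a c \<odot> form l i ?M (P c) ((D i ^^ k) s)) = (\<Sum>c\<in>C. a c \<odot> form l i ?M (P c) (j c))" by simp
    moreover have "(\<Sum>c\<in>C. a c \<odot> form l i ?M (P c) (j c)) \<in> J"
      using J(1) jg submod_form[OF J(1)] by (intro subspace_sum) (auto simp: submod_def intro: subspace_scale)
    ultimately have "form l i ?M q ((D i ^^ k) s) \<in> J"
      by (simp only: q_def form_sum form_linear(2))
    moreover have "degree q \<le> ?M" unfolding q_def
      by (intro degree_sum_le C) (meson degP degree_smult_le le_trans)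
    \<comment> \<open>As in Lagrange interpolation, at c0 every other product vanishes and only the
      term of c0 survives.\<close>
    moreover have "q \<noteq> 0"
    proof -
      obtain c0 where c0: "c0 \<in> C" "a c0 \<noteq> 0" using a by blast
      have "poly q c0 = (\<Sum>c\<in>C. a c * (\<Prod>c'\<in>C - {c}. c0 - c'))"
        by (simp add: q_def P_def poly_sum poly_prod)
      also have "\<dots> = (\<Sum>c\<in>{c0}. a c * (\<Prod>c'\<in>C - {c}. c0 - c'))"
        by (rule sum.mono_neutral_right) (use C c0 in auto)
      also have "\<dots> \<noteq> 0" using c0 C by auto
      finally show ?thesis by auto
    qed
    ultimately show ?thesis by blast
  qed
  \<comment> \<open>So far the form depends on the generator; the product of finitely many forms
    serves all of S at once.\<close>
  have all: "\<exists>q m. q \<noteq> 0 \<and> degree q \<le> m \<and> (\<forall>s\<in>T. form l i m q ((D i ^^ k) s) \<in> J)" if "finite T" "T \<subseteq> S" for T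
    using that
  proof (induction T)
    case empty
    show ?case by (intro exI[of _ 1] exI[of _ 0]) auto
  next
    case (insert t T)
    then obtain q m where q: "q \<noteq> 0" "degree q \<le> m" "\<forall>s\<in>T. form l i m q ((D i ^^ k) s) \<in> J" by auto
    obtain q' where q': "q' \<noteq> 0" "degree q' \<le> ?M" "form l i ?M q' ((D i ^^ k) t) \<in> J"
      using one insert.prems by auto
    have "form l i (?M + m) (q' * q) ((D i ^^ k) s) \<in> J" if "s \<in> T" for s
      using form_mult[OF q'(2) q(2)] submod_form[OF J(1)] q(3) that by metis
    moreover have "form l i (?M + m) (q' * q) ((D i ^^ k) t) \<in> J"
      using form_mult[OF q(2) q'(2)] submod_form[OF J(1)] q'(3) by (metis mult.commute add.commute)
    moreover have "degree (q' * q) \<le> ?M + m" using q q' by (simp add: degree_mult_eq)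
    ultimately show ?case using q q' by (intro exI[of _ "q' * q"] exI[of _ "?M + m"]) auto
  qed
  obtain q m where "q \<noteq> 0" "degree q \<le> m" "\<forall>s\<in>S. form l i m q ((D i ^^ k) s) \<in> J"
    using all[OF S] by blast
  then show False using form_not_nil[OF J inv, where q = q and m = m and K = k] by blast
qed

text \<open>The scalars c are the projective zero of the Nullstellensatz.\<close>

lemma nullstellensatz:
  assumes "finite S" "submod J0" "nonnil i S J0"
  obtains J c where "J0 \<subseteq> J" "submod J" "c i = 1" "\<And>l s. s \<in> S \<Longrightarrow> D l s - c l \<odot> D i s \<in> J"
    "\<exists>s\<in>S. D i s \<notin> J"
proof -
  obtain J where J: "submod J" "J0 \<subseteq> J" "nonnil i S J"
    "\<And>J'. submod J' \<Longrightarrow> J \<subseteq> J' \<Longrightarrow> nonnil i S J' \<Longrightarrow> J' = J"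
    using maximal_nonnil[OF assms] by metis
  have "\<forall>l. \<exists>c. \<forall>s\<in>S. pencil l i c s \<in> J"
    using pencil_root[OF assms(1) J(1,3,4)] by blast
  then obtain c where c: "\<And>l. \<forall>s\<in>S. pencil l i (c l) s \<in> J" by metis
  have "\<exists>s\<in>S. D i s \<notin> J" using J(3)[unfolded nonnil_def, rule_format, of 1] by simp
  \<comment> \<open>For l = i the difference is 0 once the scalar is set to 1.\<close>
  moreover have "D l s - (c(i := 1)) l \<odot> D i s \<in> J" if "s \<in> S" for l s
    using c[of l] that submodD(1)[OF J(1)] by (auto simp: pencil_def)
  ultimately show ?thesis using J by (intro that[of J "c(i := 1)"]) auto
qed

end


section \<open>Reduction of high derivatives to an elliptic operator\<close>

text \<open>Polynomials are encoded as coefficient functions on multi-indices; shift l is multiplication by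
  the l-th variable.\<close>

definition shift :: "'n \<Rightarrow> (('n \<Rightarrow> nat) \<Rightarrow> 'b::zero) \<Rightarrow> ('n \<Rightarrow> nat) \<Rightarrow> 'b" where
  "shift l p \<alpha> = (if \<alpha> l = 0 then 0 else p (\<alpha>(l := \<alpha> l - 1)))"

lemma finite_shift_support:
  assumes "finite {\<alpha>. B \<alpha> \<noteq> 0}" shows "finite {\<alpha>. shift l B \<alpha> \<noteq> 0}"
proof (rule finite_subset)
  show "{\<alpha>. shift l B \<alpha> \<noteq> 0} \<subseteq> (\<lambda>\<alpha>. \<alpha>(l := Suc (\<alpha> l))) ` {\<alpha>. B \<alpha> \<noteq> 0}"
  proof
    fix \<alpha> assume "\<alpha> \<in> {\<alpha>. shift l B \<alpha> \<noteq> 0}"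
    then have "\<alpha> l \<noteq> 0" "B (\<alpha>(l := \<alpha> l - 1)) \<noteq> 0" by (auto simp: shift_def split: if_splits)
    then show "\<alpha> \<in> (\<lambda>\<alpha>. \<alpha>(l := Suc (\<alpha> l))) ` {\<alpha>. B \<alpha> \<noteq> 0}"
      by (intro image_eqI[of _ _ "\<alpha>(l := \<alpha> l - 1)"]) auto
  qed
qed (use assms in auto)

lemma shift_commute: "shift l (shift l' p) = shift l' (shift l p)"
  by (cases "l = l'") (auto simp: shift_def fun_eq_iff fun_upd_twist)

lemma shift_add: "shift l (\<lambda>\<alpha>. p \<alpha> + q \<alpha>) \<alpha> = shift l p \<alpha> + (shift l q \<alpha> :: 'b::monoid_add)"
  by (simp add: shift_def)

lemma shift_mult: "shift l (\<lambda>\<alpha>. c * p \<alpha>) \<alpha> = c * (shift l p \<alpha> :: 'b::mult_zero)"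
  by (simp add: shift_def)

text \<open>The ambient module consists of tuples of formal power series, so no support condition
  has to be carried along; polynomials enter through the finite supports in \<open>J0\<close>
  below.\<close>

interpretation poly_ops: commuting_ops
  "\<lambda>c f j \<alpha>. c * f j \<alpha>" "\<lambda>l f j. shift l (f j)" for
  dummy :: "'N \<Rightarrow> ('n::finite \<Rightarrow> nat) \<Rightarrow> complex"
  by unfold_locales (auto simp: fun_eq_iff algebra_simps shift_add shift_mult plus_fun_def shift_commute)

definition unit_poly :: "'N \<Rightarrow> 'N \<Rightarrow> ('n \<Rightarrow> nat) \<Rightarrow> complex" where
  "unit_poly j j' \<alpha> = (if j' = j \<and> \<alpha> = (\<lambda>_. 0) then 1 else 0)"

lemma shift_pow_unit:
  "((\<lambda>f j. shift l (f j)) ^^ m) (unit_poly j) j' \<alpha> = (if j' = j \<and> \<alpha> = (\<lambda>_. 0)(l := m) then 1 else 0)"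
proof (induction m arbitrary: \<alpha>)
  case 0
  then show ?case by (auto simp: unit_poly_def fun_eq_iff)
next
  case (Suc m)
  have "\<alpha> l \<noteq> 0 \<and> \<alpha>(l := \<alpha> l - 1) = (\<lambda>_. 0)(l := m) \<longleftrightarrow> \<alpha> = (\<lambda>_. 0)(l := Suc m)"
    by (auto simp: fun_eq_iff split: if_splits)
  moreover have "((\<lambda>f j. shift l (f j)) ^^ Suc m) (unit_poly j) j' \<alpha> =
      (if \<alpha> l \<noteq> 0 \<and> \<alpha>(l := \<alpha> l - 1) = (\<lambda>_. 0)(l := m) then if j' = j then 1 else 0 else 0)"
    by (simp add: shift_def[of l "_ j'"] Suc del: fun_upd_apply)
  ultimately show ?case by presburger
qed

lemma linear_nth_expansion:
  fixes T :: "real^'N::finite \<Rightarrow> real^'K"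
  assumes "linear T"
  shows "T v $ \<kappa> = (\<Sum>j\<in>UNIV. v $ j * (T (axis j 1) $ \<kappa>))"
proof -
  have "T v = T (\<Sum>j\<in>UNIV. v $ j *\<^sub>R axis j 1)" using basis_expansion[of v] by (simp add: scalar_mult_eq_scaleR)
  also have "\<dots> = (\<Sum>j\<in>UNIV. v $ j *\<^sub>R T (axis j 1))"
    using assms by (simp add: linear_sum linear_cmul)
  finally show ?thesis by simp
qed

lemma op_symbol_nth:
  assumes "\<And>l. linear (A l)"
  shows "op_symbol A \<xi> \<eta> $ \<kappa> = (\<Sum>j\<in>UNIV. (\<Sum>l\<in>UNIV. \<xi> $ l * of_real (A l (axis j 1) $ \<kappa>)) * \<eta> $ j)"
proof -
  note lin = linear_nth_expansion[OF assms]
  have c: "complexify (A l) \<eta> $ \<kappa> = (\<Sum>j\<in>UNIV. of_real (A l (axis j 1) $ \<kappa>) * \<eta> $ j)" for l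
  proof (rule complex_eqI)
    show "Re (complexify (A l) \<eta> $ \<kappa>) = Re (\<Sum>j\<in>UNIV. of_real (A l (axis j 1) $ \<kappa>) * \<eta> $ j)"
      using lin[where v = "\<chi> j. Re (\<eta> $ j)"] by (simp add: complexify_def mult.commute)
    show "Im (complexify (A l) \<eta> $ \<kappa>) = Im (\<Sum>j\<in>UNIV. of_real (A l (axis j 1) $ \<kappa>) * \<eta> $ j)"
      using lin[where v = "\<chi> j. Im (\<eta> $ j)"] by (simp add: complexify_def mult.commute)
  qed
  show ?thesis
    by (simp add: op_symbol_def c sum_distrib_left sum_distrib_right mult.assoc)
       (rule sum.swap)
qed

text \<open>\<open>J0\<close> is the submodule generated by the rows of the symbol, and the claim is
  that X_i^m e_j lies in it. Otherwise the Nullstellensatz yields J above \<open>J0\<close> with X_l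
  e_j congruent to c_l X_i e_j, so that modulo J the symbol becomes X_i times its value M at c.
  Ellipticity gives M a left inverse L; the rows of the symbol combined by L lie in J and are
  congruent to X_i e_j, so every X_i e_j lies in J, a contradiction.\<close>

lemma elliptic_reduction_complex:
  fixes A :: "'n::finite \<Rightarrow> real^'N::finite \<Rightarrow> real^'K::finite"
  assumes lin: "\<And>l. linear (A l)" and ell: "C_elliptic A"
  shows "\<exists>m. \<forall>i j. \<exists>B :: 'K \<Rightarrow> ('n \<Rightarrow> nat) \<Rightarrow> complex. (\<forall>\<kappa>. finite {\<alpha>. B \<kappa> \<alpha> \<noteq> 0}) \<and>
     (\<forall>j' \<alpha>. (\<Sum>\<kappa>\<in>UNIV. \<Sum>l\<in>UNIV. of_real (A l (axis j' 1) $ \<kappa>) * shift l (B \<kappa>) \<alpha>)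
        = (if j' = j \<and> \<alpha> = (\<lambda>_. 0)(i := m) then 1 else 0))"
proof -
  define J0 :: "('N \<Rightarrow> ('n \<Rightarrow> nat) \<Rightarrow> complex) set" where
    "J0 = {f. \<exists>B :: 'K \<Rightarrow> ('n \<Rightarrow> nat) \<Rightarrow> complex. (\<forall>\<kappa>. finite {\<alpha>. B \<kappa> \<alpha> \<noteq> 0}) \<and>
     (\<forall>j' \<alpha>. (\<Sum>\<kappa>\<in>UNIV. \<Sum>l\<in>UNIV. of_real (A l (axis j' 1) $ \<kappa>) * shift l (B \<kappa>) \<alpha>) = f j' \<alpha>)}"
  let ?D = "\<lambda>(l::'n) f (j::'N). shift l (f j :: ('n \<Rightarrow> nat) \<Rightarrow> complex)"
  let ?S = "range unit_poly :: ('N \<Rightarrow> ('n \<Rightarrow> nat) \<Rightarrow> complex) set"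
  have J0I: "f \<in> J0" if "\<And>\<kappa>. finite {\<alpha>. B \<kappa> \<alpha> \<noteq> 0}" "\<And>j' \<alpha>. (\<Sum>\<kappa>\<in>UNIV. \<Sum>l\<in>UNIV. of_real (A l (axis j' 1) $ \<kappa>) * shift l (B \<kappa>) \<alpha>) = f j' \<alpha>" for B f
    using that unfolding J0_def by blast
  have sub: "poly_ops.submod J0"
    unfolding poly_ops.submod_def
  proof (intro conjI allI ballI poly_ops.subspaceI)
    show "0 \<in> J0" by (rule J0I[of "\<lambda>_ _. 0"]) (auto simp: shift_def)
    show "(\<lambda>j \<alpha>. c * f j \<alpha>) \<in> J0" if f: "f \<in> J0" for c f
    proof -
      obtain B where B: "\<And>\<kappa>. finite {\<alpha>. B \<kappa> \<alpha> \<noteq> 0}" "\<And>j' \<alpha>. (\<Sum>\<kappa>\<in>UNIV. \<Sum>l\<in>UNIV. of_real (A l (axis j' 1) $ \<kappa>) * shift l (B \<kappa>) \<alpha>) = f j' \<alpha>"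
        using f unfolding J0_def by blast
      show ?thesis
        by (intro J0I[of "\<lambda>\<kappa> \<alpha>. c * B \<kappa> \<alpha>"])
           (auto simp: shift_mult B(2)[symmetric] sum_distrib_left mult.left_commute intro: finite_subset[OF _ B(1)])
    qed
    fix f assume f: "f \<in> J0"
    then obtain B where B: "\<And>\<kappa>. finite {\<alpha>. B \<kappa> \<alpha> \<noteq> 0}" "\<And>j' \<alpha>. (\<Sum>\<kappa>\<in>UNIV. \<Sum>l\<in>UNIV. of_real (A l (axis j' 1) $ \<kappa>) * shift l (B \<kappa>) \<alpha>) = f j' \<alpha>"
      unfolding J0_def by blast
    show "f + g \<in> J0" if g: "g \<in> J0" for g
    proof -
      obtain B' where B': "\<And>\<kappa>. finite {\<alpha>. B' \<kappa> \<alpha> \<noteq> 0}" "\<And>j' \<alpha>. (\<Sum>\<kappa>\<in>UNIV. \<Sum>l\<in>UNIV. of_real (A l (axis j' 1) $ \<kappa>) * shift l (B' \<kappa>) \<alpha>) = g j' \<alpha>"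
        using g unfolding J0_def by blast
      have s: "shift l (\<lambda>\<alpha>. B \<kappa> \<alpha> + B' \<kappa> \<alpha>) \<alpha> = shift l (B \<kappa>) \<alpha> + shift l (B' \<kappa>) \<alpha>" for l \<kappa> \<alpha> by (simp add: shift_def)
      have "finite {\<alpha>. B \<kappa> \<alpha> + B' \<kappa> \<alpha> \<noteq> 0}" for \<kappa>
        by (rule finite_subset[OF _ finite_UnI[OF B(1)[of \<kappa>] B'(1)[of \<kappa>]]]) auto
      then show ?thesis
        by (intro J0I[of "\<lambda>\<kappa> \<alpha>. B \<kappa> \<alpha> + B' \<kappa> \<alpha>"])
           (auto simp: s B(2)[symmetric] B'(2)[symmetric] sum.distrib distrib_left)
    qed
    show "?D i f \<in> J0" for i
    proof (rule J0I[of "\<lambda>\<kappa>. shift i (B \<kappa>)"])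
      show "finite {\<alpha>. shift i (B \<kappa>) \<alpha> \<noteq> 0}" for \<kappa> by (rule finite_shift_support[OF B(1)])
      show "(\<Sum>\<kappa>\<in>UNIV. \<Sum>l\<in>UNIV. of_real (A l (axis j' 1) $ \<kappa>) * shift l (shift i (B \<kappa>)) \<alpha>) = ?D i f j' \<alpha>" for j' \<alpha>
        unfolding shift_commute[of _ i] by (subst shift_def[of i], subst shift_def[of i]) (simp add: B(2)[symmetric])
    qed
  qed
  have ex: "\<exists>k. \<forall>s\<in>?S. (?D i ^^ k) s \<in> J0" for i
  proof (rule ccontr)
    assume "\<not> ?thesis"
    then have nn: "poly_ops.nonnil i ?S J0" unfolding poly_ops.nonnil_def by blast
    obtain J c where J: "J0 \<subseteq> J" "poly_ops.submod J" "c i = 1"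
      "\<And>l s. s \<in> ?S \<Longrightarrow> ?D l s - (\<lambda>j \<alpha>. c l * ?D i s j \<alpha>) \<in> J" "\<exists>s\<in>?S. ?D i s \<notin> J"
      by (rule poly_ops.nullstellensatz[OF _ sub nn]) auto
    let ?c = "(\<chi> l. c l) :: complex^'n"
    define M :: "complex^'N^'K" where "M = (\<chi> \<kappa> j. \<Sum>l\<in>UNIV. c l * of_real (A l (axis j 1) $ \<kappa>))"
    have "op_symbol A ?c = (*v) M"
      by (simp add: fun_eq_iff vec_eq_iff op_symbol_nth[OF lin] M_def matrix_vector_mult_def)
    moreover have "?c \<noteq> 0" using J(3) by (metis vec_lambda_beta zero_index zero_neq_one)
    ultimately have "inj ((*v) M)" using ell unfolding C_elliptic_def by metis
    then obtain L where L: "L ** M = mat 1" using matrix_left_invertible_injective by blast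
    have LM: "(\<Sum>\<kappa>\<in>UNIV. L $ j $ \<kappa> * M $ \<kappa> $ j') = (if j = j' then 1 else 0)" for j j'
      using arg_cong[OF L, of "\<lambda>X. X $ j $ j'"] by (simp add: matrix_matrix_mult_def mat_def)
    have "?D i (unit_poly j) \<in> J" for j
    proof -
      define w where "w l j' = (\<Sum>\<kappa>\<in>UNIV. L $ j $ \<kappa> * of_real (A l (axis j' 1) $ \<kappa>))" for l j'
      define B :: "'K \<Rightarrow> ('n \<Rightarrow> nat) \<Rightarrow> complex" where "B \<kappa> \<alpha> = (if \<alpha> = (\<lambda>_. 0) then L $ j $ \<kappa> else 0)" for \<kappa> \<alpha>
      define F where "F j' \<alpha> = (\<Sum>\<kappa>\<in>UNIV. \<Sum>l\<in>UNIV. of_real (A l (axis j' 1) $ \<kappa>) * shift l (B \<kappa>) \<alpha>)" for j' \<alpha>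
      have "F \<in> J0"
        by (rule J0I[of B]) (auto simp: F_def B_def)
      then have "F \<in> J" using J by blast
      have F: "F j' \<alpha> = (\<Sum>l\<in>UNIV. w l j' * ?D l (unit_poly j') j' \<alpha>)" for j' \<alpha>
      proof -
        have sB: "shift l (B \<kappa>) \<alpha> = L $ j $ \<kappa> * shift l (unit_poly j' j') \<alpha>" for l \<kappa>
          by (auto simp: shift_def B_def unit_poly_def)
        show ?thesis unfolding F_def w_def sB
          by (subst sum.swap) (simp add: sum_distrib_left sum_distrib_right algebra_simps)
      qed
      \<comment> \<open>E collects the errors made in F when each X_l is replaced by c_l X_i. Every
        summand lies in J, and by L ** M = 1 what remains of F is X_i e_j.\<close>
      define E where "E = (\<Sum>l\<in>UNIV. \<Sum>j'\<in>UNIV. (\<lambda>k \<alpha>. w l j' * (?D l (unit_poly j') - (\<lambda>k \<alpha>. c l * ?D i (unit_poly j') k \<alpha>)) k \<alpha>))"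
      have "E \<in> J" unfolding E_def
      proof (intro poly_ops.subspace_sum)
        show "poly_ops.subspace J" using J(2) by (simp add: poly_ops.submod_def)
        then show "poly_ops.subspace J" .
        show "(\<lambda>k \<alpha>. w l j' * (?D l (unit_poly j') - (\<lambda>k \<alpha>. c l * ?D i (unit_poly j') k \<alpha>)) k \<alpha>) \<in> J" for l j'
          by (rule poly_ops.submodD(3)[OF J(2) J(4)]) simp
      qed
      have un: "j'' \<noteq> j' \<Longrightarrow> unit_poly j'' j' = (\<lambda>_. 0)" for j'' j' :: 'N
        by (auto simp: unit_poly_def fun_eq_iff)
      have s0: "shift l (\<lambda>_. 0) \<alpha> = 0" for l and \<alpha> :: "'n \<Rightarrow> nat" by (simp add: shift_def)
      have fs: "sum f U k \<alpha> = (\<Sum>l\<in>U. f l k \<alpha>)" for f :: "'z \<Rightarrow> 'N \<Rightarrow> ('n \<Rightarrow> nat) \<Rightarrow> complex" and U k \<alpha>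
        by (induction U rule: infinite_finite_induct) auto
      have E: "E k \<alpha> = F k \<alpha> - (\<Sum>l\<in>UNIV. w l k * c l) * ?D i (unit_poly k) k \<alpha>" for k \<alpha>
      proof -
        have "E k \<alpha> = (\<Sum>l\<in>UNIV. \<Sum>j'\<in>UNIV. w l j' * (shift l (unit_poly j' k) \<alpha> - c l * shift i (unit_poly j' k) \<alpha>))"
          by (simp add: E_def fs)
        also have "\<dots> = (\<Sum>l\<in>UNIV. \<Sum>j'\<in>UNIV. if j' = k then w l k * (shift l (unit_poly k k) \<alpha> - c l * shift i (unit_poly k k) \<alpha>) else 0)"
          by (intro sum.cong refl) (auto simp: un s0)
        also have "\<dots> = F k \<alpha> - (\<Sum>l\<in>UNIV. w l k * c l) * ?D i (unit_poly k) k \<alpha>"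
          by (simp add: F sum_subtractf right_diff_distrib sum_distrib_right mult.assoc)
        finally show ?thesis .
      qed
      have wc: "(\<Sum>l\<in>UNIV. w l k * c l) = (if j = k then 1 else 0)" for k
      proof -
        have "(\<Sum>l\<in>UNIV. w l k * c l) = (\<Sum>\<kappa>\<in>UNIV. L $ j $ \<kappa> * M $ \<kappa> $ k)"
          unfolding w_def M_def by (simp add: sum_distrib_left sum_distrib_right algebra_simps) (rule sum.swap)
        then show ?thesis using LM by simp
      qed
      have "F - E = ?D i (unit_poly j)"
        by (auto simp: fun_eq_iff E wc un s0)
      then show ?thesis using poly_ops.submodD(5)[OF J(2) \<open>F \<in> J\<close> \<open>E \<in> J\<close>] by simp
    qed
    then show False using J(5) by blast
  qed
  then obtain kk where kk: "\<And>i j. (?D i ^^ (kk i)) (unit_poly j) \<in> J0" by (metis rangeI)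
  \<comment> \<open>\<open>J0\<close> absorbs higher powers, so the sum of the exponents is one
    exponent for all i.\<close>
  define m where "m = (\<Sum>i\<in>UNIV. kk i)"
  have "(?D i ^^ m) (unit_poly j) \<in> J0" for i j
  proof -
    have "kk i \<le> m" unfolding m_def by (intro member_le_sum) auto
    then have "m = (m - kk i) + kk i" by simp
    then have "(?D i ^^ m) (unit_poly j) = (?D i ^^ (m - kk i)) ((?D i ^^ (kk i)) (unit_poly j))"
      by (metis funpow_add comp_apply)
    then show ?thesis using poly_ops.submod_pow[OF sub kk] by metis
  qed
  then show ?thesis
    unfolding J0_def mem_Collect_eq shift_pow_unit by blast
qed

text \<open>The symbol has real coefficients, so the real parts of a complex solution solve the same
  system.\<close>

lemma elliptic_reduction:
  fixes A :: "'n::finite \<Rightarrow> real^'N::finite \<Rightarrow> real^'K::finite"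
  assumes lin: "\<And>l. linear (A l)" and ell: "C_elliptic A"
  shows "\<exists>m. \<forall>i j. \<exists>B :: 'K \<Rightarrow> ('n \<Rightarrow> nat) \<Rightarrow> real. (\<forall>\<kappa>. finite {\<alpha>. B \<kappa> \<alpha> \<noteq> 0}) \<and>
     (\<forall>j' \<alpha>. (\<Sum>\<kappa>\<in>UNIV. \<Sum>l\<in>UNIV. A l (axis j' 1) $ \<kappa> * shift l (B \<kappa>) \<alpha>)
        = (if j' = j \<and> \<alpha> = (\<lambda>_. 0)(i := m) then 1 else 0))"
proof -
  obtain m where m: "\<forall>i j. \<exists>B :: 'K \<Rightarrow> ('n \<Rightarrow> nat) \<Rightarrow> complex. (\<forall>\<kappa>. finite {\<alpha>. B \<kappa> \<alpha> \<noteq> 0}) \<and>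
     (\<forall>j' \<alpha>. (\<Sum>\<kappa>\<in>UNIV. \<Sum>l\<in>UNIV. of_real (A l (axis j' 1) $ \<kappa>) * shift l (B \<kappa>) \<alpha>)
        = (if j' = j \<and> \<alpha> = (\<lambda>_. 0)(i := m) then 1 else 0))"
    using elliptic_reduction_complex[OF assms] by blast
  show ?thesis
  proof (rule exI[of _ m], intro allI)
    fix i j
    obtain B :: "'K \<Rightarrow> ('n \<Rightarrow> nat) \<Rightarrow> complex" where B: "\<And>\<kappa>. finite {\<alpha>. B \<kappa> \<alpha> \<noteq> 0}"
       "\<And>j' \<alpha>. (\<Sum>\<kappa>\<in>UNIV. \<Sum>l\<in>UNIV. of_real (A l (axis j' 1) $ \<kappa>) * shift l (B \<kappa>) \<alpha>)
        = (if j' = j \<and> \<alpha> = (\<lambda>_. 0)(i := m) then 1 else 0)" using m by meson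
    have s: "shift l (\<lambda>\<alpha>. Re (B \<kappa> \<alpha>)) \<alpha> = Re (shift l (B \<kappa>) \<alpha>)" for l \<kappa> \<alpha> by (simp add: shift_def)
    have "finite {\<alpha>. Re (B \<kappa> \<alpha>) \<noteq> 0}" for \<kappa>
      by (rule finite_subset[OF _ B(1)[of \<kappa>]]) auto
    moreover have "(\<Sum>\<kappa>\<in>UNIV. \<Sum>l\<in>UNIV. A l (axis j' 1) $ \<kappa> * shift l (\<lambda>\<alpha>. Re (B \<kappa> \<alpha>)) \<alpha>)
        = (if j' = j \<and> \<alpha> = (\<lambda>_. 0)(i := m) then 1 else 0)" for j' \<alpha>
      using arg_cong[OF B(2)[of j' \<alpha>], of Re] by (simp add: s Re_sum)
    ultimately show "\<exists>B :: 'K \<Rightarrow> ('n \<Rightarrow> nat) \<Rightarrow> real. (\<forall>\<kappa>. finite {\<alpha>. B \<kappa> \<alpha> \<noteq> 0}) \<and>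
     (\<forall>j' \<alpha>. (\<Sum>\<kappa>\<in>UNIV. \<Sum>l\<in>UNIV. A l (axis j' 1) $ \<kappa> * shift l (B \<kappa>) \<alpha>)
        = (if j' = j \<and> \<alpha> = (\<lambda>_. 0)(i := m) then 1 else 0))"
      by (intro exI[of _ "\<lambda>\<kappa> \<alpha>. Re (B \<kappa> \<alpha>)"]) auto
  qed
qed


section \<open>Smooth kernels on the line with vanishing moments\<close>

text \<open>Continuity of the n-th derivative is left to order n + 1; all orders together give
  smoothness.\<close>

primrec Ck :: "nat \<Rightarrow> (real \<Rightarrow> real) \<Rightarrow> bool" where
  "Ck 0 f = True"
| "Ck (Suc n) f = (\<exists>f'. (\<forall>x. (f has_real_derivative f' x) (at x)) \<and> Ck n f')"

lemma Ck_SucI: "(\<And>x. (f has_real_derivative f' x) (at x)) \<Longrightarrow> Ck n f' \<Longrightarrow> Ck (Suc n) f"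
  by auto

definition smooth :: "(real \<Rightarrow> real) \<Rightarrow> bool" where
  "smooth f \<longleftrightarrow> (\<forall>n. Ck n f)"

lemma smooth_DERIV:
  assumes "smooth f" shows "(f has_real_derivative deriv f x) (at x)"
proof -
  have "Ck 1 f" using assms by (simp only: smooth_def)
  then show ?thesis by (auto intro: DERIV_imp_deriv[THEN ssubst])
qed

lemma smooth_deriv:
  assumes "smooth f" shows "smooth (deriv f)"
  unfolding smooth_def
proof
  fix n
  have "Ck (Suc n) f" using assms by (simp only: smooth_def)
  then obtain f' where f': "\<And>x. (f has_real_derivative f' x) (at x)" "Ck n f'" by auto
  then have "deriv f = f'" by (auto intro: DERIV_imp_deriv)
  then show "Ck n (deriv f)" using f' by simp
qed

lemma smoothI:
  assumes "\<And>x. (f has_real_derivative f' x) (at x)" "smooth f'" shows "smooth f"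
  unfolding smooth_def
proof
  show "Ck n f" for n
    using assms by (cases n) (auto simp: smooth_def)
qed

lemma smooth_deriv_pow: "smooth f \<Longrightarrow> smooth ((deriv ^^ k) f)"
  by (induction k) (auto intro: smooth_deriv)

lemma smooth_continuous: "smooth f \<Longrightarrow> continuous_on S f"
  using smooth_DERIV by (meson DERIV_isCont continuous_at_imp_continuous_on)

lemma Ck_Suc: "Ck (Suc n) f \<Longrightarrow> Ck n f"
  by (induction n arbitrary: f) auto

lemma Ck_add: "Ck n f \<Longrightarrow> Ck n g \<Longrightarrow> Ck n (\<lambda>x. f x + g x)"
proof (induction n arbitrary: f g)
  case (Suc n)
  then obtain f' g' where "\<And>x. (f has_real_derivative f' x) (at x)" "Ck n f'"
    "\<And>x. (g has_real_derivative g' x) (at x)" "Ck n g'" by auto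
  then show ?case using Suc.IH
    by (auto intro!: exI[of _ "\<lambda>x. f' x + g' x"] derivative_intros)
qed auto

lemma Ck_mult: "Ck n f \<Longrightarrow> Ck n g \<Longrightarrow> Ck n (\<lambda>x. f x * g x)"
proof (induction n arbitrary: f g)
  case (Suc n)
  then obtain f' g' where *: "\<And>x. (f has_real_derivative f' x) (at x)" "Ck n f'"
    "\<And>x. (g has_real_derivative g' x) (at x)" "Ck n g'" by auto
  have "((\<lambda>x. f x * g x) has_real_derivative f x * g' x + f' x * g x) (at x)" for x
    using DERIV_mult'[OF *(1) *(3)] by simp
  moreover have "Ck n (\<lambda>x. f x * g' x + f' x * g x)"
    by (rule Ck_add[OF Suc.IH[OF Ck_Suc[OF Suc.prems(1)] *(4)] Suc.IH[OF *(2) Ck_Suc[OF Suc.prems(2)]]])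
  ultimately show ?case by (rule Ck_SucI)
qed auto

lemma Ck_const: "Ck n (\<lambda>x. c)"
proof (induction n arbitrary: c)
  case (Suc n)
  show ?case unfolding Ck.simps by (intro exI[of _ "\<lambda>x. 0"]) (auto simp: Suc)
qed auto

lemma Ck_affine: "Ck n f \<Longrightarrow> Ck n (\<lambda>x. f (a * x + b))"
proof (induction n arbitrary: f)
  case (Suc n)
  then obtain f' where *: "\<And>x. (f has_real_derivative f' x) (at x)" "Ck n f'" by auto
  have "((\<lambda>x. f (a * x + b)) has_real_derivative a * f' (a * x + b)) (at x)" for x
  proof -
    have "((\<lambda>x. a * x + b) has_real_derivative a) (at x)" by (auto intro!: derivative_eq_intros)
    from DERIV_chain2[OF *(1) this] show ?thesis by (simp add: mult.commute)
  qed
  moreover have "Ck n (\<lambda>x. a * f' (a * x + b))"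
    by (intro Ck_mult Ck_const Suc.IH *)
  ultimately show ?case by (rule Ck_SucI)
qed auto

lemma smooth_add: "smooth f \<Longrightarrow> smooth g \<Longrightarrow> smooth (\<lambda>x. f x + g x)"
  and smooth_mult: "smooth f \<Longrightarrow> smooth g \<Longrightarrow> smooth (\<lambda>x. f x * g x)"
  and smooth_const: "smooth (\<lambda>x. c)"
  and smooth_affine: "smooth f \<Longrightarrow> smooth (\<lambda>x. f (a * x + b))"
  by (simp_all add: smooth_def Ck_add Ck_mult Ck_const Ck_affine)

section \<open>Flat functions built from exp (-1/t)\<close>

lemma poly_div_exp_tendsto_0: "((\<lambda>x. poly p x * exp (- x)) \<longlongrightarrow> 0) at_top" for p :: "real poly"
proof -
  have "((\<lambda>x. \<Sum>i\<le>degree p. coeff p i * (x ^ i / exp x)) \<longlongrightarrow> (\<Sum>i\<le>degree p. coeff p i * 0)) at_top"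
    by (intro tendsto_sum tendsto_mult tendsto_const tendsto_power_div_exp_0)
  moreover have "(\<lambda>x. poly p x * exp (- x)) = (\<lambda>x. \<Sum>i\<le>degree p. coeff p i * (x ^ i / exp x))"
    by (simp add: poly_altdef sum_distrib_right exp_minus divide_inverse mult.assoc)
  ultimately show ?thesis by simp
qed

definition flat :: "real poly \<Rightarrow> real \<Rightarrow> real" where
  "flat p t = (if t \<le> 0 then 0 else poly p (inverse t) * exp (- inverse t))"

text \<open>The polynomial factor is carried so that the family is closed under differentiation: for
  t > 0 the chain rule replaces p by x^2 (p - p'), and at 0 the exponential beats every polynomial
  in 1/t. Smoothness is then an induction.\<close>

lemma flat_DERIV: "(flat p has_real_derivative flat ([:0, 0, 1:] * (p - pderiv p)) t) (at t)"
proof -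
  consider "t > 0" | "t < 0" | "t = 0" by linarith
  then show ?thesis
  proof cases
    case 1
    have "((\<lambda>t. poly p (inverse t) * exp (- inverse t)) has_real_derivative
        flat ([:0, 0, 1:] * (p - pderiv p)) t) (at t)"
    proof -
      have i: "((\<lambda>t. inverse t) has_real_derivative - (inverse t ^ 2)) (at t)"
        using DERIV_inverse[of t] 1 by (simp add: power2_eq_square)
      have "((\<lambda>t. poly p (inverse t)) has_real_derivative poly (pderiv p) (inverse t) * - (inverse t ^ 2)) (at t)"
        by (rule DERIV_chain2[OF poly_DERIV i])
      moreover have "((\<lambda>t. exp (- inverse t)) has_real_derivative exp (- inverse t) * (inverse t ^ 2)) (at t)"
        using DERIV_chain2[OF DERIV_exp DERIV_minus[OF i]] by simp
      ultimately show ?thesis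
        by (rule DERIV_cong[OF DERIV_mult])
           (use 1 in \<open>simp add: flat_def power2_eq_square algebra_simps\<close>)
    qed
    then show ?thesis
      by (rule has_field_derivative_transform_within_open[of _ _ _ "{0<..}"]) (use 1 in \<open>auto simp: flat_def\<close>)
  next
    case 2
    have "((\<lambda>t. 0) has_real_derivative flat ([:0, 0, 1:] * (p - pderiv p)) t) (at t)"
      using 2 by (simp add: flat_def)
    then show ?thesis
      by (rule has_field_derivative_transform_within_open[of _ _ _ "{..<0}"]) (use 2 in \<open>auto simp: flat_def\<close>)
  next
    case 3
    have "((\<lambda>h. (flat p h - flat p 0) / h) \<longlongrightarrow> 0) (at 0)"
      unfolding filterlim_at_split
    proof
      have "((\<lambda>h. 0) \<longlongrightarrow> (0::real)) (at_left 0)" by simp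
      then show "((\<lambda>h. (flat p h - flat p 0) / h) \<longlongrightarrow> 0) (at_left 0)"
        by (rule Lim_transform_eventually)
           (auto simp: flat_def eventually_at_filter intro!: always_eventually)
      have "((\<lambda>h. poly (pCons 0 p) (inverse h) * exp (- inverse h)) \<longlongrightarrow> 0) (at_right 0)"
        by (rule filterlim_compose[OF poly_div_exp_tendsto_0 filterlim_inverse_at_top_right])
      then show "((\<lambda>h. (flat p h - flat p 0) / h) \<longlongrightarrow> 0) (at_right (0::real))"
        by (rule Lim_transform_eventually)
           (auto simp: flat_def eventually_at_filter field_simps intro!: always_eventually)
    qed
    then show ?thesis using 3 by (simp add: has_field_derivative_iff flat_def)
  qed
qed

lemma smooth_flat: "smooth (flat p)"
proof -
  have "Ck n (flat p)" for n
  proof (induction n arbitrary: p)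
    case (Suc n)
    then show ?case using flat_DERIV by (auto intro!: exI[of _ "flat ([:0, 0, 1:] * (p - pderiv p))"])
  qed auto
  then show ?thesis by (simp add: smooth_def)
qed

section \<open>Test functions on an interval and their moments\<close>

definition test_fn :: "real \<Rightarrow> real \<Rightarrow> (real \<Rightarrow> real) \<Rightarrow> bool" where
  "test_fn a b f \<longleftrightarrow> smooth f \<and> (\<forall>t. t \<notin> {a..b} \<longrightarrow> f t = 0)"

lemma test_fn_integrable:
  assumes "continuous_on UNIV f" "\<And>t. t \<notin> {a..b} \<Longrightarrow> f t = 0"
  shows "integrable lborel (f :: real \<Rightarrow> real)"
proof -
  have "integrable lborel (\<lambda>x. indicator {a..b} x *\<^sub>R f x)"
    by (intro borel_integrable_compact compact_Icc continuous_on_subset[OF assms(1)]) auto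
  moreover have "(\<lambda>x. indicator {a..b} x *\<^sub>R f x) = f" using assms(2) by (auto simp: fun_eq_iff indicator_def)
  ultimately show ?thesis by simp
qed

lemma lborel_integral_deriv_0:
  assumes "\<And>x. (F has_real_derivative f x) (at x)" "continuous_on UNIV f"
    "\<And>t. t \<notin> {a..b} \<Longrightarrow> F t = 0" "\<And>t. t \<notin> {a..b} \<Longrightarrow> f t = 0"
  shows "(LINT t|lborel. f t) = 0"
proof -
  \<comment> \<open>One unit beyond both endpoints F vanishes, and the interval is in the right
    order even if b < a.\<close>
  let ?c = "min a b - 1" let ?d = "max a b + 1"
  have "(LINT t|lborel. indicator {?c..?d} t *\<^sub>R f t) = F ?d - F ?c"
    by (rule integral_FTC_atLeastAtMost)
       (use assms in \<open>auto simp: has_real_derivative_iff_has_vector_derivative[symmetric] intro: DERIV_subset continuous_on_subset\<close>)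
  also have "(\<lambda>t. indicator {?c..?d} t *\<^sub>R f t) = f"
  proof
    show "indicator {?c..?d} t *\<^sub>R f t = f t" for t
      using assms(4)[of t] by (cases "t \<in> {a..b}") (auto simp: indicator_def)
  qed
  also have "F ?d - F ?c = 0"
  proof -
    have "?d \<notin> {a..b}" "?c \<notin> {a..b}" by (auto simp: min_def max_def)
    then show ?thesis using assms(3) by simp
  qed
  finally show ?thesis .
qed

lemma test_fn_deriv:
  assumes "test_fn a b f" shows "test_fn a b (deriv f)"
proof -
  have "deriv f t = 0" if "t \<notin> {a..b}" for t
  proof (rule DERIV_imp_deriv)
    have "((\<lambda>_. 0) has_real_derivative 0) (at t)" by simp
    then show "(f has_real_derivative 0) (at t)"
      by (rule has_field_derivative_transform_within_open[of _ _ _ "- {a..b}"])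
         (use that assms in \<open>auto simp: test_fn_def\<close>)
  qed
  then show ?thesis using assms by (simp add: test_fn_def smooth_deriv)
qed

lemma test_fn_deriv_pow: "test_fn a b f \<Longrightarrow> test_fn a b ((deriv ^^ k) f)"
  by (induction k) (auto intro: test_fn_deriv)

definition moment :: "nat \<Rightarrow> (real \<Rightarrow> real) \<Rightarrow> real" where
  "moment i f = (LINT t|lborel. t ^ i * f t)"

lemma moment_integrable:
  assumes "test_fn a b f" shows "integrable lborel (\<lambda>t. t ^ i * f t)"
proof (rule test_fn_integrable[of _ a b])
  show "continuous_on UNIV (\<lambda>t. t ^ i * f t)"
    using assms unfolding test_fn_def
    by (intro continuous_on_mult continuous_on_power continuous_on_id smooth_continuous) auto
qed (use assms in \<open>auto simp: test_fn_def\<close>)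

text \<open>Integration by parts. For i = 0 the truncated \<open>i - 1\<close> is harmless because
  of the factor \<open>real i\<close>.\<close>

lemma moment_deriv:
  assumes "test_fn a b f" shows "moment i (deriv f) = - real i * moment (i - 1) f"
proof -
  have "(LINT t|lborel. t ^ i * deriv f t + real i * (t ^ (i - 1) * f t)) = 0"
  proof (rule lborel_integral_deriv_0[of "\<lambda>t. t ^ i * f t" _ a b])
    show "((\<lambda>t. t ^ i * f t) has_real_derivative x ^ i * deriv f x + real i * (x ^ (i - 1) * f x)) (at x)" for x
      by (rule derivative_eq_intros smooth_DERIV refl | use assms in \<open>simp add: test_fn_def\<close>)+
    show "continuous_on UNIV (\<lambda>t. t ^ i * deriv f t + real i * (t ^ (i - 1) * f t))"
      using assms unfolding test_fn_def
      by (intro continuous_on_add continuous_on_mult continuous_on_power continuous_on_id continuous_on_const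
          smooth_continuous smooth_deriv) auto
  qed (use assms test_fn_deriv[OF assms] in \<open>auto simp: test_fn_def\<close>)
  moreover have "(LINT t|lborel. t ^ i * deriv f t + real i * (t ^ (i - 1) * f t)) =
      moment i (deriv f) + real i * moment (i - 1) f"
    unfolding moment_def
    by (subst Bochner_Integration.integral_add)
       (auto intro: moment_integrable assms test_fn_deriv)
  ultimately show ?thesis by simp
qed

text \<open>A multiple of an m-th derivative changes the m-th moment and leaves the lower ones
  alone; \<open>moment_function_exists\<close> uses it as a correction term.\<close>

lemma moment_deriv_pow:
  assumes "test_fn a b f"
  shows "i \<le> m \<Longrightarrow> moment i ((deriv ^^ m) f) = (if i = m then (-1) ^ m * fact m * moment 0 f else 0)"
proof (induction m arbitrary: i)
  case (Suc m)
  have "moment i ((deriv ^^ Suc m) f) = - real i * moment (i - 1) ((deriv ^^ m) f)"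
    using moment_deriv[OF test_fn_deriv_pow[OF assms]] by simp
  then show ?case using Suc by (cases i) (auto simp: algebra_simps)
qed auto

text \<open>The antiderivative that vanishes left of a is constant right of b, and this constant is
  the mass of f.\<close>

lemma test_fn_antideriv:
  assumes "test_fn a b f" "moment 0 f = 0" "a \<le> b"
  shows "\<exists>F. test_fn a b F \<and> deriv F = f"
proof -
  have cont: "continuous_on UNIV f" using assms smooth_continuous by (auto simp: test_fn_def)
  obtain F0 where "\<And>x. (F0 has_vector_derivative f x) (at x)"
    using einterval_antiderivative[of "-\<infinity>" \<infinity> f] cont by (auto simp: continuous_on_eq_continuous_at)
  then have F0: "(F0 has_real_derivative f x) (at x)" for x by (simp add: has_real_derivative_iff_has_vector_derivative)
  define F where "F x = F0 x - F0 a" for x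
  have F: "(F has_real_derivative f x) (at x)" for x
    unfolding F_def using F0[of x] by (auto intro!: derivative_eq_intros)
  have flat: "F y = F x" if "x \<le> y" "\<And>t. x < t \<Longrightarrow> t < y \<Longrightarrow> f t = 0" for x y
  proof (cases "x = y")
    case False
    then have "x < y" using that by simp
    have "continuous_on {x..y} F" using F by (meson DERIV_isCont continuous_at_imp_continuous_on)
    then show ?thesis
      using DERIV_isconst_end[OF \<open>x < y\<close>, of F] F that(2) by metis
  qed simp
  have "F t = 0" if "t \<notin> {a..b}" for t
  proof (cases "t < a")
    case True
    then have "F a = F t" using assms by (intro flat) (auto simp: test_fn_def)
    then show ?thesis by (simp add: F_def)
  next
    case False
    then have "F t = F b" using that assms by (intro flat) (auto simp: test_fn_def)
    also have "(LINT t|lborel. indicator {a..b} t *\<^sub>R f t) = F b - F a"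
      by (rule integral_FTC_atLeastAtMost)
         (use assms F cont in \<open>auto simp: has_real_derivative_iff_has_vector_derivative[symmetric] intro: DERIV_subset continuous_on_subset\<close>)
    then have "F b = F a + (LINT t|lborel. indicator {a..b} t *\<^sub>R f t)" by simp
    also have "(\<lambda>t. indicator {a..b} t *\<^sub>R f t) = f" using assms by (auto simp: test_fn_def fun_eq_iff indicator_def)
    also have "F a + (LINT t|lborel. f t) = 0" using assms(2) by (simp add: moment_def F_def)
    finally show ?thesis .
  qed
  then have "test_fn a b F" using F assms by (auto simp: test_fn_def intro: smoothI)
  moreover have "deriv F = f" using F by (auto intro: DERIV_imp_deriv)
  ultimately show ?thesis by blast
qed

text \<open>By \<open>moment_deriv\<close>, taking an antiderivative shifts the vanishing moments
  down by one index, so m of them allow m successive compactly supported antiderivatives.\<close>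

lemma test_fn_antideriv_pow:
  assumes "test_fn a b f" "\<And>i. i < m \<Longrightarrow> moment i f = 0" "a \<le> b"
  shows "\<exists>F. test_fn a b F \<and> (deriv ^^ m) F = f"
  using assms(1,2)
proof (induction m arbitrary: f)
  case (Suc m)
  obtain F where F: "test_fn a b F" "deriv F = f" using test_fn_antideriv Suc.prems assms(3) by blast
  have "moment i F = 0" if "i < m" for i
    using moment_deriv[OF F(1), of "Suc i"] Suc.prems(2)[of "Suc i"] that F(2) by simp
  then obtain G where "test_fn a b G" "(deriv ^^ m) G = F" using Suc.IH[OF F(1)] by blast
  then show ?case using F by (intro exI[of _ G]) auto
qed auto

lemma test_fn_normalized_exists:
  assumes "a < b" shows "\<exists>f. test_fn a b f \<and> moment 0 f = 1"
proof -
  define f where "f t = flat 1 (1 * t + (- a)) * flat 1 (-1 * t + b)" for t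
  have "smooth f" unfolding f_def by (intro smooth_mult smooth_affine smooth_flat)
  then have f: "test_fn a b f" by (auto simp: test_fn_def f_def flat_def)
  have nn: "f t \<ge> 0" for t by (auto simp: f_def flat_def)
  have "moment 0 f \<noteq> 0"
  proof
    assume "moment 0 f = 0"
    then have "AE t in lborel. f t = 0"
      using integral_nonneg_eq_0_iff_AE[OF moment_integrable[OF f, of 0]] nn by (simp add: moment_def)
    moreover have "f t \<noteq> 0" if "t \<in> {a<..<b}" for t using that by (auto simp: f_def flat_def)
    ultimately have "AE t in lborel. t \<notin> {a<..<b}" by (auto elim: eventually_mono)
    then have "emeasure lborel {a<..<b} = 0"
      by (subst (asm) AE_iff_measurable[of "{a<..<b}"]) auto
    then show False using assms by simp
  qed
  then have "moment 0 (\<lambda>t. inverse (moment 0 f) * f t) = 1"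
    by (simp add: moment_def)
  moreover have "test_fn a b (\<lambda>t. inverse (moment 0 f) * f t)"
    using f by (auto simp: test_fn_def intro: smooth_mult smooth_const)
  ultimately show ?thesis by blast
qed

lemma moment_function_exists:
  assumes "a < b" shows "\<exists>f. test_fn a b f \<and> moment 0 f = 1 \<and> (\<forall>i. 0 < i \<and> i < m \<longrightarrow> moment i f = 0)"
proof (induction m)
  case 0
  then show ?case using test_fn_normalized_exists[OF assms] by auto
next
  case (Suc m)
  obtain f where f: "test_fn a b f" "moment 0 f = 1" "\<forall>i. 0 < i \<and> i < m \<longrightarrow> moment i f = 0"
    using Suc by blast
  show ?case
  proof (cases "m = 0")
    case False
    obtain p where p: "test_fn a b p" "moment 0 p = 1" using test_fn_normalized_exists[OF assms] by blast
    define q where "q = (deriv ^^ m) p"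
    have q: "test_fn a b q" unfolding q_def by (rule test_fn_deriv_pow[OF p(1)])
    have mq: "moment i q = (if i = m then (-1) ^ m * fact m else 0)" if "i \<le> m" for i
      unfolding q_def using moment_deriv_pow[OF p(1) that] p(2) by simp
    define c where "c = - moment m f / ((-1) ^ m * fact m)"
    have "moment i (\<lambda>t. f t + c * q t) = moment i f + c * moment i q" for i
      unfolding moment_def using moment_integrable[OF f(1), of i] moment_integrable[OF q, of i]
      by (subst integral_mult_right_zero[symmetric], subst Bochner_Integration.integral_add[symmetric])
         (auto simp: algebra_simps)
    moreover have "test_fn a b (\<lambda>t. f t + c * q t)"
      using f(1) q by (auto simp: test_fn_def intro!: smooth_add smooth_mult smooth_const)
    ultimately show ?thesis using f False
      by (intro exI[of _ "\<lambda>t. f t + c * q t"]) (auto simp: mq c_def less_Suc_eq)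
  qed (use f in auto)
qed

lemma moment_rescale:
  assumes "\<mu> > 0" shows "moment i (\<lambda>t. f (t / \<mu>) / \<mu>) = \<mu> ^ i * moment i f"
proof -
  have "moment i (\<lambda>t. f (t / \<mu>) / \<mu>) = \<bar>\<mu>\<bar> *\<^sub>R (LINT t|lborel. (0 + \<mu> * t) ^ i * (f ((0 + \<mu> * t) / \<mu>) / \<mu>))"
    unfolding moment_def using assms by (intro lborel_integral_real_affine) auto
  also have "\<dots> = \<bar>\<mu>\<bar> *\<^sub>R (LINT t|lborel. \<mu> ^ i / \<mu> * (t ^ i * f t))"
    using assms by (simp add: power_mult_distrib field_simps)
  also have "\<dots> = \<mu> ^ i * moment i f"
    using assms by (simp add: moment_def)
  finally show ?thesis .
qed

text \<open>Rescaling preserves the mass and the vanishing moments of r, so the difference has m vanishing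
  moments and is therefore an m-th derivative.\<close>

lemma scaling_kernel_exists:
  fixes a \<epsilon> \<mu> :: real
  assumes "\<epsilon> > 0" "\<mu> > 1" "(\<mu> - 1) * (\<bar>a\<bar> + \<epsilon>) \<le> \<epsilon>"
  shows "\<exists>r g. test_fn (a - \<epsilon>) (a + \<epsilon>) r \<and> test_fn (a - 2 * \<epsilon>) (a + 2 * \<epsilon>) (\<lambda>t. r (t / \<mu>) / \<mu>) \<and>
    test_fn (a - 2 * \<epsilon>) (a + 2 * \<epsilon>) g \<and> (LINT t|lborel. r t) = 1 \<and>
    (deriv ^^ m) g = (\<lambda>t. r t - r (t / \<mu>) / \<mu>)"
proof -
  obtain r where r: "test_fn (a - \<epsilon>) (a + \<epsilon>) r" "moment 0 r = 1" "\<And>i. 0 < i \<Longrightarrow> i < m \<Longrightarrow> moment i r = 0"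
    using moment_function_exists[of "a - \<epsilon>" "a + \<epsilon>" m] assms by auto
  let ?s = "\<lambda>t. r (t / \<mu>) / \<mu>"
  have "smooth (\<lambda>t. (1 / \<mu>) * r ((1 / \<mu>) * t + 0))"
    using r(1) by (intro smooth_mult smooth_const smooth_affine) (auto simp: test_fn_def)
  moreover have "?s t = 0" if t: "t \<notin> {a - 2 * \<epsilon>..a + 2 * \<epsilon>}" for t
  proof -
    have "t / \<mu> \<notin> {a - \<epsilon>..a + \<epsilon>}"
    proof
      assume u: "t / \<mu> \<in> {a - \<epsilon>..a + \<epsilon>}"
      \<comment> \<open>The dilation moves a point of the support by at most (\<mu> - 1) (|a| +
        \<epsilon>), which the third hypothesis bounds by \<epsilon>; so the dilated support stays
        within 2 \<epsilon> of a.\<close>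
      have "\<bar>t - t / \<mu>\<bar> = (\<mu> - 1) * \<bar>t / \<mu>\<bar>"
      proof -
        have "t - t / \<mu> = (\<mu> - 1) * (t / \<mu>)" using assms by (simp add: field_simps)
        then show ?thesis using assms by (simp add: abs_mult)
      qed
      also have "\<dots> \<le> (\<mu> - 1) * (\<bar>a\<bar> + \<epsilon>)" using u assms by (intro mult_left_mono) auto
      finally have "\<bar>t - t / \<mu>\<bar> \<le> \<epsilon>" using assms by simp
      then have "t \<in> {a - 2 * \<epsilon>..a + 2 * \<epsilon>}" using u by (simp only: atLeastAtMost_iff) linarith
      then show False using t by blast
    qed
    then show ?thesis using r(1) by (simp add: test_fn_def)
  qed
  ultimately have s: "test_fn (a - 2 * \<epsilon>) (a + 2 * \<epsilon>) ?s" by (simp add: test_fn_def)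
  have r2: "test_fn (a - 2 * \<epsilon>) (a + 2 * \<epsilon>) r" using r(1) assms by (auto simp: test_fn_def)
  have d: "test_fn (a - 2 * \<epsilon>) (a + 2 * \<epsilon>) (\<lambda>t. r t - ?s t)"
    using smooth_add[of r "\<lambda>t. -1 * ?s t"] smooth_mult[OF smooth_const, of ?s "-1"] r2 s
    by (auto simp: test_fn_def)
  have "moment i (\<lambda>t. r t - ?s t) = 0" if "i < m" for i
  proof -
    have "moment i (\<lambda>t. r t - ?s t) = moment i r - moment i ?s"
      unfolding moment_def right_diff_distrib
      by (rule Bochner_Integration.integral_diff) (rule moment_integrable[OF r2] moment_integrable[OF s])+
    also have "\<dots> = (1 - \<mu> ^ i) * moment i r"
      using moment_rescale[of \<mu> i r] assms by (simp add: algebra_simps)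
    also have "\<dots> = 0" using r(3)[of i] that by (cases "i = 0") auto
    finally show ?thesis .
  qed
  then obtain g where "test_fn (a - 2 * \<epsilon>) (a + 2 * \<epsilon>) g" "(deriv ^^ m) g = (\<lambda>t. r t - ?s t)"
    using test_fn_antideriv_pow[OF d, of m] assms by auto
  then show ?thesis using r s by (intro exI[of _ r] exI[of _ g]) (auto simp: moment_def)
qed


section \<open>Averaging kernels adapted to an elliptic operator\<close>

lemma Basis_cart: "(Basis :: (real^'n) set) = range (\<lambda>i. axis i 1)"
  by (auto simp: Basis_vec_def)

lemma bij_axis: "bij_betw (\<lambda>i::'n::finite. axis i (1::real)) UNIV Basis"
  unfolding Basis_cart by (intro inj_on_imp_bij_betw) (auto simp: inj_on_def axis_eq_axis)

lemma lborel_integral_prod: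
  fixes f :: "'n::finite \<Rightarrow> real \<Rightarrow> real"
  assumes int: "\<And>l. integrable lborel (f l)" and [measurable]: "\<And>l. f l \<in> borel_measurable borel"
  shows "(LINT y|lborel. (\<Prod>l\<in>UNIV. f l ((y :: real^'n) $ l))) = (\<Prod>l\<in>UNIV. (LINT t|lborel. f l t))"
proof -
  interpret product_sigma_finite "\<lambda>_::real^'n. lborel :: real measure" by standard
  have eq: "(\<Prod>l\<in>UNIV. g (axis l (1::real))) = (\<Prod>b\<in>Basis. g (b :: real^'n))" for g :: "_ \<Rightarrow> real"
    by (rule prod.reindex_bij_betw[OF bij_axis])
  have "(LINT y|lborel. (\<Prod>l\<in>UNIV. f l ((y :: real^'n) $ l))) = (LINT y|lborel. (\<Prod>b\<in>Basis. f (axis_index b) ((y :: real^'n) \<bullet> b)))"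
    by (subst eq[symmetric]) (simp add: inner_axis)
  also have "\<dots> = (LINT x|(\<Pi>\<^sub>M b\<in>(Basis::(real^'n) set). lborel). (\<Prod>b\<in>Basis. f (axis_index b) ((\<Sum>b\<in>Basis. x b *\<^sub>R b) \<bullet> b)))"
    by (subst lborel_eq, subst integral_distr) (auto intro!: borel_measurable_prod)
  also have "\<dots> = (LINT x|(\<Pi>\<^sub>M b\<in>(Basis::(real^'n) set). lborel). (\<Prod>b\<in>Basis. f (axis_index b) (x b)))"
    by simp
  also have "\<dots> = (\<Prod>b\<in>(Basis::(real^'n) set). (LINT t|lborel. f (axis_index b) t))"
    by (rule product_integral_prod) (auto simp: int)
  also have "\<dots> = (\<Prod>l\<in>UNIV. (LINT t|lborel. f l t))"
    by (subst eq[symmetric]) simp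
  finally show ?thesis .
qed

text \<open>Factors are exchanged one at a time, and \<open>Q i\<close> holds the indices whose
  factor comes from a when i is exchanged. Q is chosen before a and b, because in the kernel these
  are values at a varying point y while the choice of functions must be fixed.\<close>

lemma prod_telescope:
  fixes S :: "'i set"
  assumes "finite S"
  shows "\<exists>Q. \<forall>a b :: 'i \<Rightarrow> 'a::comm_ring_1. (\<Prod>l\<in>S. a l) - (\<Prod>l\<in>S. b l) =
     (\<Sum>i\<in>S. \<Prod>l\<in>S. if l = i then a i - b i else if l \<in> Q i then a l else b l)"
  using assms
proof (induction S)
  case empty
  then show ?case by simp
next
  case (insert s S)
  then obtain Q where Q: "\<And>a b :: 'i \<Rightarrow> 'a. (\<Prod>l\<in>S. a l) - (\<Prod>l\<in>S. b l) =
     (\<Sum>i\<in>S. \<Prod>l\<in>S. if l = i then a i - b i else if l \<in> Q i then a l else b l)" by blast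
  define Q' where "Q' i = (if i = s then {} else insert s (Q i))" for i
  have "(\<Prod>l\<in>insert s S. a l) - (\<Prod>l\<in>insert s S. b l) =
     (\<Sum>i\<in>insert s S. \<Prod>l\<in>insert s S. if l = i then a i - b i else if l \<in> Q' i then a l else b l)" for a b :: "'i \<Rightarrow> 'a"
  proof -
    have 1: "(\<Prod>l\<in>S. if l = s then a s - b s else if l \<in> Q' s then a l else b l) = (\<Prod>l\<in>S. b l)"
      using insert by (intro prod.cong) (auto simp: Q'_def)
    have 2: "(\<Prod>l\<in>insert s S. if l = i then a i - b i else if l \<in> Q' i then a l else b l) =
        a s * (\<Prod>l\<in>S. if l = i then a i - b i else if l \<in> Q i then a l else b l)" if "i \<in> S" for i
    proof -
      have "(\<Prod>l\<in>S. if l = i then a i - b i else if l \<in> Q' i then a l else b l) =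
        (\<Prod>l\<in>S. if l = i then a i - b i else if l \<in> Q i then a l else b l)"
        using insert that by (intro prod.cong) (auto simp: Q'_def)
      moreover have "s \<noteq> i" using insert that by auto
      ultimately show ?thesis using insert by (simp add: Q'_def)
    qed
    have "(\<Sum>i\<in>insert s S. \<Prod>l\<in>insert s S. if l = i then a i - b i else if l \<in> Q' i then a l else b l) =
      (a s - b s) * (\<Prod>l\<in>S. b l) + a s * ((\<Prod>l\<in>S. a l) - (\<Prod>l\<in>S. b l))"
      using insert(1,2) by (simp add: 1 2 Q sum_distrib_left del: prod.insert) (simp add: 1)
    then show ?thesis using insert by (simp add: algebra_simps)
  qed
  then show ?case by blast
qed

lemma sum_shift:
  fixes E :: "('n \<Rightarrow> nat) \<Rightarrow> real"
  assumes "finite {\<alpha>. B \<alpha> \<noteq> 0}" "finite F" "{\<alpha>. shift l B \<alpha> \<noteq> 0} \<subseteq> F"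
  shows "(\<Sum>\<alpha> | B \<alpha> \<noteq> 0. B \<alpha> * E (\<alpha>(l := Suc (\<alpha> l)))) = (\<Sum>\<beta>\<in>F. shift l B \<beta> * E \<beta>)"
proof -
  have "(\<Sum>\<beta>\<in>F. shift l B \<beta> * E \<beta>) = (\<Sum>\<beta> | shift l B \<beta> \<noteq> 0. shift l B \<beta> * E \<beta>)"
    using assms by (intro sum.mono_neutral_right) auto
  also have "\<dots> = (\<Sum>\<alpha> | B \<alpha> \<noteq> 0. B \<alpha> * E (\<alpha>(l := Suc (\<alpha> l))))"
    by (rule sum.reindex_bij_witness[of _ "\<lambda>\<alpha>. \<alpha>(l := Suc (\<alpha> l))" "\<lambda>\<beta>. \<beta>(l := \<beta> l - 1)"])
       (auto simp: shift_def split: if_splits)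
  finally show ?thesis by simp
qed

text \<open>The formal identity is evaluated under the linear map sending the monomial X^\<alpha> to
  \<open>E \<alpha>\<close>. With E taken as \<open>tensor\<close>, multiplication by X_l becomes
  differentiation in direction l.\<close>

lemma reduction_apply:
  fixes E :: "('n::finite \<Rightarrow> nat) \<Rightarrow> real" and B :: "'K::finite \<Rightarrow> ('n \<Rightarrow> nat) \<Rightarrow> real"
  assumes fin: "\<And>\<kappa>. finite {\<alpha>. B \<kappa> \<alpha> \<noteq> 0}"
    and id: "\<And>\<alpha>. (\<Sum>\<kappa>\<in>UNIV. \<Sum>l\<in>UNIV. a l \<kappa> * shift l (B \<kappa>) \<alpha>) = (if \<alpha> = \<alpha>0 then d else 0)"
  shows "(\<Sum>\<kappa>\<in>UNIV. \<Sum>l\<in>UNIV. a l \<kappa> * (\<Sum>\<alpha> | B \<kappa> \<alpha> \<noteq> 0. B \<kappa> \<alpha> * E (\<alpha>(l := Suc (\<alpha> l))))) = d * E \<alpha>0"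
proof -
  define F where "F = insert \<alpha>0 (\<Union>\<kappa>. \<Union>l. {\<alpha>. shift l (B \<kappa>) \<alpha> \<noteq> 0})"
  have F: "finite F" by (auto simp: F_def intro: finite_shift_support fin)
  have "(\<Sum>\<alpha> | B \<kappa> \<alpha> \<noteq> 0. B \<kappa> \<alpha> * E (\<alpha>(l := Suc (\<alpha> l)))) = (\<Sum>\<beta>\<in>F. shift l (B \<kappa>) \<beta> * E \<beta>)" for \<kappa> l
    by (rule sum_shift[OF fin F]) (auto simp: F_def)
  then have "(\<Sum>\<kappa>\<in>UNIV. \<Sum>l\<in>UNIV. a l \<kappa> * (\<Sum>\<alpha> | B \<kappa> \<alpha> \<noteq> 0. B \<kappa> \<alpha> * E (\<alpha>(l := Suc (\<alpha> l))))) =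
     (\<Sum>\<kappa>\<in>UNIV. \<Sum>l\<in>UNIV. \<Sum>\<beta>\<in>F. a l \<kappa> * shift l (B \<kappa>) \<beta> * E \<beta>)"
    by (simp add: sum_distrib_left mult.assoc)
  also have "\<dots> = (\<Sum>\<kappa>\<in>UNIV. \<Sum>\<beta>\<in>F. \<Sum>l\<in>UNIV. a l \<kappa> * shift l (B \<kappa>) \<beta> * E \<beta>)"
    by (intro sum.cong refl sum.swap)
  also have "\<dots> = (\<Sum>\<beta>\<in>F. \<Sum>\<kappa>\<in>UNIV. \<Sum>l\<in>UNIV. a l \<kappa> * shift l (B \<kappa>) \<beta> * E \<beta>)"
    by (rule sum.swap)
  also have "\<dots> = (\<Sum>\<beta>\<in>F. (\<Sum>\<kappa>\<in>UNIV. \<Sum>l\<in>UNIV. a l \<kappa> * shift l (B \<kappa>) \<beta>) * E \<beta>)"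
    by (simp add: sum_distrib_right)
  also have "\<dots> = (\<Sum>\<beta>\<in>F. if \<beta> = \<alpha>0 then d * E \<alpha>0 else 0)"
    unfolding id by (intro sum.cong) auto
  also have "\<dots> = d * E \<alpha>0" using F by (simp add: F_def)
  finally show ?thesis .
qed

text \<open>The partial derivative of order \<alpha> of the product of the functions f_l(y_l),
  written so that only one-variable derivatives occur.\<close>

definition tensor :: "('n::finite \<Rightarrow> real \<Rightarrow> real) \<Rightarrow> ('n \<Rightarrow> nat) \<Rightarrow> real^'n \<Rightarrow> real" where
  "tensor f \<alpha> y = (\<Prod>l\<in>UNIV. (deriv ^^ \<alpha> l) (f l) (y $ l))"

lemma tensor_continuous:
  assumes "\<And>l. smooth (f l)" shows "continuous_on S (tensor f \<alpha>)"
  unfolding tensor_def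
  by (intro continuous_on_prod continuous_on_compose2[OF smooth_continuous[OF smooth_deriv_pow[OF assms], of UNIV]]
      continuous_intros) auto

lemma tensor_deriv:
  assumes "\<And>l. smooth (f l)"
  shows "((\<lambda>t. tensor f \<alpha> (y + t *\<^sub>R axis l 1)) has_real_derivative tensor f (\<alpha>(l := Suc (\<alpha> l))) y) (at 0)"
proof -
  let ?P = "\<Prod>l'\<in>UNIV - {l}. (deriv ^^ \<alpha> l') (f l') (y $ l')"
  have eq: "tensor f \<alpha>' (y + t *\<^sub>R axis l 1) = (deriv ^^ \<alpha>' l) (f l) (y $ l + t) * (\<Prod>l'\<in>UNIV - {l}. (deriv ^^ \<alpha>' l') (f l') (y $ l'))" for t \<alpha>'
  proof -
    have "(\<Prod>l'\<in>UNIV - {l}. (deriv ^^ \<alpha>' l') (f l') ((y + t *\<^sub>R axis l 1) $ l')) = (\<Prod>l'\<in>UNIV - {l}. (deriv ^^ \<alpha>' l') (f l') (y $ l'))"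
      by (intro prod.cong) (auto simp: axis_def)
    then show ?thesis
      unfolding tensor_def by (subst prod.remove[of _ l]) (auto simp: axis_def)
  qed
  have "((\<lambda>t. (deriv ^^ \<alpha> l) (f l) (y $ l + t)) has_real_derivative deriv ((deriv ^^ \<alpha> l) (f l)) (y $ l + 0)) (at 0)"
    using smooth_DERIV[OF smooth_deriv_pow[OF assms[of l]], of "\<alpha> l" "0 + y $ l"]
    unfolding DERIV_shift[of _ _ 0] by (simp add: add.commute)
  from DERIV_cmult_right[OF this, of ?P]
  have "((\<lambda>t. tensor f \<alpha> (y + t *\<^sub>R axis l 1)) has_real_derivative deriv ((deriv ^^ \<alpha> l) (f l)) (y $ l + 0) * ?P) (at 0)"
    unfolding eq by simp
  moreover have "(\<Prod>l'\<in>UNIV - {l}. (deriv ^^ (\<alpha>(l := Suc (\<alpha> l))) l') (f l') (y $ l')) = ?P"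
    by (intro prod.cong) auto
  then have "tensor f (\<alpha>(l := Suc (\<alpha> l))) y = deriv ((deriv ^^ \<alpha> l) (f l)) (y $ l + 0) * ?P"
    using eq[of "\<alpha>(l := Suc (\<alpha> l))" 0] by simp
  ultimately show ?thesis by simp
qed

text \<open>The support is a box of half side \<epsilon>, and the Euclidean norm is at most the sum
  of the n coordinates.\<close>

lemma tensor_vanish:
  assumes f: "\<And>l. test_fn (\<nu> $ l - \<epsilon>) (\<nu> $ l + \<epsilon>) (f l)" and y: "y \<notin> cball \<nu> (real CARD('n) * \<epsilon>)"
  shows "tensor f \<alpha> (y :: real^'n::finite) = 0"
proof -
  have "\<exists>l. y $ l \<notin> {\<nu> $ l - \<epsilon>..\<nu> $ l + \<epsilon>}"
  proof (rule ccontr)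
    assume "\<not> ?thesis"
    then have "\<And>l. \<bar>(\<nu> - y) $ l\<bar> \<le> \<epsilon>" by (auto simp: abs_le_iff algebra_simps)
    then have "norm (\<nu> - y) \<le> (\<Sum>l\<in>(UNIV::'n set). \<epsilon>)"
      by (intro order_trans[OF norm_le_l1_cart] sum_mono)
    then show False using y by (simp add: dist_norm)
  qed
  then obtain l where "y $ l \<notin> {\<nu> $ l - \<epsilon>..\<nu> $ l + \<epsilon>}" by blast
  then have "(deriv ^^ \<alpha> l) (f l) (y $ l) = 0"
    using test_fn_deriv_pow[OF f[of l], of "\<alpha> l"] by (auto simp: test_fn_def)
  then show ?thesis unfolding tensor_def by (intro prod_zero) auto
qed

text \<open>Telescoping writes \<rho> minus its normalised dilate as the sum over i of the m-th
  derivative in direction i of the product of the \<open>f i\<close>, whose i-th factor is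
  \<open>g i\<close> with m-th derivative r_i - s'_i. The reduction expresses X_i^m e_j through the
  rows of the symbol with coefficients B; hence each term is the transposed operator applied to
  B(\<partial>) of that product, and \<open>h j\<close> adds these fields up. \<open>h' j l\<close>
  is the partial derivative of \<open>h j\<close> in direction l.\<close>

theorem elliptic_kernel:
  fixes A :: "'n::finite \<Rightarrow> real^'N::finite \<Rightarrow> real^'K::finite" and \<nu> :: "real^'n"
  assumes lin: "\<And>l. linear (A l)" and ell: "C_elliptic A" and \<nu>: "norm \<nu> = 1" and \<theta>: "\<theta> > 0"
  obtains \<mu> :: real and \<rho> :: "real^'n \<Rightarrow> real" and h :: "'N \<Rightarrow> real^'n \<Rightarrow> real^'K" and h' :: "'N \<Rightarrow> 'n \<Rightarrow> real^'n \<Rightarrow> real^'K"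
  where "\<mu> > 1"
    "continuous_on UNIV \<rho>" "\<And>j. continuous_on UNIV (h j)" "\<And>j l. continuous_on UNIV (h' j l)"
    "\<And>y. y \<notin> cball \<nu> \<theta> \<Longrightarrow> \<rho> y = 0" "\<And>y. y \<notin> cball \<nu> \<theta> \<Longrightarrow> \<rho> ((1/\<mu>) *\<^sub>R y) = 0"
    "\<And>y j. y \<notin> cball \<nu> \<theta> \<Longrightarrow> h j y = 0" "\<And>y j l. y \<notin> cball \<nu> \<theta> \<Longrightarrow> h' j l y = 0"
    "(LINT y|lborel. \<rho> y) = 1"
    "\<And>j l y. ((\<lambda>t. h j (y + t *\<^sub>R axis l 1)) has_vector_derivative h' j l y) (at 0)"
    "\<And>j v y. (\<Sum>l\<in>UNIV. A l v \<bullet> h' j l y) = v $ j * (\<rho> y - \<rho> ((1/\<mu>) *\<^sub>R y) / \<mu> ^ CARD('n))"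
proof -
  let ?n = "real CARD('n)"
  \<comment> \<open>All factors are supported within 2 \<epsilon> of the coordinates of \<nu>, and
    that box lies in the ball of radius 2 n \<epsilon> = \<theta>.\<close>
  define \<epsilon> where "\<epsilon> = \<theta> / (2 * ?n)"
  have n0: "?n > 0" by simp
  have \<epsilon>: "\<epsilon> > 0" "?n * (2 * \<epsilon>) = \<theta>" using \<theta> by (auto simp: \<epsilon>_def)
  \<comment> \<open>Chosen to make (\<mu> - 1) (1 + \<epsilon>) = \<epsilon>; as |\<nu>_l| \<le> 1,
    this gives the hypothesis of \<open>scaling_kernel_exists\<close>.\<close>
  define \<mu> where "\<mu> = 1 + \<epsilon> / (1 + \<epsilon>)"
  have \<mu>: "\<mu> > 1" using \<epsilon> by (simp add: \<mu>_def)
  have \<mu>\<epsilon>: "(\<mu> - 1) * (\<bar>\<nu> $ l\<bar> + \<epsilon>) \<le> \<epsilon>" for l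
  proof -
    have "\<bar>\<nu> $ l\<bar> \<le> 1" using component_le_norm_cart[of \<nu> l] \<nu> by simp
    then have "(\<mu> - 1) * (\<bar>\<nu> $ l\<bar> + \<epsilon>) \<le> (\<mu> - 1) * (1 + \<epsilon>)" using \<mu> by (intro mult_left_mono) auto
    also have "\<dots> = \<epsilon>" using \<epsilon> by (simp add: \<mu>_def)
    finally show ?thesis .
  qed
  define P where "P m i j B \<longleftrightarrow> (\<forall>\<kappa>. finite {\<alpha>. B \<kappa> \<alpha> \<noteq> 0}) \<and>
     (\<forall>j' \<alpha>. (\<Sum>\<kappa>\<in>UNIV. \<Sum>l\<in>UNIV. A l (axis j' 1) $ \<kappa> * shift l (B \<kappa>) \<alpha>)
        = (if j' = j \<and> \<alpha> = (\<lambda>_. 0)(i := m) then 1 else 0))"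
    for m i j and B :: "'K \<Rightarrow> ('n \<Rightarrow> nat) \<Rightarrow> real"
  obtain m where "\<forall>i j. \<exists>B. P m i j B"
    using elliptic_reduction[OF lin ell] unfolding P_def by blast
  then obtain B where PB: "\<And>i j. P m i j (B i j)" by metis
  have B: "finite {\<alpha>. B i j \<kappa> \<alpha> \<noteq> 0}"
       "(\<Sum>\<kappa>\<in>UNIV. \<Sum>l\<in>UNIV. A l (axis j' 1) $ \<kappa> * shift l (B i j \<kappa>) \<alpha>)
        = (if j' = j \<and> \<alpha> = (\<lambda>_. 0)(i := m) then 1 else 0)" for i j \<kappa> j' \<alpha>
    using PB[of i j] unfolding P_def by blast+
  define K where "K l r g \<longleftrightarrow> test_fn (\<nu> $ l - \<epsilon>) (\<nu> $ l + \<epsilon>) r \<and>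
    test_fn (\<nu> $ l - 2 * \<epsilon>) (\<nu> $ l + 2 * \<epsilon>) (\<lambda>t. r (t / \<mu>) / \<mu>) \<and>
    test_fn (\<nu> $ l - 2 * \<epsilon>) (\<nu> $ l + 2 * \<epsilon>) g \<and> (LINT t|lborel. r t) = 1 \<and>
    (deriv ^^ m) g = (\<lambda>t. r t - r (t / \<mu>) / \<mu>)" for l r g
  have "\<exists>r g. K l r g" for l
    unfolding K_def by (rule scaling_kernel_exists[OF \<epsilon>(1) \<mu> \<mu>\<epsilon>])
  then obtain r g where rg: "\<And>l. K l (r l) (g l)" by metis
  have r: "test_fn (\<nu> $ l - \<epsilon>) (\<nu> $ l + \<epsilon>) (r l)"
    and s: "test_fn (\<nu> $ l - 2 * \<epsilon>) (\<nu> $ l + 2 * \<epsilon>) (\<lambda>t. r l (t / \<mu>) / \<mu>)"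
    and g: "test_fn (\<nu> $ l - 2 * \<epsilon>) (\<nu> $ l + 2 * \<epsilon>) (g l)"
    and r1: "(LINT t|lborel. r l t) = 1"
    and dg: "(deriv ^^ m) (g l) = (\<lambda>t. r l t - r l (t / \<mu>) / \<mu>)" for l
    using rg[of l] unfolding K_def by blast+
  define s' where "s' l t = r l (t / \<mu>) / \<mu>" for l t
  note s = s[folded s'_def] and dg = dg[folded s'_def]
  have r': "test_fn (\<nu> $ l - 2 * \<epsilon>) (\<nu> $ l + 2 * \<epsilon>) (r l)" for l
    using r[of l] \<epsilon> by (auto simp: test_fn_def)
  from prod_telescope[OF finite[of "UNIV :: 'n set"]]
  obtain Q where Q: "\<forall>a b :: 'n \<Rightarrow> real. (\<Prod>l\<in>UNIV. a l) - (\<Prod>l\<in>UNIV. b l) =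
     (\<Sum>i\<in>UNIV. \<Prod>l\<in>UNIV. if l = i then a i - b i else if l \<in> Q i then a l else b l)" ..
  define f where "f i l = (if l = i then g i else if l \<in> Q i then r l else s' l)" for i l
  have f: "test_fn (\<nu> $ l - 2 * \<epsilon>) (\<nu> $ l + 2 * \<epsilon>) (f i l)" for i l
    using g r' s by (auto simp: f_def)
  then have fs: "smooth (f i l)" for i l by (simp add: test_fn_def)
  define \<rho> where "\<rho> = tensor r (\<lambda>_. 0)"
  define h where "h j y = (\<chi> \<kappa>. \<Sum>i\<in>UNIV. \<Sum>\<alpha> | B i j \<kappa> \<alpha> \<noteq> 0. B i j \<kappa> \<alpha> * tensor (f i) \<alpha> y)" for j y
  define h' where "h' j l y = (\<chi> \<kappa>. \<Sum>i\<in>UNIV. \<Sum>\<alpha> | B i j \<kappa> \<alpha> \<noteq> 0. B i j \<kappa> \<alpha> * tensor (f i) (\<alpha>(l := Suc (\<alpha> l))) y)" for j l y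
  have \<rho>s: "\<rho> ((1/\<mu>) *\<^sub>R y) / \<mu> ^ CARD('n) = tensor s' (\<lambda>_. 0) y" for y
    by (simp add: \<rho>_def tensor_def s'_def prod_dividef)
  show ?thesis
  proof (rule that[of \<mu> \<rho> h h'])
    show "\<mu> > 1" by (rule \<mu>)
    show "continuous_on UNIV \<rho>" unfolding \<rho>_def by (rule tensor_continuous) (use r in \<open>auto simp: test_fn_def\<close>)
    show "continuous_on UNIV (h j)" for j
      unfolding h_def by (intro continuous_intros tensor_continuous fs)
    show "continuous_on UNIV (h' j l)" for j l
      unfolding h'_def by (intro continuous_intros tensor_continuous fs)
    fix y
    show "\<rho> y = 0" if "y \<notin> cball \<nu> \<theta>"
      unfolding \<rho>_def by (rule tensor_vanish[where \<nu> = \<nu> and \<epsilon> = "2 * \<epsilon>"]) (use r' that \<epsilon> in auto)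
    show "\<rho> ((1/\<mu>) *\<^sub>R y) = 0" if "y \<notin> cball \<nu> \<theta>"
    proof -
      have "tensor s' (\<lambda>_. 0) y = 0"
        by (rule tensor_vanish[where \<nu> = \<nu> and \<epsilon> = "2 * \<epsilon>"]) (use s that \<epsilon> in auto)
      then show ?thesis using \<rho>s[of y] \<mu> by simp
    qed
    have z: "tensor (f i) \<alpha> y = 0" if "y \<notin> cball \<nu> \<theta>" for i \<alpha>
      by (rule tensor_vanish[where \<nu> = \<nu> and \<epsilon> = "2 * \<epsilon>"]) (use f that \<epsilon> in auto)
    show "h j y = 0" if "y \<notin> cball \<nu> \<theta>" for j
      by (simp add: h_def z[OF that] vec_eq_iff)
    show "h' j l y = 0" if "y \<notin> cball \<nu> \<theta>" for j l
      by (simp add: h'_def z[OF that] vec_eq_iff)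
    show "((\<lambda>t. h j (y + t *\<^sub>R axis l 1)) has_vector_derivative h' j l y) (at 0)" for j l
    proof -
      have "((\<lambda>t. \<Sum>i\<in>UNIV. \<Sum>\<alpha> | B i j \<kappa> \<alpha> \<noteq> 0. B i j \<kappa> \<alpha> * tensor (f i) \<alpha> (y + t *\<^sub>R axis l 1)) has_real_derivative
         (\<Sum>i\<in>UNIV. \<Sum>\<alpha> | B i j \<kappa> \<alpha> \<noteq> 0. B i j \<kappa> \<alpha> * tensor (f i) (\<alpha>(l := Suc (\<alpha> l))) y)) (at 0)" for \<kappa>
        by (intro DERIV_sum DERIV_cmult tensor_deriv fs)
      then show ?thesis
        unfolding h_def h'_def has_vector_derivative_def
        by (subst has_derivative_componentwise_within)
           (auto simp: Basis_cart inner_axis has_field_derivative_def mult.commute mult_commute_abs)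
    qed
    show "(\<Sum>l\<in>UNIV. A l v \<bullet> h' j l y) = v $ j * (\<rho> y - \<rho> ((1/\<mu>) *\<^sub>R y) / \<mu> ^ CARD('n))" for j v
    proof -
      note linv = linear_nth_expansion[OF lin, where v = v]
      let ?T = "\<lambda>i \<kappa> l. \<Sum>\<alpha> | B i j \<kappa> \<alpha> \<noteq> 0. B i j \<kappa> \<alpha> * tensor (f i) (\<alpha>(l := Suc (\<alpha> l))) y"
      have red: "(\<Sum>\<kappa>\<in>UNIV. \<Sum>l\<in>UNIV. A l v $ \<kappa> * ?T i \<kappa> l) = v $ j * tensor (f i) ((\<lambda>_. 0)(i := m)) y" for i
      proof (rule reduction_apply[OF B(1)])
        fix \<alpha>
        have "(\<Sum>\<kappa>\<in>UNIV. \<Sum>l\<in>UNIV. A l v $ \<kappa> * shift l (B i j \<kappa>) \<alpha>) =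
           (\<Sum>\<kappa>\<in>UNIV. \<Sum>l\<in>UNIV. \<Sum>j'\<in>UNIV. v $ j' * (A l (axis j' 1) $ \<kappa> * shift l (B i j \<kappa>) \<alpha>))"
          unfolding linv by (simp only: sum_distrib_right mult.assoc)
        also have "\<dots> = (\<Sum>\<kappa>\<in>UNIV. \<Sum>j'\<in>UNIV. \<Sum>l\<in>UNIV. v $ j' * (A l (axis j' 1) $ \<kappa> * shift l (B i j \<kappa>) \<alpha>))"
          by (intro sum.cong refl sum.swap)
        also have "\<dots> = (\<Sum>j'\<in>UNIV. \<Sum>\<kappa>\<in>UNIV. \<Sum>l\<in>UNIV. v $ j' * (A l (axis j' 1) $ \<kappa> * shift l (B i j \<kappa>) \<alpha>))"
          by (rule sum.swap)
        also have "\<dots> = (\<Sum>j'\<in>UNIV. v $ j' * (if j' = j \<and> \<alpha> = (\<lambda>_. 0)(i := m) then 1 else 0))"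
          unfolding B(2)[symmetric] by (simp only: sum_distrib_left)
        also have "\<dots> = (if \<alpha> = (\<lambda>_. 0)(i := m) then v $ j else 0)"
          by (simp add: if_distrib cong: if_cong del: fun_upd_apply)
        finally show "(\<Sum>\<kappa>\<in>UNIV. \<Sum>l\<in>UNIV. A l v $ \<kappa> * shift l (B i j \<kappa>) \<alpha>) = (if \<alpha> = (\<lambda>_. 0)(i := m) then v $ j else 0)" .
      qed
      have "(\<Sum>l\<in>UNIV. A l v \<bullet> h' j l y) = (\<Sum>l\<in>UNIV. \<Sum>\<kappa>\<in>UNIV. \<Sum>i\<in>UNIV. A l v $ \<kappa> * ?T i \<kappa> l)"
        by (simp add: h'_def inner_vec_def sum_distrib_left)
      also have "\<dots> = (\<Sum>\<kappa>\<in>UNIV. \<Sum>l\<in>UNIV. \<Sum>i\<in>UNIV. A l v $ \<kappa> * ?T i \<kappa> l)"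
        by (rule sum.swap)
      also have "\<dots> = (\<Sum>\<kappa>\<in>UNIV. \<Sum>i\<in>UNIV. \<Sum>l\<in>UNIV. A l v $ \<kappa> * ?T i \<kappa> l)"
        by (intro sum.cong refl sum.swap)
      also have "\<dots> = (\<Sum>i\<in>UNIV. \<Sum>\<kappa>\<in>UNIV. \<Sum>l\<in>UNIV. A l v $ \<kappa> * ?T i \<kappa> l)"
        by (rule sum.swap)
      also have "\<dots> = v $ j * (\<Sum>i\<in>UNIV. tensor (f i) ((\<lambda>_. 0)(i := m)) y)"
        unfolding red by (simp only: sum_distrib_left)
      also have "(\<Sum>i\<in>UNIV. tensor (f i) ((\<lambda>_. 0)(i := m)) y) =
         (\<Sum>i\<in>UNIV. \<Prod>l\<in>UNIV. if l = i then r i (y $ i) - s' i (y $ i) else if l \<in> Q i then r l (y $ l) else s' l (y $ l))"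
        unfolding tensor_def by (intro sum.cong prod.cong refl) (auto simp: f_def dg)
      also have "\<dots> = tensor r (\<lambda>_. 0) y - tensor s' (\<lambda>_. 0) y"
        unfolding tensor_def using Q[rule_format, of "\<lambda>l. r l (y $ l)" "\<lambda>l. s' l (y $ l)"] by simp
      finally show ?thesis unfolding \<rho>s by (simp add: \<rho>_def)
    qed
  next
    have c: "continuous_on UNIV (r l)" for l using r by (auto simp: test_fn_def intro: smooth_continuous)
    have "integrable lborel (r l)" for l
      by (rule test_fn_integrable[OF c]) (use r[of l] in \<open>auto simp: test_fn_def\<close>)
    then show "(LINT y|lborel. \<rho> y) = 1"
      unfolding \<rho>_def tensor_def using lborel_integral_prod[of r] c r1
      by (simp add: borel_measurable_continuous_onI)
  qed
qed


section \<open>Integration by parts against the kernel\<close>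

lemma nn_integral_lborel_affine:
  fixes f :: "'a::euclidean_space \<Rightarrow> ennreal"
  assumes [measurable]: "f \<in> borel_measurable borel" and s: "s > 0"
  shows "(\<integral>\<^sup>+w. f (x + s *\<^sub>R w) \<partial>lborel) = ennreal (1 / s ^ DIM('a)) * (\<integral>\<^sup>+y. f y \<partial>lborel)"
proof -
  have "(\<integral>\<^sup>+y. f y \<partial>lborel) = (\<integral>\<^sup>+w. ennreal (s ^ DIM('a)) * f (x + s *\<^sub>R w) \<partial>lborel)"
    using s by (subst lborel_affine[of s x]) (simp_all add: nn_integral_density nn_integral_distr)
  also have "\<dots> = ennreal (s ^ DIM('a)) * (\<integral>\<^sup>+w. f (x + s *\<^sub>R w) \<partial>lborel)"
    by (rule nn_integral_cmult) simp
  finally have "ennreal (1 / s ^ DIM('a)) * (\<integral>\<^sup>+y. f y \<partial>lborel) =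
     ennreal (1 / s ^ DIM('a) * s ^ DIM('a)) * (\<integral>\<^sup>+w. f (x + s *\<^sub>R w) \<partial>lborel)"
    using s by (subst ennreal_mult) (simp_all add: mult.assoc)
  then show ?thesis using s by simp
qed

lemma integral_lborel_scale:
  fixes f :: "'a::euclidean_space \<Rightarrow> 'b::euclidean_space"
  assumes [measurable]: "f \<in> borel_measurable borel" and s: "s > 0"
  shows "(LINT w|lborel. f (s *\<^sub>R w)) = (1 / s ^ DIM('a)) *\<^sub>R (LINT y|lborel. f y)"
proof -
  have "(LINT y|lborel. f y) = (LINT w|lborel. (s ^ DIM('a)) *\<^sub>R f (s *\<^sub>R w))"
    using s by (subst lborel_affine[of s 0]) (simp_all add: integral_density integral_distr)
  then show ?thesis using s by simp
qed

lemma integrable_continuous_compact_support: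
  fixes f :: "'a::euclidean_space \<Rightarrow> 'b::euclidean_space"
  assumes "continuous_on UNIV f" "\<And>y. y \<notin> cball c R \<Longrightarrow> f y = 0"
  shows "integrable lborel f"
proof -
  have "integrable lborel (\<lambda>x. indicator (cball c R) x *\<^sub>R f x)"
    by (intro borel_integrable_compact compact_cball continuous_on_subset[OF assms(1)]) auto
  moreover have "(\<lambda>x. indicator (cball c R) x *\<^sub>R f x) = f" using assms(2) by (auto simp: fun_eq_iff indicator_def)
  ultimately show ?thesis by simp
qed

lemma continuous_compact_support_bounded:
  fixes f :: "'a::euclidean_space \<Rightarrow> 'b::euclidean_space"
  assumes "continuous_on UNIV f" "\<And>y. y \<notin> cball c R \<Longrightarrow> f y = 0"
  obtains M where "M > 0" "\<And>y. norm (f y) \<le> M"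
proof -
  have "compact (f ` cball c R)" by (intro compact_continuous_image continuous_on_subset[OF assms(1)]) auto
  then obtain M where M: "M > 0" "\<And>y. y \<in> cball c R \<Longrightarrow> norm (f y) \<le> M"
    using compact_imp_bounded[of "f ` cball c R"] unfolding bounded_pos by blast
  have "norm (f y) \<le> M" for y using M assms(2)[of y] by (cases "y \<in> cball c R") auto
  then show ?thesis using M(1) that by blast
qed

text \<open>F is known to be differentiable only along e, so difference quotients are integrated
  directly: their integrals vanish by translation invariance, and the mean value theorem bounds them
  for dominated convergence.\<close>

lemma integral_directional_deriv_0:
  fixes F :: "'a::euclidean_space \<Rightarrow> real"
  assumes F: "continuous_on UNIV F" and F': "continuous_on UNIV F'"
    and supp: "\<And>y. y \<notin> cball c R \<Longrightarrow> F y = 0"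
    and D: "\<And>y. ((\<lambda>t. F (y + t *\<^sub>R e)) has_real_derivative F' y) (at 0)"
  shows "(LINT y|lborel. F' y) = 0"
proof -
  have D': "((\<lambda>t. F (y + t *\<^sub>R e)) has_real_derivative F' (y + t *\<^sub>R e)) (at t)" for y t
  proof -
    have "((\<lambda>h. F ((y + t *\<^sub>R e) + h *\<^sub>R e)) has_real_derivative F' (y + t *\<^sub>R e)) (at 0)" by (rule D)
    moreover have "(\<lambda>h. F ((y + t *\<^sub>R e) + h *\<^sub>R e)) = (\<lambda>h. (\<lambda>t. F (y + t *\<^sub>R e)) (h + t))"
      by (simp add: algebra_simps)
    ultimately show ?thesis using DERIV_shift[of "\<lambda>t. F (y + t *\<^sub>R e)" "F' (y + t *\<^sub>R e)" 0 t] by simp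
  qed
  have supp': "F' y = 0" if "y \<notin> cball c R" for y
  proof -
    have op: "open ((\<lambda>t. y + t *\<^sub>R e) -` (- cball c R))"
      by (intro open_vimage continuous_intros) auto
    have "((\<lambda>t. F (y + t *\<^sub>R e)) has_real_derivative 0) (at 0)"
    proof (rule has_field_derivative_transform_within_open[OF DERIV_const op])
      show "0 \<in> (\<lambda>t. y + t *\<^sub>R e) -` (- cball c R)" using that by simp
      show "0 = F (y + t *\<^sub>R e)" if "t \<in> (\<lambda>t. y + t *\<^sub>R e) -` (- cball c R)" for t
        using that supp by simp
    qed
    from DERIV_unique[OF D this] show ?thesis .
  qed
  obtain M where M: "M > 0" "\<And>y. norm (F' y) \<le> M"
    using continuous_compact_support_bounded[OF F' supp'] by blast
  define q where "q n y = real (Suc n) * (F (y + (1 / real (Suc n)) *\<^sub>R e) - F y)" for n y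
  have intF: "integrable lborel F" by (rule integrable_continuous_compact_support[OF F supp])
  have [measurable]: "F \<in> borel_measurable borel" "F' \<in> borel_measurable borel"
    using F F' by (auto intro: borel_measurable_continuous_onI)
  have "(\<lambda>n. LINT y|lborel. q n y) \<longlonglongrightarrow> (LINT y|lborel. F' y)"
  proof (rule integral_dominated_convergence[where w = "\<lambda>y. M * indicator (cball c (R + norm e)) y"])
    show "integrable lborel (\<lambda>y. M * indicator (cball c (R + norm e)) y)"
      using emeasure_bounded_finite[of "cball c (R + norm e)"]
      by (intro integrable_mult_right integrable_real_indicator) auto
    show "AE y in lborel. (\<lambda>n. q n y) \<longlonglongrightarrow> F' y"
    proof (rule AE_I2)
      fix y
      have "((\<lambda>h. (F (y + h *\<^sub>R e) - F y) / h) \<longlongrightarrow> F' y) (at 0)"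
        using D[of y] by (simp add: DERIV_def)
      moreover have "filterlim (\<lambda>n. 1 / real (Suc n)) (at 0) sequentially"
        unfolding filterlim_at using LIMSEQ_inverse_real_of_nat by (auto simp: divide_inverse)
      ultimately have "(\<lambda>n. (F (y + (1 / real (Suc n)) *\<^sub>R e) - F y) / (1 / real (Suc n))) \<longlonglongrightarrow> F' y"
        by (rule filterlim_compose)
      then show "(\<lambda>n. q n y) \<longlonglongrightarrow> F' y" by (simp add: q_def mult.commute)
    qed
    show "AE y in lborel. norm (q n y) \<le> M * indicator (cball c (R + norm e)) y" for n
    proof (rule AE_I2)
      fix y
      define d where "d = 1 / real (Suc n)"
      have d: "0 < d" "d \<le> 1" by (auto simp: d_def)
      obtain z where "z > 0" "z < d" "F (y + d *\<^sub>R e) - F (y + 0 *\<^sub>R e) = (d - 0) * F' (y + z *\<^sub>R e)"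
        using MVT2[of 0 d "\<lambda>t. F (y + t *\<^sub>R e)" "\<lambda>t. F' (y + t *\<^sub>R e)"] D' d by auto
      then have "q n y = F' (y + z *\<^sub>R e)" by (simp add: q_def d_def)
      then have 1: "norm (q n y) \<le> M" using M by simp
      have "q n y = 0" if y: "y \<notin> cball c (R + norm e)"
      proof -
        have n: "norm (d *\<^sub>R e) \<le> norm e" using d by (simp add: mult_left_le_one_le)
        have "dist c y \<le> dist c (y + d *\<^sub>R e) + dist (y + d *\<^sub>R e) y" by (rule dist_triangle)
        moreover have "dist (y + d *\<^sub>R e) y \<le> norm e" using n by (simp add: dist_norm)
        ultimately have "y + d *\<^sub>R e \<notin> cball c R" using y by (auto simp: dist_commute)
        moreover have "y \<notin> cball c R" using y norm_ge_zero[of e] by (auto simp del: norm_ge_zero)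
        ultimately show ?thesis using supp by (simp add: q_def d_def)
      qed
      then show "norm (q n y) \<le> M * indicator (cball c (R + norm e)) y"
        using 1 by (auto simp: indicator_def)
    qed
  qed (auto simp: q_def)
  moreover have "(LINT y|lborel. q n y) = 0" for n
  proof -
    let ?v = "(1 / real (Suc n)) *\<^sub>R e"
    have tr: "(LINT y|lborel. F y) = (LINT y|lborel. F (y + ?v))"
      by (subst lborel_distr_plus[of ?v, symmetric], subst integral_distr) (simp_all add: add.commute)
    have "integrable lborel (\<lambda>y. F (y + ?v))"
    proof (rule integrable_continuous_compact_support)
      show "continuous_on UNIV (\<lambda>y. F (y + ?v))"
        by (intro continuous_on_compose2[OF F] continuous_intros) auto
      show "F (y + ?v) = 0" if "y \<notin> cball (c - ?v) R" for y
        using that supp[of "y + ?v"] by (simp add: dist_norm algebra_simps)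
    qed
    then show ?thesis unfolding q_def using intF tr by (simp add: Bochner_Integration.integral_diff)
  qed
  ultimately have "(\<lambda>n. 0) \<longlonglongrightarrow> (LINT y|lborel. F' y)" by simp
  then show ?thesis using LIMSEQ_unique by blast
qed

lemma continuous_on_zero_outside:
  fixes f :: "'a::heine_borel \<Rightarrow> 'b::real_normed_vector"
  assumes "open V" "cball c R \<subseteq> V" "continuous_on V f" "\<And>y. y \<notin> cball c R \<Longrightarrow> f y = 0"
  shows "continuous_on UNIV f"
proof -
  have "continuous_on (- cball c R) f"
    by (rule continuous_on_eq[OF continuous_on_const[of _ 0]]) (use assms(4) in auto)
  then have "continuous_on (V \<union> - cball c R) f"
    using assms by (intro continuous_on_open_Un) auto
  moreover have "V \<union> - cball c R = UNIV" using assms(2) by auto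
  ultimately show ?thesis by simp
qed

lemma C1_on_continuous: "C1_on \<Omega> u \<Longrightarrow> continuous_on \<Omega> u"
  by (auto simp: C1_on_def intro!: continuous_at_imp_continuous_on differentiable_imp_continuous_within)

lemma diff_op_continuous:
  fixes A :: "'n::finite \<Rightarrow> real^'N::finite \<Rightarrow> real^'K::finite"
  assumes "\<And>l. linear (A l)" "C1_on \<Omega> u" shows "continuous_on \<Omega> (diff_op A u)"
proof -
  have "continuous_on \<Omega> (\<lambda>x. A l (partial l u x))" for l
    using linear_continuous_on_compose[OF _ assms(1), of \<Omega> "partial l u" l] assms(2) by (simp add: C1_on_def)
  then show ?thesis unfolding diff_op_def by (intro continuous_on_sum)
qed

text \<open>Bundles the output of \<open>elliptic_kernel\<close>. The assumption
  \<open>adjoint\<close> says, up to sign, that the formal adjoint of the operator maps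
  \<open>h j\<close> to the j-th unit vector times \<rho> minus its normalised dilate.\<close>

locale trace_kernel =
  fixes A :: "'n::finite \<Rightarrow> real^'N::finite \<Rightarrow> real^'K::finite" and \<nu> :: "real^'n" and \<theta> \<mu> :: real
    and \<rho> :: "real^'n \<Rightarrow> real" and h :: "'N \<Rightarrow> real^'n \<Rightarrow> real^'K" and h' :: "'N \<Rightarrow> 'n \<Rightarrow> real^'n \<Rightarrow> real^'K"
  assumes lin: "\<And>l. linear (A l)" and \<theta>: "\<theta> > 0" and \<mu>: "\<mu> > 1"
    and cont: "continuous_on UNIV \<rho>" "\<And>j. continuous_on UNIV (h j)" "\<And>j l. continuous_on UNIV (h' j l)"
    and supp: "\<And>y. y \<notin> cball \<nu> \<theta> \<Longrightarrow> \<rho> y = 0" "\<And>y. y \<notin> cball \<nu> \<theta> \<Longrightarrow> \<rho> ((1/\<mu>) *\<^sub>R y) = 0"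
      "\<And>y j. y \<notin> cball \<nu> \<theta> \<Longrightarrow> h j y = 0" "\<And>y j l. y \<notin> cball \<nu> \<theta> \<Longrightarrow> h' j l y = 0"
    and int1: "(LINT y|lborel. \<rho> y) = 1"
    and deriv: "\<And>j l y. ((\<lambda>t. h j (y + t *\<^sub>R axis l 1)) has_vector_derivative h' j l y) (at 0)"
    and adjoint: "\<And>j v y. (\<Sum>l\<in>UNIV. A l v \<bullet> h' j l y) = v $ j * (\<rho> y - \<rho> ((1/\<mu>) *\<^sub>R y) / \<mu> ^ CARD('n))"
begin

definition avg :: "(real^'n \<Rightarrow> real^'N) \<Rightarrow> real^'n \<Rightarrow> real \<Rightarrow> real^'N" where
  "avg u x s = (\<chi> j. LINT w|lborel. \<rho> w * u (x + s *\<^sub>R w) $ j)"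

lemma kernel_bounded: "\<exists>M>0. \<forall>y. \<bar>\<rho> y\<bar> \<le> M \<and> (\<forall>j. norm (h j y) \<le> M)"
proof -
  obtain M0 where M0: "M0 > 0" "\<And>y. norm (\<rho> y) \<le> M0"
    using continuous_compact_support_bounded[OF cont(1) supp(1)] by blast
  have "\<exists>M. M > 0 \<and> (\<forall>y. norm (h j y) \<le> M)" for j
    using continuous_compact_support_bounded[of "h j" \<nu> \<theta>, OF cont(2) supp(3)] by metis
  then obtain M where M: "\<And>j. M j > 0" "\<And>j y. norm (h j y) \<le> M j" by metis
  have "norm (h j y) \<le> (\<Sum>j\<in>UNIV. M j)" for j y
    using M(2)[of j y] member_le_sum[of j UNIV M] M(1) by (simp add: less_imp_le)
  moreover have "(\<Sum>j\<in>UNIV. M j) > 0" using M(1) by (intro sum_pos) auto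
  ultimately show ?thesis using M0
    by (intro exI[of _ "M0 + (\<Sum>j\<in>UNIV. M j)"]) (auto intro: add_increasing add_increasing2 less_imp_le)
qed

context
  fixes \<Omega> :: "(real^'n) set" and u :: "real^'n \<Rightarrow> real^'N" and x :: "real^'n" and s :: real
  assumes op: "open \<Omega>" and C1: "C1_on \<Omega> u" and s: "s > 0"
    and inside: "\<And>w. w \<in> cball \<nu> \<theta> \<Longrightarrow> x + s *\<^sub>R w \<in> \<Omega>"
begin

lemma open_rescaled: "open ((\<lambda>w. x + s *\<^sub>R w) -` \<Omega>)"
  by (intro open_vimage op continuous_intros)

lemma continuous_rescaled:
  assumes "continuous_on \<Omega> f" shows "continuous_on ((\<lambda>w. x + s *\<^sub>R w) -` \<Omega>) (\<lambda>w. f (x + s *\<^sub>R w))"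
  by (rule continuous_on_compose2[OF assms]) (auto intro!: continuous_intros)

text \<open>Nothing is known about u outside \<Omega>. A factor supported in the ball makes the
  products continuous on the whole space, whatever values u takes there.\<close>

lemma continuous_cutoff:
  fixes f :: "real^'n \<Rightarrow> 'c::real_normed_vector"
  assumes "continuous_on ((\<lambda>w. x + s *\<^sub>R w) -` \<Omega>) f" "\<And>y. y \<notin> cball \<nu> \<theta> \<Longrightarrow> f y = 0"
  shows "continuous_on UNIV f"
proof (rule continuous_on_zero_outside[OF open_rescaled])
  show "cball \<nu> \<theta> \<subseteq> (\<lambda>w. x + s *\<^sub>R w) -` \<Omega>" using inside by auto
qed (use assms in auto)

text \<open>Each \<open>?F l\<close> has compact support, so its derivative in direction l
  integrates to 0. Summed over l, the product rule yields the operator applied to u, with a factor s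
  from the rescaled argument, and, through \<open>adjoint\<close>, the difference of the
  kernels.\<close>

lemma partial_integration:
  "(LINT w|lborel. u (x + s *\<^sub>R w) $ j * (\<rho> w - \<rho> ((1/\<mu>) *\<^sub>R w) / \<mu> ^ CARD('n))) =
    - s * (LINT w|lborel. diff_op A u (x + s *\<^sub>R w) \<bullet> h j w)"
proof -
  let ?F = "\<lambda>l w. A l (u (x + s *\<^sub>R w)) \<bullet> h j w"
  let ?D = "\<lambda>l w. A l (s *\<^sub>R partial l u (x + s *\<^sub>R w)) \<bullet> h j w + A l (u (x + s *\<^sub>R w)) \<bullet> h' j l w"
  have cl: "continuous_on S f \<Longrightarrow> continuous_on S (\<lambda>w. A l (f w))" for l S and f :: "real^'n \<Rightarrow> real^'N"
    by (rule linear_continuous_on_compose[OF _ lin])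
  have cu: "continuous_on \<Omega> u" by (rule C1_on_continuous[OF C1])
  have cp: "continuous_on \<Omega> (partial l u)" for l using C1 by (simp add: C1_on_def)
  have cF: "continuous_on UNIV (?F l)" for l
    by (rule continuous_cutoff)
       (auto intro!: continuous_intros cl continuous_rescaled cu continuous_on_subset[OF cont(2)] simp: supp)
  have cD: "continuous_on UNIV (?D l)" for l
    by (rule continuous_cutoff)
       (auto intro!: continuous_intros cl continuous_rescaled cu cp continuous_on_subset[OF cont(2)] continuous_on_subset[OF cont(3)] simp: supp)
  have D: "((\<lambda>t. ?F l (w + t *\<^sub>R axis l 1)) has_real_derivative ?D l w) (at 0)" for l w
  proof (cases "x + s *\<^sub>R w \<in> \<Omega>")
    case True
    let ?z = "x + s *\<^sub>R w"
    have "(u has_derivative frechet_derivative u (at ?z)) (at ?z)"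
      using C1 True by (auto simp: C1_on_def frechet_derivative_works)
    then have U: "(u has_derivative frechet_derivative u (at ?z)) (at (x + s *\<^sub>R (w + 0 *\<^sub>R axis l 1)))" by simp
    have "((\<lambda>t. x + s *\<^sub>R (w + t *\<^sub>R axis l 1)) has_derivative (\<lambda>t. (t * s) *\<^sub>R axis l 1)) (at 0)"
      by (auto intro!: derivative_eq_intros simp: mult.commute)
    from diff_chain_at[OF this U]
    have "((\<lambda>t. u (x + s *\<^sub>R (w + t *\<^sub>R axis l 1))) has_derivative (\<lambda>t. frechet_derivative u (at ?z) ((t * s) *\<^sub>R axis l 1))) (at 0)"
      by (simp add: o_def)
    moreover have "frechet_derivative u (at ?z) ((t * s) *\<^sub>R axis l 1) = t *\<^sub>R (s *\<^sub>R partial l u ?z)" for t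
      using C1 True by (simp add: partial_def linear_cmul[OF linear_frechet_derivative] C1_on_def)
    ultimately have "((\<lambda>t. u (x + s *\<^sub>R (w + t *\<^sub>R axis l 1))) has_vector_derivative (s *\<^sub>R partial l u ?z)) (at 0)"
      by (simp add: has_vector_derivative_def)
    from bounded_linear.has_vector_derivative[OF linear_conv_bounded_linear[THEN iffD1, OF lin[of l]] this]
    have "((\<lambda>t. A l (u (x + s *\<^sub>R (w + t *\<^sub>R axis l 1)))) has_vector_derivative A l (s *\<^sub>R partial l u ?z)) (at 0)" .
    from bounded_bilinear.has_vector_derivative[OF bounded_bilinear_inner this deriv[of j w l]]
    show ?thesis
      by (simp add: has_real_derivative_iff_has_vector_derivative add.commute)
  next
    case False
    then have w: "w \<notin> cball \<nu> \<theta>" using inside by blast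
    have op': "open ((\<lambda>t. w + t *\<^sub>R axis l (1::real)) -` (- cball \<nu> \<theta>))"
      by (intro open_vimage continuous_intros) auto
    have "((\<lambda>t. ?F l (w + t *\<^sub>R axis l 1)) has_real_derivative 0) (at 0)"
    proof (rule has_field_derivative_transform_within_open[OF DERIV_const op'])
      show "0 \<in> (\<lambda>t. w + t *\<^sub>R axis l 1) -` (- cball \<nu> \<theta>)" using w by simp
      show "0 = ?F l (w + t *\<^sub>R axis l 1)" if "t \<in> (\<lambda>t. w + t *\<^sub>R axis l 1) -` (- cball \<nu> \<theta>)" for t
        using that supp(3)[of "w + t *\<^sub>R axis l 1" j] by simp
    qed
    then show ?thesis using supp(3,4)[OF w] by simp
  qed
  have zero: "(LINT w|lborel. ?D l w) = 0" for l
    by (rule integral_directional_deriv_0[OF cF cD _ D, of \<nu> \<theta>]) (simp add: supp)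
  have intD: "integrable lborel (?D l)" for l
    by (rule integrable_continuous_compact_support[OF cD, of \<nu> \<theta>]) (auto simp: supp)
  let ?g = "\<lambda>w. s * (diff_op A u (x + s *\<^sub>R w) \<bullet> h j w)"
  let ?f = "\<lambda>w. u (x + s *\<^sub>R w) $ j * (\<rho> w - \<rho> ((1/\<mu>) *\<^sub>R w) / \<mu> ^ CARD('n))"
  have "(\<Sum>l\<in>UNIV. ?D l w) = ?g w + ?f w" for w
  proof -
    have "(\<Sum>l\<in>UNIV. A l (s *\<^sub>R partial l u (x + s *\<^sub>R w)) \<bullet> h j w) = ?g w"
      by (simp add: linear_cmul[OF lin] diff_op_def inner_sum_left sum_distrib_left)
    then show ?thesis by (simp add: sum.distrib adjoint)
  qed
  moreover have "(LINT w|lborel. (\<Sum>l\<in>UNIV. ?D l w)) = 0"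
    using intD zero by (subst Bochner_Integration.integral_sum) auto
  ultimately have 0: "(LINT w|lborel. ?g w + ?f w) = 0" by simp
  have cg: "continuous_on UNIV ?g"
    by (rule continuous_cutoff)
       (auto intro!: continuous_intros continuous_rescaled diff_op_continuous[OF lin C1] continuous_on_subset[OF cont(2)] simp: supp)
  have cf: "continuous_on UNIV ?f"
  proof (rule continuous_cutoff)
    let ?V = "(\<lambda>w. x + s *\<^sub>R w) -` \<Omega>"
    have "continuous_on ?V \<rho>" "continuous_on ?V (\<lambda>w. \<rho> ((1/\<mu>) *\<^sub>R w))" "continuous_on ?V (\<lambda>w. u (x + s *\<^sub>R w))"
      by (rule continuous_on_compose2[OF cont(1)] continuous_rescaled[OF cu] continuous_on_subset[OF cont(1)];
          auto intro!: continuous_intros)+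
    then show "continuous_on ?V ?f"
      using \<mu> by (intro continuous_on_mult continuous_on_diff continuous_on_divide continuous_on_const
          continuous_on_component) auto
  qed (auto simp: supp)
  have "integrable lborel ?g"
    by (rule integrable_continuous_compact_support[OF cg, of \<nu> \<theta>]) (simp add: supp)
  moreover have "integrable lborel ?f"
    by (rule integrable_continuous_compact_support[OF cf, of \<nu> \<theta>]) (simp add: supp)
  ultimately have "(LINT w|lborel. ?g w + ?f w) = s * (LINT w|lborel. diff_op A u (x + s *\<^sub>R w) \<bullet> h j w) + (LINT w|lborel. ?f w)"
    by (subst Bochner_Integration.integral_add) auto
  then show ?thesis using 0 by simp
qed

end

end

lemma mem_cball_rescale:
  fixes w :: "'a::real_normed_vector"
  assumes "s > 0"
  shows "x + s *\<^sub>R w \<in> cball (x + s *\<^sub>R \<nu>) (s * \<theta>) \<longleftrightarrow> w \<in> cball \<nu> (\<theta> :: real)"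
proof -
  have "dist (x + s *\<^sub>R \<nu>) (x + s *\<^sub>R w) = s * dist \<nu> w"
    using assms by (simp add: dist_norm scaleR_diff_right[symmetric])
  then show ?thesis using assms by (simp only: mem_cball mult_le_cancel_left_pos)
qed

lemma cball_rescaleD:
  assumes s: "s > 0" and y: "y \<in> cball (x + s *\<^sub>R \<nu>) (s * \<theta>)"
  obtains w where "w \<in> cball \<nu> \<theta>" "y = x + s *\<^sub>R (w :: 'a::euclidean_space)"
proof -
  have "y = x + s *\<^sub>R ((1 / s) *\<^sub>R (y - x))" using s by simp
  then show ?thesis using that y mem_cball_rescale[OF s] by metis
qed

context trace_kernel begin

lemma nn_integral_cball_rescale:
  fixes g :: "real^'n \<Rightarrow> ennreal"
  assumes s: "s > 0" and g: "g \<in> borel_measurable borel"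
  shows "(\<integral>\<^sup>+w. g (x + s *\<^sub>R w) * indicator (cball \<nu> \<theta>) w \<partial>lborel) =
    ennreal (1 / s ^ CARD('n)) * (\<integral>\<^sup>+y. g y * indicator (cball (x + s *\<^sub>R \<nu>) (s * \<theta>)) y \<partial>lborel)"
proof -
  have "indicator (cball \<nu> \<theta>) w = (indicator (cball (x + s *\<^sub>R \<nu>) (s * \<theta>)) (x + s *\<^sub>R w) :: ennreal)" for w
    unfolding indicator_def mem_cball_rescale[OF s] ..
  moreover have "(\<lambda>y. g y * indicator (cball (x + s *\<^sub>R \<nu>) (s * \<theta>)) y) \<in> borel_measurable borel"
    using g by (intro borel_measurable_times_ennreal borel_measurable_indicator) auto
  ultimately show ?thesis
    using nn_integral_lborel_affine[of "\<lambda>y. g y * indicator (cball (x + s *\<^sub>R \<nu>) (s * \<theta>)) y" s x] s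
    by simp
qed

context
  fixes \<Omega> :: "(real^'n) set" and u :: "real^'n \<Rightarrow> real^'N" and x :: "real^'n" and s :: real
  assumes op: "open \<Omega>" and C1: "C1_on \<Omega> u" and s: "s > 0"
    and inside: "\<And>w. w \<in> cball \<nu> \<theta> \<Longrightarrow> x + s *\<^sub>R w \<in> \<Omega>"
begin

lemma avg_integrand_continuous: "continuous_on UNIV (\<lambda>w. \<rho> w * u (x + s *\<^sub>R w) $ j)"
proof (rule continuous_cutoff[OF op C1 s inside])
  show "continuous_on ((\<lambda>w. x + s *\<^sub>R w) -` \<Omega>) (\<lambda>w. \<rho> w * u (x + s *\<^sub>R w) $ j)"
    by (intro continuous_on_mult continuous_on_component continuous_on_subset[OF cont(1) subset_UNIV]
        continuous_rescaled[OF op C1 s inside C1_on_continuous[OF C1]])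
qed (simp_all add: supp)

lemma avg_increment:
  "(avg u x s - avg u x (\<mu> * s)) $ j = - s * (LINT w|lborel. diff_op A u (x + s *\<^sub>R w) \<bullet> h j w)"
proof -
  let ?f = "\<lambda>w. \<rho> ((1/\<mu>) *\<^sub>R w) * u (x + s *\<^sub>R w) $ j"
  have cf: "continuous_on UNIV ?f"
  proof (rule continuous_cutoff[OF op C1 s inside])
    show "continuous_on ((\<lambda>w. x + s *\<^sub>R w) -` \<Omega>) ?f"
      by (intro continuous_on_mult continuous_on_component continuous_on_compose2[OF cont(1), of _ "\<lambda>w. (1/\<mu>) *\<^sub>R w"]
        continuous_rescaled[OF op C1 s inside C1_on_continuous[OF C1]]) (auto intro!: continuous_intros)
  qed (simp_all add: supp)
  \<comment> \<open>The change of variables moves the dilation from u to the kernel, so that both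
    averages sample u at the same points x + s w.\<close>
  have "avg u x (\<mu> * s) $ j = (LINT w|lborel. ?f (\<mu> *\<^sub>R w))"
    using \<mu> by (simp add: avg_def mult.commute)
  also have "\<dots> = (1 / \<mu> ^ CARD('n)) *\<^sub>R (LINT w|lborel. ?f w)"
    using integral_lborel_scale[of ?f \<mu>] cf \<mu> by (simp add: borel_measurable_continuous_onI)
  finally have 1: "avg u x (\<mu> * s) $ j = (LINT w|lborel. ?f w / \<mu> ^ CARD('n))" by simp
  have "integrable lborel ?f"
    by (rule integrable_continuous_compact_support[OF cf, of \<nu> \<theta>]) (simp add: supp)
  moreover have "integrable lborel (\<lambda>w. \<rho> w * u (x + s *\<^sub>R w) $ j)"
    by (rule integrable_continuous_compact_support[OF avg_integrand_continuous, of \<nu> \<theta>]) (simp add: supp)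
  ultimately have "(avg u x s - avg u x (\<mu> * s)) $ j = (LINT w|lborel. \<rho> w * u (x + s *\<^sub>R w) $ j - ?f w / \<mu> ^ CARD('n))"
    unfolding vector_minus_component 1 by (subst Bochner_Integration.integral_diff) (auto simp: avg_def)
  also have "\<dots> = - s * (LINT w|lborel. diff_op A u (x + s *\<^sub>R w) \<bullet> h j w)"
    using partial_integration[OF op C1 s inside, of j] by (simp add: algebra_simps)
  finally show ?thesis .
qed

lemma cball_inside: "cball (x + s *\<^sub>R \<nu>) (s * \<theta>) \<subseteq> \<Omega>"
  using inside by (auto elim!: cball_rescaleD[OF s])

lemma measurable_cutoff:
  fixes f :: "real^'n \<Rightarrow> 'c::euclidean_space"
  assumes "continuous_on \<Omega> f"
  shows "(\<lambda>y. ennreal (norm (indicator \<Omega> y *\<^sub>R f y))) \<in> borel_measurable borel"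
proof -
  have "(\<lambda>y. indicator \<Omega> y *\<^sub>R f y) \<in> borel_measurable borel"
    using assms op by (intro borel_measurable_continuous_on_indicator) auto
  then show ?thesis by measurable
qed

lemma nn_integral_cutoff:
  fixes f :: "real^'n \<Rightarrow> 'c::euclidean_space"
  assumes "continuous_on \<Omega> f"
  shows "(\<integral>\<^sup>+w. ennreal (norm (f (x + s *\<^sub>R w))) * indicator (cball \<nu> \<theta>) w \<partial>lborel) =
    ennreal (1 / s ^ CARD('n)) * (\<integral>\<^sup>+y. ennreal (norm (f y)) * indicator (cball (x + s *\<^sub>R \<nu>) (s * \<theta>)) y \<partial>lborel)"
proof -
  let ?g = "\<lambda>y. ennreal (norm (indicator \<Omega> y *\<^sub>R f y))"
  have "(\<integral>\<^sup>+w. ennreal (norm (f (x + s *\<^sub>R w))) * indicator (cball \<nu> \<theta>) w \<partial>lborel) =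
     (\<integral>\<^sup>+w. ?g (x + s *\<^sub>R w) * indicator (cball \<nu> \<theta>) w \<partial>lborel)"
    using inside by (intro nn_integral_cong) (auto simp: indicator_def)
  also have "\<dots> = ennreal (1 / s ^ CARD('n)) * (\<integral>\<^sup>+y. ?g y * indicator (cball (x + s *\<^sub>R \<nu>) (s * \<theta>)) y \<partial>lborel)"
    by (rule nn_integral_cball_rescale[OF s measurable_cutoff[OF assms]])
  also have "(\<integral>\<^sup>+y. ?g y * indicator (cball (x + s *\<^sub>R \<nu>) (s * \<theta>)) y \<partial>lborel) =
    (\<integral>\<^sup>+y. ennreal (norm (f y)) * indicator (cball (x + s *\<^sub>R \<nu>) (s * \<theta>)) y \<partial>lborel)"
    using cball_inside by (intro nn_integral_cong) (auto simp: indicator_def)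
  finally show ?thesis .
qed

text \<open>The common last step of \<open>avg_bound\<close> and \<open>avg_increment_bound\<close>;
  summing over the components costs the factor \<open>CARD('N)\<close>.\<close>

lemma norm_vec_le_nn_integral:
  fixes v :: "real^'N"
  assumes M: "M \<ge> 0" and f: "continuous_on \<Omega> f" and v: "\<And>j. ennreal \<bar>v $ j\<bar> \<le> (\<integral>\<^sup>+w. ennreal (M * norm (f (x + s *\<^sub>R w))) * indicator (cball \<nu> \<theta>) w \<partial>lborel)"
  shows "ennreal (norm v) \<le> ennreal (real CARD('N) * M * (1 / s ^ CARD('n))) *
    (\<integral>\<^sup>+y. ennreal (norm (f y :: 'c::euclidean_space)) * indicator (cball (x + s *\<^sub>R \<nu>) (s * \<theta>)) y \<partial>lborel)"
proof -
  let ?I = "\<integral>\<^sup>+w. ennreal (M * norm (f (x + s *\<^sub>R w))) * indicator (cball \<nu> \<theta>) w \<partial>lborel"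
  let ?g = "\<lambda>y. ennreal (norm (indicator \<Omega> y *\<^sub>R f y))"
  have "?I = (\<integral>\<^sup>+w. ennreal M * (?g (x + s *\<^sub>R w) * indicator (cball \<nu> \<theta>) w) \<partial>lborel)"
    using inside M by (intro nn_integral_cong) (auto simp: indicator_def ennreal_mult)
  also have "\<dots> = ennreal M * (\<integral>\<^sup>+w. ?g (x + s *\<^sub>R w) * indicator (cball \<nu> \<theta>) w \<partial>lborel)"
  proof (intro nn_integral_cmult borel_measurable_times_ennreal)
    have "(\<lambda>w. x + s *\<^sub>R w) \<in> borel_measurable lborel" by measurable
    from measurable_compose[OF this measurable_cutoff[OF f]]
    show "(\<lambda>w. ?g (x + s *\<^sub>R w)) \<in> borel_measurable lborel" .
  qed (simp add: borel_measurable_indicator)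
  also have "(\<integral>\<^sup>+w. ?g (x + s *\<^sub>R w) * indicator (cball \<nu> \<theta>) w \<partial>lborel) =
      (\<integral>\<^sup>+w. ennreal (norm (f (x + s *\<^sub>R w))) * indicator (cball \<nu> \<theta>) w \<partial>lborel)"
    using inside by (intro nn_integral_cong) (auto simp: indicator_def)
  finally have I: "?I = ennreal M * (ennreal (1 / s ^ CARD('n)) * (\<integral>\<^sup>+y. ennreal (norm (f y)) * indicator (cball (x + s *\<^sub>R \<nu>) (s * \<theta>)) y \<partial>lborel))"
    unfolding nn_integral_cutoff[OF f] .
  have "ennreal (norm v) \<le> ennreal (\<Sum>j\<in>UNIV. \<bar>v $ j\<bar>)"
    by (intro ennreal_leI norm_le_l1_cart)
  also have "\<dots> = (\<Sum>j\<in>UNIV. ennreal \<bar>v $ j\<bar>)" by (subst sum_ennreal) auto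
  also have "\<dots> \<le> (\<Sum>j\<in>(UNIV::'N set). ?I)" by (intro sum_mono v)
  also have "\<dots> = ennreal (real CARD('N)) * ?I" by (simp add: ennreal_of_nat_eq_real_of_nat)
  finally have "ennreal (norm v) \<le> ennreal (real CARD('N)) * ?I" .
  moreover have "ennreal (real CARD('N) * M * (1 / s ^ CARD('n))) =
      ennreal (real CARD('N)) * ennreal M * ennreal (1 / s ^ CARD('n))"
    using s M by (simp add: ennreal_mult[symmetric])
  ultimately show ?thesis unfolding I by (simp only: mult.assoc)
qed

lemma avg_bound:
  assumes M: "\<And>y. \<bar>\<rho> y\<bar> \<le> M"
  shows "ennreal (norm (avg u x s)) \<le> ennreal (real CARD('N) * M * (1 / s ^ CARD('n))) *
    (\<integral>\<^sup>+y. ennreal (norm (u y)) * indicator (cball (x + s *\<^sub>R \<nu>) (s * \<theta>)) y \<partial>lborel)"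
proof (rule norm_vec_le_nn_integral)
  show "M \<ge> 0" using M[of 0] by linarith
  show "continuous_on \<Omega> u" by (rule C1_on_continuous[OF C1])
  fix j
  have int: "integrable lborel (\<lambda>w. \<rho> w * u (x + s *\<^sub>R w) $ j)"
    by (rule integrable_continuous_compact_support[OF avg_integrand_continuous, of \<nu> \<theta>]) (simp add: supp)
  have "ennreal \<bar>avg u x s $ j\<bar> \<le> (\<integral>\<^sup>+w. norm (\<rho> w * u (x + s *\<^sub>R w) $ j) \<partial>lborel)"
    using integral_norm_bound_ennreal[OF int] by (simp add: avg_def)
  also have "\<dots> \<le> (\<integral>\<^sup>+w. ennreal (M * norm (u (x + s *\<^sub>R w))) * indicator (cball \<nu> \<theta>) w \<partial>lborel)"
  proof (rule nn_integral_mono)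
    fix w
    show "ennreal (norm (\<rho> w * u (x + s *\<^sub>R w) $ j)) \<le> ennreal (M * norm (u (x + s *\<^sub>R w))) * indicator (cball \<nu> \<theta>) w"
    proof (cases "w \<in> cball \<nu> \<theta>")
      case True
      then show ?thesis using M[of w] component_le_norm_cart[of "u (x + s *\<^sub>R w)" j]
        by (auto simp: abs_mult intro!: ennreal_leI mult_mono)
    qed (simp add: supp)
  qed
  finally show "ennreal \<bar>avg u x s $ j\<bar> \<le> (\<integral>\<^sup>+w. ennreal (M * norm (u (x + s *\<^sub>R w))) * indicator (cball \<nu> \<theta>) w \<partial>lborel)" .
qed

text \<open>The factor s from \<open>partial_integration\<close> turns the weight s^(-n) into
  s^(1-n), which later cancels against the (n-1)-dimensional measure of a boundary piece of size
  s.\<close>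

lemma avg_increment_bound:
  assumes M: "\<And>y j. norm (h j y) \<le> M"
  shows "ennreal (norm (avg u x s - avg u x (\<mu> * s))) \<le> ennreal (real CARD('N) * (s * M) * (1 / s ^ CARD('n))) *
    (\<integral>\<^sup>+y. ennreal (norm (diff_op A u y)) * indicator (cball (x + s *\<^sub>R \<nu>) (s * \<theta>)) y \<partial>lborel)"
proof (rule norm_vec_le_nn_integral)
  have "M \<ge> 0" using order_trans[OF norm_ge_zero M] .
  then show "s * M \<ge> 0" using s by simp
  show cA: "continuous_on \<Omega> (diff_op A u)" by (rule diff_op_continuous[OF lin C1])
  fix j
  let ?f = "\<lambda>w. diff_op A u (x + s *\<^sub>R w) \<bullet> h j w"
  have cf: "continuous_on UNIV ?f"
  proof (rule continuous_cutoff[OF op C1 s inside])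
    show "continuous_on ((\<lambda>w. x + s *\<^sub>R w) -` \<Omega>) ?f"
      by (intro continuous_on_inner continuous_rescaled[OF op C1 s inside cA] continuous_on_subset[OF cont(2) subset_UNIV])
  qed (simp_all add: supp)
  have int: "integrable lborel ?f"
    by (rule integrable_continuous_compact_support[OF cf, of \<nu> \<theta>]) (simp add: supp)
  have "ennreal \<bar>(avg u x s - avg u x (\<mu> * s)) $ j\<bar> = ennreal (norm (LINT w|lborel. s * ?f w))"
    unfolding avg_increment by simp
  also have "\<dots> \<le> (\<integral>\<^sup>+w. norm (s * ?f w) \<partial>lborel)"
    by (rule integral_norm_bound_ennreal) (use int in simp)
  also have "\<dots> \<le> (\<integral>\<^sup>+w. ennreal (s * M * norm (diff_op A u (x + s *\<^sub>R w))) * indicator (cball \<nu> \<theta>) w \<partial>lborel)"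
  proof (rule nn_integral_mono)
    fix w
    show "ennreal (norm (s * ?f w)) \<le> ennreal (s * M * norm (diff_op A u (x + s *\<^sub>R w))) * indicator (cball \<nu> \<theta>) w"
    proof (cases "w \<in> cball \<nu> \<theta>")
      case True
      have "\<bar>?f w\<bar> \<le> norm (diff_op A u (x + s *\<^sub>R w)) * M"
        by (rule order_trans[OF Cauchy_Schwarz_ineq2]) (intro mult_left_mono M norm_ge_zero)
      then show ?thesis using True s by (auto simp: abs_mult mult_ac intro!: ennreal_leI)
    qed (simp add: supp)
  qed
  finally show "ennreal \<bar>(avg u x s - avg u x (\<mu> * s)) $ j\<bar> \<le> (\<integral>\<^sup>+w. ennreal (s * M * norm (diff_op A u (x + s *\<^sub>R w))) * indicator (cball \<nu> \<theta>) w \<partial>lborel)" .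
qed

end

text \<open>Since \<rho> has mass 1, the error is the \<rho>-weighted integral of u(x + s w) - u(x).
  Continuity on the closure suffices because x + s w lies in \<Omega> for w in the support.\<close>

lemma avg_tendsto:
  assumes op: "open \<Omega>" and C1: "C1_on \<Omega> u" and cu: "continuous_on (closure \<Omega>) u" and x: "x \<in> closure \<Omega>"
    and S: "\<And>k::nat. S k > 0" "S \<longlonglongrightarrow> 0"
    and inside: "\<And>k w. w \<in> cball \<nu> \<theta> \<Longrightarrow> x + S k *\<^sub>R w \<in> \<Omega>"
  shows "(\<lambda>k. avg u x (S k)) \<longlonglongrightarrow> u x"
proof (rule vec_tendstoI)
  fix j
  have int\<rho>: "integrable lborel \<rho>" by (rule integrable_continuous_compact_support[OF cont(1) supp(1)])
  define I where "I = (LINT w|lborel. \<bar>\<rho> w\<bar>)"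
  have I0: "I \<ge> 0" by (simp add: I_def)
  show "(\<lambda>k. avg u x (S k) $ j) \<longlonglongrightarrow> u x $ j"
  proof (rule LIMSEQ_I)
    fix e :: real assume e: "e > 0"
    define e' where "e' = e / (I + 1)"
    have e': "e' > 0" using e I0 by (simp add: e'_def)
    obtain d where d: "d > 0" "\<And>y. y \<in> closure \<Omega> \<Longrightarrow> dist y x < d \<Longrightarrow> dist (u y) (u x) < e'"
      using cu x e' unfolding continuous_on_iff by blast
    have "\<forall>\<^sub>F k in sequentially. S k < d / (norm \<nu> + \<theta> + 1)"
      using \<theta> d(1) by (intro order_tendstoD[OF S(2)]) (auto intro!: divide_pos_pos add_nonneg_pos)
    then obtain K where K: "\<And>k. k \<ge> K \<Longrightarrow> S k < d / (norm \<nu> + \<theta> + 1)"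
      unfolding eventually_sequentially by blast
    have "norm (avg u x (S k) $ j - u x $ j) < e" if k: "k \<ge> K" for k
    proof -
      have int: "integrable lborel (\<lambda>w. \<rho> w * u (x + S k *\<^sub>R w) $ j)"
        by (rule integrable_continuous_compact_support[OF avg_integrand_continuous[OF op C1 S(1) inside], of \<nu> \<theta>]) (simp_all add: supp)
      have "avg u x (S k) $ j - u x $ j = (LINT w|lborel. \<rho> w * u (x + S k *\<^sub>R w) $ j) - (LINT w|lborel. \<rho> w * u x $ j)"
        using int1 by (simp add: avg_def)
      also have "\<dots> = (LINT w|lborel. \<rho> w * (u (x + S k *\<^sub>R w) $ j - u x $ j))"
        using int int\<rho> by (simp add: right_diff_distrib Bochner_Integration.integral_diff)
      finally have eq: "avg u x (S k) $ j - u x $ j = (LINT w|lborel. \<rho> w * (u (x + S k *\<^sub>R w) $ j - u x $ j))" .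
      have "norm (avg u x (S k) $ j - u x $ j) \<le> (LINT w|lborel. e' * \<bar>\<rho> w\<bar>)"
        unfolding eq
      proof (rule Bochner_Integration.integral_norm_bound_integral)
        show "integrable lborel (\<lambda>w. \<rho> w * (u (x + S k *\<^sub>R w) $ j - u x $ j))"
          using int int\<rho> by (simp add: right_diff_distrib)
        show "integrable lborel (\<lambda>w. e' * \<bar>\<rho> w\<bar>)" using int\<rho> by simp
        fix w
        show "norm (\<rho> w * (u (x + S k *\<^sub>R w) $ j - u x $ j)) \<le> e' * \<bar>\<rho> w\<bar>"
        proof (cases "w \<in> cball \<nu> \<theta>")
          case True
          have "norm w \<le> norm \<nu> + \<theta>"
            using True norm_triangle_ineq[of \<nu> "w - \<nu>"] by (simp add: dist_norm norm_minus_commute)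
          then have "S k * norm w \<le> S k * (norm \<nu> + \<theta> + 1)" using S(1)[of k] by (intro mult_left_mono) auto
          also have "\<dots> < d"
          proof -
            have "norm \<nu> + \<theta> + 1 > 0" using \<theta> norm_ge_zero[of \<nu>] by linarith
            then show ?thesis using K[OF k] by (simp add: pos_less_divide_eq)
          qed
          finally have "dist (x + S k *\<^sub>R w) x < d" using S(1)[of k] by (simp add: dist_norm)
          then have "norm (u (x + S k *\<^sub>R w) - u x) < e'"
            using d(2)[of "x + S k *\<^sub>R w"] inside[OF True, of k] closure_subset[of \<Omega>] by (auto simp: dist_norm)
          then have "\<bar>u (x + S k *\<^sub>R w) $ j - u x $ j\<bar> \<le> e'"
            using component_le_norm_cart[of "u (x + S k *\<^sub>R w) - u x" j] by simp
          then show ?thesis by (simp add: abs_mult mult.commute[of "\<bar>\<rho> w\<bar>"] mult_right_mono)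
        qed (simp add: supp)
      qed
      also have "\<dots> = e' * I" by (simp add: I_def)
      also have "\<dots> < e" using e I0 by (simp add: e'_def field_simps)
      finally show ?thesis .
    qed
    then show "\<exists>no. \<forall>n\<ge>no. norm (avg u x (S n) $ j - u x $ j) < e" by blast
  qed
qed

text \<open>The averages at the scales \<open>S k\<close> telescope: the first is bounded by u, each
  increment by the operator, and the limit is u(x). Staying in \<open>ennreal\<close> spares any
  distinction between finite and infinite integrals.\<close>

lemma pointwise_estimate:
  assumes op: "open \<Omega>" and C1: "C1_on \<Omega> u" and cu: "continuous_on (closure \<Omega>) u" and x: "x \<in> closure \<Omega>"
    and s0: "s0 > 0"
    and inside: "\<And>s w. 0 < s \<Longrightarrow> s \<le> s0 \<Longrightarrow> w \<in> cball \<nu> \<theta> \<Longrightarrow> x + s *\<^sub>R w \<in> \<Omega>"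
    and M: "\<And>y. \<bar>\<rho> y\<bar> \<le> M" "\<And>y j. norm (h j y) \<le> M"
  defines "S \<equiv> \<lambda>k::nat. s0 / \<mu> ^ k"
  shows "ennreal (norm (u x)) \<le> ennreal (real CARD('N) * M * (1 / s0 ^ CARD('n))) * (\<integral>\<^sup>+y\<in>\<Omega>. ennreal (norm (u y)) \<partial>lborel) +
    (\<Sum>k. ennreal (real CARD('N) * (S (Suc k) * M) * (1 / S (Suc k) ^ CARD('n))) *
    (\<integral>\<^sup>+y. ennreal (norm (diff_op A u y)) * indicator (cball (x + S (Suc k) *\<^sub>R \<nu>) (S (Suc k) * \<theta>)) y \<partial>lborel))"
    (is "_ \<le> ?a + (\<Sum>k. ?b k)")
proof -
  have S: "S k > 0" "S k \<le> s0" for k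
  proof -
    have "\<mu> ^ k \<ge> 1" using \<mu> by simp
    then show "S k > 0" "S k \<le> s0" using s0 by (auto simp: S_def divide_le_eq)
  qed
  have S0: "S \<longlonglongrightarrow> 0"
    unfolding S_def using \<mu> by (intro LIMSEQ_divide_realpow_zero)
  have step: "\<mu> * S (Suc k) = S k" for k using \<mu> by (simp add: S_def)
  have a: "ennreal (norm (avg u x (S 0))) \<le> ?a"
  proof -
    have "ennreal (norm (avg u x s0)) \<le> ennreal (real CARD('N) * M * (1 / s0 ^ CARD('n))) *
      (\<integral>\<^sup>+y. ennreal (norm (u y)) * indicator (cball (x + s0 *\<^sub>R \<nu>) (s0 * \<theta>)) y \<partial>lborel)"
      by (rule avg_bound[OF op C1 s0 inside M(1)]) (use s0 in auto)
    also have "\<dots> \<le> ?a"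
      using cball_inside[OF op C1 s0 inside] s0
      by (intro mult_left_mono nn_integral_mono) (auto simp: indicator_def)
    finally show ?thesis by (simp add: S_def)
  qed
  have b: "ennreal (norm (avg u x (S (Suc k)) - avg u x (S k))) \<le> ?b k" for k
    using avg_increment_bound[OF op C1 S(1) inside M(2), of "Suc k"] S(2)[of "Suc k"] S(1)[of "Suc k"]
    unfolding step by simp
  have "ennreal (norm (avg u x (S k))) \<le> ?a + (\<Sum>i<k. ?b i)" for k
  proof (induction k)
    case 0
    then show ?case using a by simp
  next
    case (Suc k)
    have "ennreal (norm (avg u x (S (Suc k)))) \<le> ennreal (norm (avg u x (S k)) + norm (avg u x (S (Suc k)) - avg u x (S k)))"
      by (intro ennreal_leI norm_triangle_sub)
    also have "\<dots> = ennreal (norm (avg u x (S k))) + ennreal (norm (avg u x (S (Suc k)) - avg u x (S k)))"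
      by (rule ennreal_plus) auto
    also have "\<dots> \<le> (?a + (\<Sum>i<k. ?b i)) + ?b k" by (rule add_mono[OF Suc b])
    also have "\<dots> = ?a + (\<Sum>i<Suc k. ?b i)" by (simp only: sum.lessThan_Suc add.assoc)
    finally show ?case .
  qed
  then have *: "ennreal (norm (avg u x (S k))) \<le> ?a + (\<Sum>i. ?b i)" for k
    by (rule order_trans) (intro add_left_mono sum_le_suminf, auto)
  have "(\<lambda>k. avg u x (S k)) \<longlonglongrightarrow> u x"
    by (rule avg_tendsto[OF op C1 cu x S(1) S0]) (use inside S in blast)
  then have "(\<lambda>k. ennreal (norm (avg u x (S k)))) \<longlonglongrightarrow> ennreal (norm (u x))"
    by (intro tendsto_ennrealI tendsto_norm)
  then show ?thesis by (rule LIMSEQ_le_const2) (use * in blast)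
qed

end


section \<open>Hausdorff measure of Lipschitz graphs\<close>

lemma space_hausdorff_measure [simp]: "space (hausdorff_measure s) = UNIV"
  by (simp add: hausdorff_measure_def)

lemma sets_hausdorff_measure [simp, measurable_cong]: "sets (hausdorff_measure s) = sets borel"
  using sets.sigma_sets_eq[of "borel :: 'a measure"] by (simp add: hausdorff_measure_def)

text \<open>A measure formed by \<open>measure_of\<close> takes the value of the set function or 0,
  so this half is available before countable additivity.\<close>

lemma emeasure_hausdorff_measure_le: "emeasure (hausdorff_measure s) E \<le> hausdorff_outer s E"
  unfolding hausdorff_measure_def emeasure_measure_of_conv by simp

lemma hausdorff_premeasure_finite_cover:
  fixes E :: "'a::metric_space set"
  assumes P: "finite P" "E \<subseteq> \<Union>P" and d: "\<And>X. X \<in> P \<Longrightarrow> bounded X \<and> diameter X \<le> d" and "0 \<le> d" "d \<le> \<delta>"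
  shows "hausdorff_premeasure s \<delta> E \<le> ennreal (real (card P) * (unit_ball_vol (real s) * (d / 2) ^ s))"
proof -
  obtain f where f: "bij_betw f {..<card P} P"
    using ex_bij_betw_nat_finite[OF P(1)] by (auto simp: lessThan_atLeast0)
  define C where "C i = (if i < card P then f i else {})" for i
  have fP: "f i \<in> P" if "i < card P" for i using f that by (auto simp: bij_betw_def)
  have "E \<subseteq> (\<Union>i. C i)"
  proof
    fix x assume "x \<in> E"
    then obtain X where "X \<in> P" "x \<in> X" using P by blast
    moreover then obtain i where "i < card P" "X = f i" using f by (auto simp: bij_betw_def)
    ultimately show "x \<in> (\<Union>i. C i)" by (auto simp: C_def intro!: exI[of _ i])
  qed
  moreover have "bounded (C i) \<and> diameter (C i) \<le> \<delta>" for i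
    using d[OF fP] assms(4,5) by (force simp: C_def)
  ultimately have "hausdorff_premeasure s \<delta> E \<le> (\<Sum>i. if C i = {} then 0
            else ennreal (unit_ball_vol (real s) * (diameter (C i) / 2) ^ s))"
    unfolding hausdorff_premeasure_def by (intro INF_lower) auto
  also have "\<dots> = (\<Sum>i<card P. if C i = {} then 0
            else ennreal (unit_ball_vol (real s) * (diameter (C i) / 2) ^ s))"
    by (rule suminf_finite) (auto simp: C_def)
  also have "\<dots> \<le> (\<Sum>i<card P. ennreal (unit_ball_vol (real s) * (d / 2) ^ s))"
  proof (rule sum_mono)
    fix i assume "i \<in> {..<card P}"
    then have "bounded (C i)" "diameter (C i) \<le> d" using d[OF fP] by (auto simp: C_def)
    then show "(if C i = {} then 0 else ennreal (unit_ball_vol (real s) * (diameter (C i) / 2) ^ s))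
        \<le> ennreal (unit_ball_vol (real s) * (d / 2) ^ s)"
      using diameter_ge_0[of "C i"]
      by (auto intro!: ennreal_leI mult_left_mono power_mono unit_ball_vol_nonneg)
  qed
  also have "\<dots> = ennreal (real (card P) * (unit_ball_vol (real s) * (d / 2) ^ s))"
    using assms(4) by (simp add: ennreal_mult ennreal_of_nat_eq_real_of_nat)
  finally show ?thesis .
qed

text \<open>Covers by the cells of a grid of mesh R/m; their number grows like \<open>m ^ card I\<close>.\<close>

lemma hausdorff_outer_coordinates:
  fixes E :: "'a::metric_space set" and p :: "'i \<Rightarrow> 'a \<Rightarrow> real"
  assumes I: "finite I" and R: "R > 0" and C: "C > 0"
    and box: "\<And>x l. x \<in> E \<Longrightarrow> l \<in> I \<Longrightarrow> \<bar>p l x - c l\<bar> \<le> R"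
    and lip: "\<And>x y t. x \<in> E \<Longrightarrow> y \<in> E \<Longrightarrow> t \<ge> 0 \<Longrightarrow> (\<And>l. l \<in> I \<Longrightarrow> \<bar>p l x - p l y\<bar> \<le> t) \<Longrightarrow> dist x y \<le> C * t"
  shows "hausdorff_outer (card I) E \<le> ennreal (unit_ball_vol (real (card I)) * (3 * C * R / 2) ^ card I)"
  unfolding hausdorff_outer_def
proof (rule SUP_least)
  fix \<delta> :: real assume "\<delta> \<in> {0<..}"
  then have \<delta>: "\<delta> > 0" by simp
  \<comment> \<open>The mesh R / m must give cells of diameter at most \<delta>.\<close>
  obtain m0 where m0: "C * R / \<delta> < real m0" using reals_Archimedean2 by blast
  define m where "m = Suc m0"
  have m: "real m > 0" "C * (R / real m) \<le> \<delta>"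
    using m0 \<delta> by (auto simp: m_def field_simps)
  \<comment> \<open>The index of the grid cell. It runs from 0 to 2 m inclusive, so there are 2 m +
    1 \<le> 3 m cells per direction; this is the 3 in the final constant.\<close>
  define q where "q x l = nat \<lfloor>(p l x - c l + R) * real m / R\<rfloor>" for x l
  define cell where "cell k = {x \<in> E. \<forall>l\<in>I. q x l = k l}" for k
  let ?K = "PiE I (\<lambda>_. {..2 * m})"
  let ?P = "cell ` ?K"
  have finK: "finite ?K" using I by (intro finite_PiE) auto
  have pos: "(p l x - c l + R) * real m / R \<ge> 0" "(p l x - c l + R) * real m / R \<le> 2 * real m" if "x \<in> E" "l \<in> I" for x l
  proof -
    have b: "0 \<le> p l x - c l + R" "p l x - c l + R \<le> 2 * R" using box[OF that] by (auto simp: abs_le_iff)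
    then show "(p l x - c l + R) * real m / R \<ge> 0" using R m by simp
    have "(p l x - c l + R) * real m / R \<le> (2 * R) * real m / R"
      using b R m by (intro divide_right_mono mult_right_mono) auto
    then show "(p l x - c l + R) * real m / R \<le> 2 * real m" using R by simp
  qed
  have "E \<subseteq> \<Union>?P"
  proof
    fix x assume x: "x \<in> E"
    have "restrict (q x) I \<in> ?K"
    proof (intro PiE_I)
      fix l assume l: "l \<in> I"
      have "\<lfloor>(p l x - c l + R) * real m / R\<rfloor> \<le> 2 * int m"
        using pos(2)[OF x l] by linarith
      then show "restrict (q x) I l \<in> {..2 * m}" using l by (simp add: q_def nat_le_iff)
    qed auto
    moreover have "x \<in> cell (restrict (q x) I)" using x by (simp add: cell_def)
    ultimately show "x \<in> \<Union>?P" by blast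
  qed
  moreover have "bounded X \<and> diameter X \<le> C * (R / real m)" if XP: "X \<in> ?P" for X
  proof -
    obtain k where X: "X = cell k" using XP by blast
    have dist: "dist x y \<le> C * (R / real m)" if "x \<in> X" "y \<in> X" for x y
    proof (rule lip)
      show "x \<in> E" "y \<in> E" using that by (auto simp: X cell_def)
      show "R / real m \<ge> 0" using R by simp
      fix l assume l: "l \<in> I"
      let ?a = "(p l x - c l + R) * real m / R" and ?b = "(p l y - c l + R) * real m / R"
      have "q x l = q y l" using that l by (simp add: X cell_def)
      then have "\<lfloor>?a\<rfloor> = \<lfloor>?b\<rfloor>"
        using pos(1)[OF \<open>x \<in> E\<close> l] pos(1)[OF \<open>y \<in> E\<close> l] by (simp add: q_def nat_eq_iff)
      then have "\<bar>?a - ?b\<bar> \<le> 1" by linarith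
      moreover have "?a - ?b = (p l x - p l y) * (real m / R)" using R by (simp add: field_simps)
      ultimately have "\<bar>p l x - p l y\<bar> * (real m / R) \<le> 1" using R m by (simp add: abs_mult)
      then show "\<bar>p l x - p l y\<bar> \<le> R / real m" using R m by (simp add: field_simps)
    qed
    have "bounded X"
    proof (cases "X = {}")
      case False
      then obtain x where "x \<in> X" by blast
      then show ?thesis using dist unfolding bounded_def by blast
    qed simp
    moreover have "diameter X \<le> C * (R / real m)"
      using dist C R by (auto simp: diameter_def intro!: cSUP_least)
    ultimately show ?thesis by blast
  qed
  ultimately have "hausdorff_premeasure (card I) \<delta> E \<le> ennreal (real (card ?P) * (unit_ball_vol (real (card I)) * (C * (R / real m) / 2) ^ card I))"
    using finK C R m by (intro hausdorff_premeasure_finite_cover) auto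
  also have "\<dots> \<le> ennreal (unit_ball_vol (real (card I)) * (3 * C * R / 2) ^ card I)"
  proof (rule ennreal_leI)
    have "card ?P \<le> card ?K" by (rule card_image_le[OF finK])
    also have "\<dots> = (2 * m + 1) ^ card I" using I by (simp add: card_PiE)
    also have "\<dots> \<le> (3 * m) ^ card I" by (intro power_mono) (auto simp: m_def)
    finally have "real (card ?P) \<le> real ((3 * m) ^ card I)" by (simp only: of_nat_le_iff)
    then have cP: "real (card ?P) \<le> (3 * real m) ^ card I" by simp
    have "real (card ?P) * (unit_ball_vol (real (card I)) * (C * (R / real m) / 2) ^ card I) \<le>
      (3 * real m) ^ card I * (unit_ball_vol (real (card I)) * (C * (R / real m) / 2) ^ card I)"
      using C R by (intro mult_right_mono cP mult_nonneg_nonneg unit_ball_vol_nonneg zero_le_power) auto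
    also have "\<dots> = unit_ball_vol (real (card I)) * (3 * real m * (C * (R / real m) / 2)) ^ card I"
      by (subst power_mult_distrib[of "3 * real m" "C * (R / real m) / 2"]) (simp only: mult_ac)
    also have "3 * real m * (C * (R / real m) / 2) = 3 * C * R / 2" using m by simp
    finally show "real (card ?P) * (unit_ball_vol (real (card I)) * (C * (R / real m) / 2) ^ card I) \<le>
      unit_ball_vol (real (card I)) * (3 * C * R / 2) ^ card I" .
  qed
  finally show "hausdorff_premeasure (card I) \<delta> E \<le> ennreal (unit_ball_vol (real (card I)) * (3 * C * R / 2) ^ card I)" .
qed

section \<open>Lipschitz graphs over the hyperplane orthogonal to \<nu>\<close>

definition hproj :: "'a::real_inner \<Rightarrow> 'a \<Rightarrow> 'a" where
  "hproj \<nu> x = x - (x \<bullet> \<nu>) *\<^sub>R \<nu>"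

lemma hproj_diff: "hproj \<nu> (x - y) = hproj \<nu> x - hproj \<nu> y"
  by (simp add: hproj_def algebra_simps inner_diff_left)

lemma hproj_add: "hproj \<nu> (x + y) = hproj \<nu> x + hproj \<nu> y"
  by (simp add: hproj_def algebra_simps inner_add_left)

lemma hproj_scale: "hproj \<nu> (s *\<^sub>R x) = s *\<^sub>R hproj \<nu> x"
  by (simp add: hproj_def algebra_simps)

lemma hproj_norm_le: "norm \<nu> = 1 \<Longrightarrow> norm (hproj \<nu> x) \<le> 2 * norm x"
  using norm_triangle_ineq4[of x "(x \<bullet> \<nu>) *\<^sub>R \<nu>"] Cauchy_Schwarz_ineq2[of x \<nu>] by (simp add: hproj_def)

lemma hproj_orthogonal: "norm \<nu> = 1 \<Longrightarrow> hproj \<nu> x \<bullet> \<nu> = 0"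
  by (simp add: hproj_def inner_diff_left dot_square_norm)

text \<open>A point of the graph is determined by its projection, and the projection, being
  orthogonal to \<nu>, by its coordinates other than some i with \<nu>_i \<noteq> 0. Both
  dependences are Lipschitz, so n - 1 of the given coordinates suffice and no rotation is carried
  out.\<close>

lemma hausdorff_graph:
  fixes \<nu> :: "real^'n::finite"
  assumes \<nu>: "norm \<nu> = 1" and \<gamma>: "L-lipschitz_on {z. z \<bullet> \<nu> = 0} \<gamma>"
  shows "\<exists>K>0. \<forall>\<Gamma> z R. (\<forall>x\<in>\<Gamma>. x \<bullet> \<nu> = \<gamma> (hproj \<nu> x)) \<longrightarrow> R > 0 \<longrightarrow> \<Gamma> \<subseteq> cball z R \<longrightarrow>
    emeasure (hausdorff_measure (CARD('n) - 1)) \<Gamma> \<le> ennreal (K * R ^ (CARD('n) - 1))"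
proof -
  have "\<nu> \<noteq> 0" using \<nu> by auto
  then obtain i where i: "\<nu> $ i \<noteq> 0" by (auto simp: vec_eq_iff)
  let ?I = "UNIV - {i}"
  let ?n = "real CARD('n)"
  have L: "L \<ge> 0" using \<gamma> by (simp add: lipschitz_on_def)
  \<comment> \<open>The term n / |\<nu>_i| bounds the dropped coordinate, which is solved from
    orthogonality; the factor 1 + L accounts for the height of the graph.\<close>
  define C where "C = (1 + L) * (?n + ?n / \<bar>\<nu> $ i\<bar>)"
  have C: "C > 0" using L i by (auto simp: C_def intro!: mult_pos_pos add_pos_nonneg)
  define K where "K = unit_ball_vol (real (CARD('n) - 1)) * (3 * C) ^ (CARD('n) - 1)"
  have "K > 0" using C by (simp add: K_def)
  have "emeasure (hausdorff_measure (CARD('n) - 1)) \<Gamma> \<le> ennreal (K * R ^ (CARD('n) - 1))"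
    if graph: "\<forall>x\<in>\<Gamma>. x \<bullet> \<nu> = \<gamma> (hproj \<nu> x)" and R: "R > 0" and sub: "\<Gamma> \<subseteq> cball z R" for \<Gamma> z R
  proof -
    have "hausdorff_outer (card ?I) \<Gamma> \<le> ennreal (unit_ball_vol (real (card ?I)) * (3 * C * (2 * R) / 2) ^ card ?I)"
    proof (rule hausdorff_outer_coordinates[where p = "\<lambda>l x. hproj \<nu> x $ l" and c = "\<lambda>l. hproj \<nu> z $ l"])
      show "\<bar>hproj \<nu> x $ l - hproj \<nu> z $ l\<bar> \<le> 2 * R" if "x \<in> \<Gamma>" for x l
      proof -
        have "\<bar>hproj \<nu> x $ l - hproj \<nu> z $ l\<bar> \<le> norm (hproj \<nu> (x - z))"
          using component_le_norm_cart[of "hproj \<nu> (x - z)" l] by (simp add: hproj_diff)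
        also have "\<dots> \<le> 2 * norm (x - z)" by (rule hproj_norm_le[OF \<nu>])
        also have "\<dots> \<le> 2 * R" using that sub by (auto simp: dist_norm norm_minus_commute)
        finally show ?thesis .
      qed
      fix x y :: "real^'n" and t :: real
      assume xy: "x \<in> \<Gamma>" "y \<in> \<Gamma>" and t: "t \<ge> 0" "\<And>l. l \<in> ?I \<Longrightarrow> \<bar>hproj \<nu> x $ l - hproj \<nu> y $ l\<bar> \<le> t"
      define d where "d = hproj \<nu> (x - y)"
      have dl: "\<bar>d $ l\<bar> \<le> t" if "l \<noteq> i" for l using t(2)[of l] that by (simp add: d_def hproj_diff)
      have "d \<bullet> \<nu> = 0" unfolding d_def by (rule hproj_orthogonal[OF \<nu>])
      then have "d $ i * \<nu> $ i = - (\<Sum>l\<in>?I. d $ l * \<nu> $ l)"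
        by (simp add: inner_vec_def sum.remove[of UNIV i])
      then have "\<bar>d $ i\<bar> * \<bar>\<nu> $ i\<bar> = \<bar>\<Sum>l\<in>?I. d $ l * \<nu> $ l\<bar>" by (metis abs_minus_cancel abs_mult)
      also have "\<dots> \<le> (\<Sum>l\<in>?I. \<bar>d $ l * \<nu> $ l\<bar>)" by (rule sum_abs)
      also have "\<dots> \<le> (\<Sum>l\<in>?I. t)"
      proof (rule sum_mono)
        fix l assume "l \<in> ?I"
        then show "\<bar>d $ l * \<nu> $ l\<bar> \<le> t"
          using mult_mono[OF dl[of l], of "\<bar>\<nu> $ l\<bar>" 1] component_le_norm_cart[of \<nu> l] \<nu> t(1) by (simp add: abs_mult)
      qed
      also have "\<dots> \<le> ?n * t" using t(1) by (simp add: mult_right_mono)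
      finally have di: "\<bar>d $ i\<bar> \<le> ?n * t / \<bar>\<nu> $ i\<bar>" using i by (simp add: field_simps)
      have "norm d \<le> (\<Sum>l\<in>UNIV. \<bar>d $ l\<bar>)" by (rule norm_le_l1_cart)
      also have "\<dots> = \<bar>d $ i\<bar> + (\<Sum>l\<in>?I. \<bar>d $ l\<bar>)" by (simp add: sum.remove[of UNIV i])
      also have "(\<Sum>l\<in>?I. \<bar>d $ l\<bar>) \<le> (\<Sum>l\<in>?I. t)" using dl by (intro sum_mono) auto
      also have "\<dots> \<le> ?n * t" using t(1) by (simp add: mult_right_mono)
      finally have nd: "norm d \<le> (?n + ?n / \<bar>\<nu> $ i\<bar>) * t" using di by (simp add: algebra_simps)
      have "x - y = d + ((x - y) \<bullet> \<nu>) *\<^sub>R \<nu>" by (simp add: d_def hproj_def)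
      then have "dist x y \<le> norm d + \<bar>(x - y) \<bullet> \<nu>\<bar>"
        using norm_triangle_ineq[of d "((x - y) \<bullet> \<nu>) *\<^sub>R \<nu>"] \<nu> by (simp add: dist_norm)
      also have "\<bar>(x - y) \<bullet> \<nu>\<bar> = dist (\<gamma> (hproj \<nu> x)) (\<gamma> (hproj \<nu> y))"
        using graph xy by (simp add: inner_diff_left dist_real_def)
      also have "\<dots> \<le> L * dist (hproj \<nu> x) (hproj \<nu> y)"
        by (rule lipschitz_onD[OF \<gamma>]) (simp_all add: hproj_orthogonal[OF \<nu>])
      also have "\<dots> = L * norm d" by (simp add: d_def hproj_diff dist_norm)
      finally have "dist x y \<le> (1 + L) * norm d" by (simp add: algebra_simps)
      also have "\<dots> \<le> (1 + L) * ((?n + ?n / \<bar>\<nu> $ i\<bar>) * t)" using L by (intro mult_left_mono nd) auto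
      finally show "dist x y \<le> C * t" by (simp add: C_def mult.assoc)
    qed (use R C in auto)
    moreover have "card ?I = CARD('n) - 1" by simp
    ultimately have "hausdorff_outer (CARD('n) - 1) \<Gamma> \<le> ennreal (K * R ^ (CARD('n) - 1))"
      by (simp add: K_def power_mult_distrib mult_ac)
    then show ?thesis using emeasure_hausdorff_measure_le order_trans by blast
  qed
  then show ?thesis using \<open>K > 0\<close> by blast
qed


section \<open>The trace inequality for elliptic operators\<close>

text \<open>The window has ratio 4, and J steps change the scale by more than 4, so all admissible
  indices lie within J of the least one. The window comes from \<open>graph_height\<close>, with
  \<tau> the height of a point over the graph.\<close>

lemma geometric_scales_count:
  fixes \<mu> s0 \<tau> :: real
  assumes \<mu>: "\<mu> > 1" and s0: "s0 > 0" and J: "\<mu> ^ J > 4"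
  shows "(\<Sum>k. indicator {k. \<tau> / 2 \<le> s0 / \<mu> ^ Suc k \<and> s0 / \<mu> ^ Suc k \<le> 2 * \<tau>} k :: ennreal) \<le> of_nat (Suc J)"
proof -
  let ?T = "{k. \<tau> / 2 \<le> s0 / \<mu> ^ Suc k \<and> s0 / \<mu> ^ Suc k \<le> 2 * \<tau>}"
  show ?thesis
  proof (cases "?T = {}")
    case False
    then obtain k0 where "k0 \<in> ?T" by blast
    define k1 where "k1 = (LEAST k. k \<in> ?T)"
    have k1: "k1 \<in> ?T" unfolding k1_def by (rule LeastI[of _ k0]) fact
    have sub: "?T \<subseteq> {k1..k1 + J}"
    proof
      fix k assume k: "k \<in> ?T"
      have le: "k1 \<le> k" unfolding k1_def by (rule Least_le[where P = "\<lambda>k. k \<in> ?T", OF k])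
      have "s0 / \<mu> ^ Suc k1 \<le> 4 * (s0 / \<mu> ^ Suc k)" using k k1 by auto
      moreover have "\<mu> ^ Suc k = \<mu> ^ Suc k1 * \<mu> ^ (k - k1)" using le by (simp add: power_add[symmetric])
      ultimately have "\<mu> ^ (k - k1) \<le> 4" using \<mu> s0 by (simp add: field_simps)
      then have "\<mu> ^ (k - k1) < \<mu> ^ J" using J by linarith
      then have "k - k1 < J" using \<mu> by simp
      then show "k \<in> {k1..k1 + J}" using le by auto
    qed
    have "(\<Sum>k. indicator ?T k :: ennreal) = (\<Sum>k\<in>{k1..k1 + J}. indicator ?T k)"
      by (rule suminf_finite) (use sub in \<open>auto simp: indicator_def\<close>)
    also have "\<dots> \<le> (\<Sum>k\<in>{k1..k1 + J}. 1)"
      by (intro sum_mono) (auto simp: indicator_def)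
    also have "\<dots> = of_nat (Suc J)" by simp
    finally show ?thesis .
  next
    case True
    then show ?thesis unfolding True by simp
  qed
qed

lemma continuous_on_hproj: "continuous_on S (hproj \<nu>)"
  unfolding hproj_def by (intro continuous_intros)

text \<open>A frontier point of an open set is outside it, hence not strictly above the graph;
  strictly below it would have a neighbourhood below the graph, which misses \<Omega>.\<close>

lemma frontier_on_graph:
  assumes op: "open \<Omega>" and \<nu>: "norm \<nu> = 1" and \<gamma>: "L-lipschitz_on {z. z \<bullet> \<nu> = 0} \<gamma>"
    and graph: "\<Omega> \<inter> ball x0 r = {y \<in> ball x0 r. \<gamma> (hproj \<nu> y) < y \<bullet> \<nu>}"
    and x: "x \<in> frontier \<Omega>" "x \<in> ball x0 r"
  shows "x \<bullet> \<nu> = \<gamma> (hproj \<nu> x)"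
proof (rule antisym)
  have "x \<notin> \<Omega>" using x op by (simp add: frontier_def interior_open)
  then show "x \<bullet> \<nu> \<le> \<gamma> (hproj \<nu> x)" using graph x(2) by force
  show "\<gamma> (hproj \<nu> x) \<le> x \<bullet> \<nu>"
  proof (rule ccontr)
    assume a: "\<not> ?thesis"
    have "continuous_on {z. z \<bullet> \<nu> = 0} \<gamma>" by (rule lipschitz_on_continuous_on[OF \<gamma>])
    then have c: "continuous_on UNIV (\<lambda>y. \<gamma> (hproj \<nu> y))"
      by (rule continuous_on_compose2[OF _ continuous_on_hproj]) (auto simp: hproj_orthogonal[OF \<nu>])
    have "open {y. y \<bullet> \<nu> < \<gamma> (hproj \<nu> y)}"
      by (intro open_Collect_less c continuous_intros)
    then have "open ({y. y \<bullet> \<nu> < \<gamma> (hproj \<nu> y)} \<inter> ball x0 r)" by auto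
    moreover have "x \<in> {y. y \<bullet> \<nu> < \<gamma> (hproj \<nu> y)} \<inter> ball x0 r" using a x by auto
    moreover have "x \<in> closure \<Omega>" using x by (simp add: frontier_def)
    ultimately obtain y where "y \<in> \<Omega>" "y \<in> {y. y \<bullet> \<nu> < \<gamma> (hproj \<nu> y)} \<inter> ball x0 r"
      unfolding closure_iff_nhds_not_empty by blast
    then show False using graph by force
  qed
qed

text \<open>For w = \<nu> the height is exactly s. A deviation of at most \<theta> alters the
  vertical part by at most \<theta> s \<le> s/4 and, as the projection costs a factor 2, the value
  of \<gamma> by at most 2 L \<theta> s \<le> s/4.\<close>

lemma graph_height:
  assumes \<nu>: "norm \<nu> = 1" and \<gamma>: "L-lipschitz_on {z. z \<bullet> \<nu> = 0} \<gamma>"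
    and \<theta>: "0 < \<theta>" "\<theta> \<le> 1/4" "L * \<theta> \<le> 1/8" and s: "s > 0" and w: "w \<in> cball \<nu> \<theta>" and x: "x \<bullet> \<nu> = \<gamma> (hproj \<nu> x)"
  defines "\<tau> \<equiv> (x + s *\<^sub>R w) \<bullet> \<nu> - \<gamma> (hproj \<nu> (x + s *\<^sub>R w))"
  shows "s / 2 \<le> \<tau>" "\<tau> \<le> 2 * s"
proof -
  have L: "L \<ge> 0" using \<gamma> by (simp add: lipschitz_on_def)
  have wn: "norm (w - \<nu>) \<le> \<theta>" using w by (simp add: dist_norm norm_minus_commute)
  have "hproj \<nu> \<nu> = 0" using \<nu> by (simp add: hproj_def dot_square_norm)
  then have "norm (hproj \<nu> w) \<le> 2 * \<theta>"
    using hproj_norm_le[OF \<nu>, of "w - \<nu>"] wn by (simp add: hproj_diff)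
  then have 1: "L * (s * norm (hproj \<nu> w)) \<le> L * (s * (2 * \<theta>))" using L s by (intro mult_left_mono) auto
  have 2: "L * (s * (2 * \<theta>)) \<le> s / 4"
  proof -
    have "L * (s * (2 * \<theta>)) = (2 * s) * (L * \<theta>)" by simp
    also have "\<dots> \<le> (2 * s) * (1/8)" using s \<theta>(3) by (intro mult_left_mono) auto
    finally show ?thesis by simp
  qed
  have "dist (\<gamma> (hproj \<nu> (x + s *\<^sub>R w))) (\<gamma> (hproj \<nu> x)) \<le> L * dist (hproj \<nu> (x + s *\<^sub>R w)) (hproj \<nu> x)"
    by (rule lipschitz_onD[OF \<gamma>]) (simp_all add: hproj_orthogonal[OF \<nu>])
  also have "\<dots> = L * (s * norm (hproj \<nu> w))" using s by (simp add: hproj_add hproj_scale dist_norm)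
  finally have 3: "\<bar>\<gamma> (hproj \<nu> (x + s *\<^sub>R w)) - \<gamma> (hproj \<nu> x)\<bar> \<le> s / 4" using 1 2 by (simp add: dist_real_def)
  have "w \<bullet> \<nu> - 1 = (w - \<nu>) \<bullet> \<nu>" using \<nu> by (simp add: inner_diff_left dot_square_norm)
  then have "\<bar>w \<bullet> \<nu> - 1\<bar> \<le> 1/4" using Cauchy_Schwarz_ineq2[of "w - \<nu>" \<nu>] wn \<nu> \<theta> by simp
  then have "s * \<bar>w \<bullet> \<nu> - 1\<bar> \<le> s * (1/4)" using s by (intro mult_left_mono) auto
  then have 4: "\<bar>s * (w \<bullet> \<nu>) - s\<bar> \<le> s / 4"
  proof -
    have "s * (w \<bullet> \<nu>) - s = s * (w \<bullet> \<nu> - 1)" by (simp add: algebra_simps)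
    then show ?thesis using \<open>s * \<bar>w \<bullet> \<nu> - 1\<bar> \<le> s * (1/4)\<close> s by (simp add: abs_mult)
  qed
  have "\<tau> = s * (w \<bullet> \<nu>) - (\<gamma> (hproj \<nu> (x + s *\<^sub>R w)) - \<gamma> (hproj \<nu> x))"
    by (simp add: \<tau>_def inner_add_left x)
  then show "s / 2 \<le> \<tau>" "\<tau> \<le> 2 * s" using 3 4 s by linarith+
qed

text \<open>After Tonelli a point y carries the sum over k of \<open>b k\<close> times the measure
  of the boundary points whose k-th ball contains y. The weight s^(1-n) cancels the bound s^(n-1)
  for this measure, so every admissible scale contributes the same constant \<open>c3\<close>, and
  \<open>geometric_scales_count\<close> bounds their number.\<close>

lemma (in trace_kernel) patch_estimate:
  assumes op: "open \<Omega>" and \<nu>: "norm \<nu> = 1" and \<gamma>: "L-lipschitz_on {z. z \<bullet> \<nu> = 0} \<gamma>"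
    and \<theta>': "\<theta> \<le> 1/4" "L * \<theta> \<le> 1/8" and r: "r > 0"
    and graph: "\<Omega> \<inter> ball x0 r = {y \<in> ball x0 r. \<gamma> (hproj \<nu> y) < y \<bullet> \<nu>}"
  defines "\<Gamma> \<equiv> frontier \<Omega> \<inter> cball x0 (r / 2)"
  shows "\<exists>c>0. \<forall>u :: real^'n \<Rightarrow> real^'N. continuous_on (closure \<Omega>) u \<and> C1_on \<Omega> u \<longrightarrow>
    L1_norm (hausdorff_measure (CARD('n) - 1)) \<Gamma> u \<le> ennreal c * (L1_norm lborel \<Omega> u + L1_norm lborel \<Omega> (diff_op A u))"
proof -
  let ?H = "hausdorff_measure (CARD('n) - 1) :: (real^'n) measure"
  let ?d = "CARD('n) - 1"
  have dn: "CARD('n) = Suc ?d" by simp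
  have on_graph: "x \<bullet> \<nu> = \<gamma> (hproj \<nu> x)" if "x \<in> \<Gamma>" for x
  proof (rule frontier_on_graph[OF op \<nu> \<gamma> graph])
    show "x \<in> frontier \<Omega>" "x \<in> ball x0 r" using that r by (auto simp: \<Gamma>_def)
  qed
  obtain K where K: "K > 0" "\<And>\<Gamma>' z R. (\<forall>x\<in>\<Gamma>'. x \<bullet> \<nu> = \<gamma> (hproj \<nu> x)) \<Longrightarrow> R > 0 \<Longrightarrow> \<Gamma>' \<subseteq> cball z R \<Longrightarrow>
    emeasure ?H \<Gamma>' \<le> ennreal (K * R ^ ?d)"
    using hausdorff_graph[OF \<nu> \<gamma>] by blast
  obtain M where M: "M > 0" "\<And>y. \<bar>\<rho> y\<bar> \<le> M" "\<And>y j. norm (h j y) \<le> M"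
    using kernel_bounded by blast
  obtain J where J: "\<mu> ^ J > 4" using real_arch_pow[OF \<mu>] by blast
  \<comment> \<open>From a point within r/2 of x0 the kernel reaches at most s0 (1 + \<theta>) \<le>
    (5/4) (r/4) < r/2, hence stays in \<open>ball x0 r\<close>, where the graph describes
    \<Omega>.\<close>
  define s0 where "s0 = r / 4"
  have s0: "s0 > 0" using r by (simp add: s0_def)
  define S where "S k = s0 / \<mu> ^ k" for k :: nat
  have S: "S k > 0" for k using s0 \<mu> by (simp add: S_def)
  \<comment> \<open>Tonelli needs a \<sigma>-finite measure; the (n-1)-dimensional Hausdorff measure
    of the whole space is not, but its restriction to \<Gamma> is finite.\<close>
  define Hm where "Hm = density ?H (indicator \<Gamma>)"
  have clG: "closed \<Gamma>" by (auto simp: \<Gamma>_def)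
  then have G[measurable]: "\<Gamma> \<in> sets borel" by auto
  have setsHm[simp, measurable_cong]: "sets Hm = sets borel" by (simp add: Hm_def)
  have spHm [simp]: "space Hm = UNIV" by (simp add: Hm_def)
  have Hm: "emeasure Hm B = emeasure ?H (\<Gamma> \<inter> B)" if "B \<in> sets borel" for B
  proof -
    have "emeasure Hm B = (\<integral>\<^sup>+x. indicator \<Gamma> x * indicator B x \<partial>?H)"
      using that by (simp add: Hm_def emeasure_density)
    also have "\<dots> = (\<integral>\<^sup>+x. indicator (\<Gamma> \<inter> B) x \<partial>?H)"
      by (simp add: indicator_inter_arith)
    also have "\<dots> = emeasure ?H (\<Gamma> \<inter> B)" using that G by (intro nn_integral_indicator) auto
    finally show ?thesis .
  qed
  define h0 where "h0 = K * (r / 2) ^ ?d"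
  have HmU: "emeasure Hm UNIV \<le> ennreal h0"
    using K(2)[of \<Gamma> "r / 2" x0] on_graph r by (simp add: Hm h0_def) (simp add: \<Gamma>_def)
  interpret Hm: finite_measure Hm
    by (rule finite_measureI) (use HmU in \<open>auto simp: top_unique\<close>)
  interpret P: pair_sigma_finite Hm "lborel :: (real^'n) measure" ..
  define c1 where "c1 = real CARD('N) * M * (1 / s0 ^ CARD('n))"
  define c2 where "c2 = real CARD('N) * M * K * \<theta> ^ ?d * real (Suc J)"
  have c1: "c1 \<ge> 0" using M s0 by (simp add: c1_def)
  have h0: "h0 \<ge> 0" using K r by (simp add: h0_def)
  have c2: "c2 \<ge> 0" using M K \<theta> by (simp add: c2_def)
  have main: "L1_norm ?H \<Gamma> u \<le> ennreal (h0 * c1 + c2) * (L1_norm lborel \<Omega> u + L1_norm lborel \<Omega> (diff_op A u))"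
    if cu: "continuous_on (closure \<Omega>) u" and C1: "C1_on \<Omega> u" for u :: "real^'n \<Rightarrow> real^'N"
  proof -
    \<comment> \<open>Cut off outside \<Omega>, since measurability of \<open>diff_op A u\<close> is
      known only there; all balls \<open>Z k x\<close> lie inside.\<close>
    define g where "g y = ennreal (norm (indicator \<Omega> y *\<^sub>R diff_op A u y))" for y
    have "(\<lambda>y. indicator \<Omega> y *\<^sub>R diff_op A u y) \<in> borel_measurable borel"
      using diff_op_continuous[OF lin C1] op by (intro borel_measurable_continuous_on_indicator) auto
    then have g[measurable]: "g \<in> borel_measurable borel" unfolding g_def by measurable
    have gA: "(\<integral>\<^sup>+y. g y \<partial>lborel) = L1_norm lborel \<Omega> (diff_op A u)"
      unfolding L1_norm_def g_def by (intro nn_integral_cong) (auto simp: indicator_def)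
    define U where "U = L1_norm lborel \<Omega> u"
    define Z where "Z k x = cball (x + S (Suc k) *\<^sub>R \<nu>) (S (Suc k) * \<theta>)" for k and x :: "real^'n"
    define b where "b k = real CARD('N) * (S (Suc k) * M) * (1 / S (Suc k) ^ CARD('n))" for k
    have b: "b k \<ge> 0" for k using M S[of "Suc k"] by (simp add: b_def)
    have inside: "x + s *\<^sub>R w \<in> \<Omega>" if "x \<in> \<Gamma>" "0 < s" "s \<le> s0" "w \<in> cball \<nu> \<theta>" for x s w
    proof -
      have "s / 2 \<le> (x + s *\<^sub>R w) \<bullet> \<nu> - \<gamma> (hproj \<nu> (x + s *\<^sub>R w))"
        by (rule graph_height(1)[OF \<nu> \<gamma> \<theta> \<theta>' that(2,4) on_graph[OF that(1)]])
      moreover have "x + s *\<^sub>R w \<in> ball x0 r"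
      proof -
        have "norm w \<le> norm \<nu> + \<theta>"
          using that(4) norm_triangle_ineq[of \<nu> "w - \<nu>"] by (simp add: dist_norm norm_minus_commute)
        then have "norm w \<le> 5/4" using \<nu> \<theta>' by simp
        then have "s * norm w \<le> s0 * (5/4)" using that s0 by (intro mult_mono) auto
        then have "dist x (x + s *\<^sub>R w) \<le> s0 * (5/4)" using that by (simp add: dist_norm)
        moreover have "dist x0 x \<le> r / 2" using that by (simp add: \<Gamma>_def)
        ultimately have "dist x0 (x + s *\<^sub>R w) < r"
          using dist_triangle[of x0 "x + s *\<^sub>R w" x] r by (simp add: s0_def)
        then show ?thesis by simp
      qed
      ultimately show ?thesis using graph that(2) by force
    qed
    have insZ: "Z k x \<subseteq> \<Omega>" if "x \<in> \<Gamma>" for k x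
    proof
      fix y assume "y \<in> Z k x"
      then obtain w where "w \<in> cball \<nu> \<theta>" "y = x + S (Suc k) *\<^sub>R w"
        unfolding Z_def by (rule cball_rescaleD[OF S])
      moreover have "S (Suc k) \<le> s0"
      proof -
        have "\<mu> ^ Suc k \<ge> 1" using \<mu> by (intro one_le_power) simp
        then show ?thesis using s0 by (simp add: S_def divide_le_eq)
      qed
      ultimately show "y \<in> \<Omega>" using inside[OF that S] by blast
    qed
    have pw: "ennreal (norm (u x)) \<le> ennreal c1 * U + (\<Sum>k. ennreal (b k) * (\<integral>\<^sup>+y. g y * indicator (Z k x) y \<partial>lborel))" if x: "x \<in> \<Gamma>" for x
    proof -
      have "x \<in> closure \<Omega>" using x by (auto simp: \<Gamma>_def frontier_def)
      from pointwise_estimate[OF op C1 cu this s0 inside[OF x] M(2,3)]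
      have "ennreal (norm (u x)) \<le> ennreal c1 * U + (\<Sum>k. ennreal (b k) * (\<integral>\<^sup>+y. ennreal (norm (diff_op A u y)) * indicator (Z k x) y \<partial>lborel))"
        by (simp add: c1_def U_def L1_norm_def b_def Z_def S_def)
      also have "(\<lambda>k. \<integral>\<^sup>+y. ennreal (norm (diff_op A u y)) * indicator (Z k x) y \<partial>lborel) = (\<lambda>k. \<integral>\<^sup>+y. g y * indicator (Z k x) y \<partial>lborel)"
        using insZ[OF x] by (intro ext nn_integral_cong) (auto simp: g_def indicator_def)
      finally show ?thesis .
    qed
    have meas: "(\<lambda>(x, y). g y * indicator (Z k x) y) \<in> borel_measurable (Hm \<Otimes>\<^sub>M lborel)" for k
    proof -
      have "(\<lambda>(x, y). g y * indicator (Z k x) y) = (\<lambda>p. g (snd p) * indicator {p. dist (fst p + S (Suc k) *\<^sub>R \<nu>) (snd p) \<le> S (Suc k) * \<theta>} p)"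
        by (auto simp: fun_eq_iff Z_def indicator_def)
      moreover have "\<dots> \<in> borel_measurable (Hm \<Otimes>\<^sub>M lborel)" by measurable
      ultimately show ?thesis by simp
    qed
    have meas1: "(\<lambda>x. \<integral>\<^sup>+y. g y * indicator (Z k x) y \<partial>lborel) \<in> borel_measurable Hm" for k
      using lborel.borel_measurable_nn_integral_fst[OF meas[of k]] by simp
    have meas2: "(\<lambda>y. \<integral>\<^sup>+x. g y * indicator (Z k x) y \<partial>Hm) \<in> borel_measurable lborel" for k
      using Hm.borel_measurable_nn_integral_fst[of "\<lambda>(y, x). g y * indicator (Z k x) y" lborel]
        measurable_pair_swap_iff[of "\<lambda>(x, y). g y * indicator (Z k x) y" Hm lborel borel] meas[of k]
      by (simp add: split_beta)
    define \<tau> where "\<tau> y = y \<bullet> \<nu> - \<gamma> (hproj \<nu> y)" for y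
    define T where "T y = {k. \<tau> y / 2 \<le> S (Suc k) \<and> S (Suc k) \<le> 2 * \<tau> y}" for y
    define c3 where "c3 = real CARD('N) * M * K * \<theta> ^ ?d"
    have c3: "c3 \<ge> 0" using M K \<theta> by (simp add: c3_def)
    have sec: "ennreal (b k) * (\<integral>\<^sup>+x. g y * indicator (Z k x) y \<partial>Hm) \<le> ennreal c3 * (g y * indicator (T y) k)" for k y
    proof -
      let ?B = "{x. y \<in> Z k x}"
      have B: "?B = cball (y - S (Suc k) *\<^sub>R \<nu>) (S (Suc k) * \<theta>)"
        by (auto simp: Z_def dist_norm norm_minus_commute algebra_simps)
      have "(\<integral>\<^sup>+x. g y * indicator (Z k x) y \<partial>Hm) = (\<integral>\<^sup>+x. g y * indicator ?B x \<partial>Hm)"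
        by (intro nn_integral_cong) (auto simp: indicator_def)
      also have "\<dots> = g y * emeasure Hm ?B" by (rule nn_integral_cmult_indicator) (simp add: B)
      also have "emeasure Hm ?B = emeasure ?H (\<Gamma> \<inter> ?B)" by (rule Hm) (simp add: B)
      finally have eq: "(\<integral>\<^sup>+x. g y * indicator (Z k x) y \<partial>Hm) = g y * emeasure ?H (\<Gamma> \<inter> ?B)" .
      show ?thesis
      proof (cases "k \<in> T y")
        case True
        have "emeasure ?H (\<Gamma> \<inter> ?B) \<le> ennreal (K * (S (Suc k) * \<theta>) ^ ?d)"
          by (rule K(2)) (use on_graph S \<theta> B in auto)
        then have "ennreal (b k) * (g y * emeasure ?H (\<Gamma> \<inter> ?B)) \<le> ennreal (b k) * (g y * ennreal (K * (S (Suc k) * \<theta>) ^ ?d))"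
          by (intro mult_left_mono) auto
        also have "\<dots> = ennreal (b k * (K * (S (Suc k) * \<theta>) ^ ?d)) * g y"
          using b[of k] K S[of "Suc k"] \<theta> by (simp add: ennreal_mult mult_ac)
        also have "b k * (K * (S (Suc k) * \<theta>) ^ ?d) = c3"
        proof -
          have "S (Suc k) ^ CARD('n) = S (Suc k) * S (Suc k) ^ ?d" by (metis dn power_Suc)
          then show ?thesis using S[of "Suc k"] unfolding b_def c3_def by (simp add: power_mult_distrib)
        qed
        finally show ?thesis using True by (simp add: eq)
      next
        case False
        have "\<Gamma> \<inter> ?B = {}"
        proof (rule ccontr)
          assume "\<Gamma> \<inter> ?B \<noteq> {}"
          then obtain x where x: "x \<in> \<Gamma>" "y \<in> cball (x + S (Suc k) *\<^sub>R \<nu>) (S (Suc k) * \<theta>)" by (auto simp: Z_def)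
          obtain w where w: "w \<in> cball \<nu> \<theta>" "y = x + S (Suc k) *\<^sub>R w"
            by (rule cball_rescaleD[OF S x(2)])
          have "S (Suc k) / 2 \<le> \<tau> y \<and> \<tau> y \<le> 2 * S (Suc k)"
            unfolding w(2) \<tau>_def using graph_height[OF \<nu> \<gamma> \<theta> \<theta>' S w(1) on_graph[OF x(1)]] by blast
          then show False using False by (simp add: T_def)
        qed
        then show ?thesis by (simp add: eq)
      qed
    qed
    have "L1_norm ?H \<Gamma> u = (\<integral>\<^sup>+x. indicator \<Gamma> x * ennreal (norm (u x)) \<partial>?H)"
      unfolding L1_norm_def by (intro nn_integral_cong) (simp add: mult.commute)
    also have "\<dots> \<le> (\<integral>\<^sup>+x. indicator \<Gamma> x * (ennreal c1 * U + (\<Sum>k. ennreal (b k) * (\<integral>\<^sup>+y. g y * indicator (Z k x) y \<partial>lborel))) \<partial>?H)"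
      by (intro nn_integral_mono) (use pw in \<open>auto simp: indicator_def\<close>)
    also have "\<dots> = (\<integral>\<^sup>+x. (ennreal c1 * U + (\<Sum>k. ennreal (b k) * (\<integral>\<^sup>+y. g y * indicator (Z k x) y \<partial>lborel))) \<partial>Hm)"
      unfolding Hm_def by (rule nn_integral_density[symmetric])
         (use meas1 in \<open>auto simp: measurable_cong_sets[OF setsHm refl] intro!: borel_measurable_add borel_measurable_suminf_order borel_measurable_times_ennreal\<close>)
    also have "\<dots> = (\<integral>\<^sup>+x. ennreal c1 * U \<partial>Hm) + (\<integral>\<^sup>+x. (\<Sum>k. ennreal (b k) * (\<integral>\<^sup>+y. g y * indicator (Z k x) y \<partial>lborel)) \<partial>Hm)"
      using meas1 by (intro nn_integral_add borel_measurable_suminf_order borel_measurable_times_ennreal) auto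
    also have "(\<integral>\<^sup>+x. ennreal c1 * U \<partial>Hm) \<le> ennreal (h0 * c1) * U"
      using HmU c1 h0 by (simp add: ennreal_mult mult_ac) (simp add: mult_left_mono mult.assoc[symmetric])
    also have "(\<integral>\<^sup>+x. (\<Sum>k. ennreal (b k) * (\<integral>\<^sup>+y. g y * indicator (Z k x) y \<partial>lborel)) \<partial>Hm) =
       (\<Sum>k. ennreal (b k) * (\<integral>\<^sup>+x. (\<integral>\<^sup>+y. g y * indicator (Z k x) y \<partial>lborel) \<partial>Hm))"
      using meas1 by (subst nn_integral_suminf) (auto simp: nn_integral_cmult)
    also have "\<dots> = (\<Sum>k. ennreal (b k) * (\<integral>\<^sup>+y. (\<integral>\<^sup>+x. g y * indicator (Z k x) y \<partial>Hm) \<partial>lborel))"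
      using P.Fubini'[OF meas] by simp
    also have "\<dots> = (\<Sum>k. (\<integral>\<^sup>+y. ennreal (b k) * (\<integral>\<^sup>+x. g y * indicator (Z k x) y \<partial>Hm) \<partial>lborel))"
      using meas2 by (subst nn_integral_cmult) auto
    also have "\<dots> = (\<integral>\<^sup>+y. (\<Sum>k. ennreal (b k) * (\<integral>\<^sup>+x. g y * indicator (Z k x) y \<partial>Hm)) \<partial>lborel)"
    proof (rule nn_integral_suminf[symmetric])
      show "(\<lambda>y. ennreal (b k) * (\<integral>\<^sup>+x. g y * indicator (Z k x) y \<partial>Hm)) \<in> borel_measurable lborel" for k
        using meas2 by (intro borel_measurable_times_ennreal) auto
    qed
    also have "\<dots> \<le> (\<integral>\<^sup>+y. (\<Sum>k. ennreal c3 * (g y * indicator (T y) k)) \<partial>lborel)"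
      by (intro nn_integral_mono suminf_le sec) auto
    also have "\<dots> = (\<integral>\<^sup>+y. ennreal c3 * (g y * (\<Sum>k. indicator (T y) k)) \<partial>lborel)"
      by simp
    also have "\<dots> \<le> (\<integral>\<^sup>+y. ennreal c3 * (g y * of_nat (Suc J)) \<partial>lborel)"
      unfolding T_def S_def by (intro nn_integral_mono mult_left_mono geometric_scales_count[OF \<mu> s0 J]) auto
    also have "\<dots> = (\<integral>\<^sup>+y. ennreal c2 * g y \<partial>lborel)"
    proof -
      have "ennreal c2 = ennreal c3 * of_nat (Suc J)"
        using c3 unfolding c2_def c3_def ennreal_of_nat_eq_real_of_nat by (subst ennreal_mult[symmetric]) auto
      then show ?thesis by (simp only: mult_ac)
    qed
    also have "\<dots> = ennreal c2 * L1_norm lborel \<Omega> (diff_op A u)"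
      by (subst nn_integral_cmult) (auto simp: gA)
    finally have "L1_norm ?H \<Gamma> u \<le> ennreal (h0 * c1) * U + ennreal c2 * L1_norm lborel \<Omega> (diff_op A u)"
      by (simp add: add_right_mono add_left_mono)
    also have "\<dots> \<le> ennreal (h0 * c1 + c2) * U + ennreal (h0 * c1 + c2) * L1_norm lborel \<Omega> (diff_op A u)"
      using c1 c2 h0 by (intro add_mono mult_right_mono ennreal_leI) auto
    finally show ?thesis by (simp add: distrib_left U_def)
  qed
  show ?thesis
  \<comment> \<open>The summand 1 makes the constant strictly positive.\<close>
  proof (intro exI[of _ "h0 * c1 + c2 + 1"] conjI allI impI)
    show "0 < h0 * c1 + c2 + 1" using c1 c2 h0 by (simp add: add_nonneg_pos)
    fix u :: "real^'n \<Rightarrow> real^'N" assume "continuous_on (closure \<Omega>) u \<and> C1_on \<Omega> u"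
    then have "L1_norm ?H \<Gamma> u \<le> ennreal (h0 * c1 + c2) * (L1_norm lborel \<Omega> u + L1_norm lborel \<Omega> (diff_op A u))"
      using main by blast
    also have "\<dots> \<le> ennreal (h0 * c1 + c2 + 1) * (L1_norm lborel \<Omega> u + L1_norm lborel \<Omega> (diff_op A u))"
      by (intro mult_right_mono ennreal_leI) auto
    finally show "L1_norm ?H \<Gamma> u \<le> ennreal (h0 * c1 + c2 + 1) * (L1_norm lborel \<Omega> u + L1_norm lborel \<Omega> (diff_op A u))" .
  qed
qed

text \<open>Each boundary point has a patch with its own direction, kernel and constant. The
  boundary is compact, so finitely many patches cover it and their constants add up.\<close>

theorem C_elliptic_trace:
  fixes A :: "'n::finite \<Rightarrow> real^'N::finite \<Rightarrow> real^'K::finite" and \<Omega> :: "(real^'n) set"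
  assumes lin: "\<And>\<alpha>. linear (A \<alpha>)" and ell: "C_elliptic A" and op: "open \<Omega>" and bd: "bounded \<Omega>" and lip: "lipschitz_domain \<Omega>"
  shows "\<exists>c::real. c > 0 \<and> (\<forall>u :: real^'n \<Rightarrow> real^'N. continuous_on (closure \<Omega>) u \<and> C1_on \<Omega> u \<longrightarrow>
    L1_norm (hausdorff_measure (CARD('n) - 1)) (frontier \<Omega>) u \<le> ennreal c * (L1_norm lborel \<Omega> u + L1_norm lborel \<Omega> (diff_op A u)))"
proof -
  let ?H = "hausdorff_measure (CARD('n) - 1) :: (real^'n) measure"
  define good where "good x0 r c \<longleftrightarrow> (\<forall>u :: real^'n \<Rightarrow> real^'N. continuous_on (closure \<Omega>) u \<and> C1_on \<Omega> u \<longrightarrow>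
    L1_norm ?H (frontier \<Omega> \<inter> cball x0 (r / 2)) u \<le> ennreal c * (L1_norm lborel \<Omega> u + L1_norm lborel \<Omega> (diff_op A u)))"
    for x0 r c
  have "\<exists>r c. r > 0 \<and> c > 0 \<and> good x0 r c" if x0: "x0 \<in> frontier \<Omega>" for x0
  proof -
    obtain r \<nu> \<gamma> L where r: "r > 0" and \<nu>: "norm \<nu> = 1" and \<gamma>: "L-lipschitz_on {z. z \<bullet> \<nu> = 0} \<gamma>"
      and graph: "\<Omega> \<inter> ball x0 r = {y \<in> ball x0 r. \<gamma> (y - (y \<bullet> \<nu>) *\<^sub>R \<nu>) < y \<bullet> \<nu>}"
      using lip x0 unfolding lipschitz_domain_def by blast
    have L: "L \<ge> 0" using \<gamma> by (simp add: lipschitz_on_def)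
    \<comment> \<open>Gives \<theta> \<le> 1/8 and L \<theta> \<le> 1/8, within the bounds that
      \<open>graph_height\<close> demands.\<close>
    define \<theta> where "\<theta> = 1 / (8 * (L + 1))"
    have th: "\<theta> > 0" "\<theta> \<le> 1/4" "L * \<theta> \<le> 1/8" using L by (auto simp: \<theta>_def field_simps)
    obtain \<mu> \<rho> h h' where k: "\<mu> > 1"
      "continuous_on UNIV \<rho>" "\<And>j. continuous_on UNIV (h j)" "\<And>j l. continuous_on UNIV (h' j l)"
      "\<And>y. y \<notin> cball \<nu> \<theta> \<Longrightarrow> \<rho> y = 0" "\<And>y. y \<notin> cball \<nu> \<theta> \<Longrightarrow> \<rho> ((1/\<mu>) *\<^sub>R y) = 0"
      "\<And>y j. y \<notin> cball \<nu> \<theta> \<Longrightarrow> h j y = 0" "\<And>y j l. y \<notin> cball \<nu> \<theta> \<Longrightarrow> h' j l y = 0"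
      "(LINT y|lborel. \<rho> y) = 1"
      "\<And>j l y. ((\<lambda>t. h j (y + t *\<^sub>R axis l 1)) has_vector_derivative h' j l y) (at 0)"
      "\<And>j v y. (\<Sum>l\<in>UNIV. A l v \<bullet> h' j l y) = v $ j * (\<rho> y - \<rho> ((1/\<mu>) *\<^sub>R y) / \<mu> ^ CARD('n))"
      using elliptic_kernel[OF lin ell \<nu> th(1)] by blast
    interpret trace_kernel A \<nu> \<theta> \<mu> \<rho> h h'
      by (rule trace_kernel.intro[OF lin th(1) k])
    show ?thesis
      using patch_estimate[OF op \<nu> \<gamma> th(2,3) r graph[folded hproj_def]] r unfolding good_def by blast
  qed
  then obtain r c where rc: "\<And>x0. x0 \<in> frontier \<Omega> \<Longrightarrow> r x0 > 0 \<and> c x0 > 0 \<and> good x0 (r x0) (c x0)" by metis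
  have "compact (frontier \<Omega>)" using bd by (rule compact_frontier_bounded)
  moreover have "frontier \<Omega> \<subseteq> (\<Union>x0\<in>frontier \<Omega>. ball x0 (r x0 / 2))"
  proof
    fix x assume x: "x \<in> frontier \<Omega>"
    then show "x \<in> (\<Union>x0\<in>frontier \<Omega>. ball x0 (r x0 / 2))" using rc[OF x] by (intro UN_I[of x]) auto
  qed
  ultimately obtain F where F: "F \<subseteq> frontier \<Omega>" "finite F" "frontier \<Omega> \<subseteq> (\<Union>x0\<in>F. ball x0 (r x0 / 2))"
    using compactE_image[of "frontier \<Omega>" "frontier \<Omega>" "\<lambda>x0. ball x0 (r x0 / 2)"] by (metis open_ball)
  have "L1_norm ?H (frontier \<Omega>) u \<le> ennreal ((\<Sum>x0\<in>F. c x0) + 1) * (L1_norm lborel \<Omega> u + L1_norm lborel \<Omega> (diff_op A u))"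
    if cu: "continuous_on (closure \<Omega>) u" and C1: "C1_on \<Omega> u" for u :: "real^'n \<Rightarrow> real^'N"
  proof -
    let ?R = "L1_norm lborel \<Omega> u + L1_norm lborel \<Omega> (diff_op A u)"
    have "continuous_on (frontier \<Omega>) u" by (rule continuous_on_subset[OF cu]) (auto simp: frontier_def)
    then have "(\<lambda>x. indicator (frontier \<Omega>) x *\<^sub>R u x) \<in> borel_measurable borel"
      by (intro borel_measurable_continuous_on_indicator) auto
    then have m: "(\<lambda>x. ennreal (norm (indicator (frontier \<Omega>) x *\<^sub>R u x))) \<in> borel_measurable borel" by measurable
    have "L1_norm ?H (frontier \<Omega>) u \<le> (\<integral>\<^sup>+x. (\<Sum>x0\<in>F. ennreal (norm (indicator (frontier \<Omega>) x *\<^sub>R u x)) * indicator (cball x0 (r x0 / 2)) x) \<partial>?H)"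
      unfolding L1_norm_def
    proof (intro nn_integral_mono)
      fix x
      show "ennreal (norm (u x)) * indicator (frontier \<Omega>) x \<le> (\<Sum>x0\<in>F. ennreal (norm (indicator (frontier \<Omega>) x *\<^sub>R u x)) * indicator (cball x0 (r x0 / 2)) x)"
      proof (cases "x \<in> frontier \<Omega>")
        case True
        then obtain x0 where x0: "x0 \<in> F" "x \<in> ball x0 (r x0 / 2)" using F by blast
        then have "ennreal (norm (u x)) = ennreal (norm (indicator (frontier \<Omega>) x *\<^sub>R u x)) * indicator (cball x0 (r x0 / 2)) x"
          using True by (auto simp: indicator_def)
        also have "\<dots> \<le> (\<Sum>x0\<in>F. ennreal (norm (indicator (frontier \<Omega>) x *\<^sub>R u x)) * indicator (cball x0 (r x0 / 2)) x)"
          using F x0 by (intro member_le_sum) auto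
        finally show ?thesis using True by simp
      qed simp
    qed
    also have "\<dots> = (\<Sum>x0\<in>F. \<integral>\<^sup>+x. ennreal (norm (indicator (frontier \<Omega>) x *\<^sub>R u x)) * indicator (cball x0 (r x0 / 2)) x \<partial>?H)"
      using m by (intro nn_integral_sum borel_measurable_times_ennreal borel_measurable_indicator) (auto simp: measurable_cong_sets[OF sets_hausdorff_measure refl])
    also have "\<dots> = (\<Sum>x0\<in>F. L1_norm ?H (frontier \<Omega> \<inter> cball x0 (r x0 / 2)) u)"
      unfolding L1_norm_def by (intro sum.cong nn_integral_cong refl) (auto simp: indicator_def)
    also have "\<dots> \<le> (\<Sum>x0\<in>F. ennreal (c x0) * ?R)"
      using rc F(1) cu C1 unfolding good_def by (intro sum_mono) blast
    also have "\<dots> = ennreal (\<Sum>x0\<in>F. c x0) * ?R"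
    proof -
      have "c x0 \<ge> 0" if "x0 \<in> F" for x0 using rc F(1) that by (auto simp: less_imp_le)
      then have "(\<Sum>x0\<in>F. ennreal (c x0)) = ennreal (\<Sum>x0\<in>F. c x0)" by (rule sum_ennreal)
      then show ?thesis by (simp add: sum_distrib_right[symmetric])
    qed
    also have "\<dots> \<le> ennreal ((\<Sum>x0\<in>F. c x0) + 1) * ?R" by (intro mult_right_mono ennreal_leI) auto
    finally show ?thesis .
  qed
  moreover have "(\<Sum>x0\<in>F. c x0) + 1 > 0" using rc F(1) by (intro add_nonneg_pos sum_nonneg) (auto simp: less_imp_le)
  ultimately show ?thesis by blast
qed


section \<open>Hausdorff measure on Borel sets\<close>

text \<open>The contribution of one covering set. The value 0 for the empty set allows sets to be
  dropped from a cover by replacing them with \<open>{}\<close>.\<close>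

definition hcost :: "nat \<Rightarrow> 'a::metric_space set \<Rightarrow> ennreal" where
  "hcost s X = (if X = {} then 0 else ennreal (unit_ball_vol (real s) * (diameter X / 2) ^ s))"

lemma hausdorff_premeasure_eq:
  "hausdorff_premeasure s \<delta> E =
     (INF C \<in> {C :: nat \<Rightarrow> 'a::metric_space set. E \<subseteq> (\<Union>i. C i) \<and> (\<forall>i. bounded (C i) \<and> diameter (C i) \<le> \<delta>)}. \<Sum>i. hcost s (C i))"
  by (simp add: hausdorff_premeasure_def hcost_def)

lemma hausdorff_premeasure_le:
  assumes "E \<subseteq> (\<Union>i. C i)" "\<And>i. bounded (C i)" "\<And>i. diameter (C i) \<le> \<delta>"
  shows "hausdorff_premeasure s \<delta> E \<le> (\<Sum>i. hcost s (C i))"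
  unfolding hausdorff_premeasure_eq by (rule INF_lower) (use assms in auto)

lemma hausdorff_premeasure_mono: "E \<subseteq> E' \<Longrightarrow> hausdorff_premeasure s \<delta> E \<le> hausdorff_premeasure s \<delta> E'"
  unfolding hausdorff_premeasure_eq by (rule INF_superset_mono) auto

lemma hausdorff_premeasure_antimono: "\<delta> \<le> \<delta>' \<Longrightarrow> hausdorff_premeasure s \<delta>' E \<le> hausdorff_premeasure s \<delta> E"
  unfolding hausdorff_premeasure_eq by (rule INF_superset_mono) (auto intro: order_trans)

lemma hausdorff_premeasure_le_outer: "\<delta> > 0 \<Longrightarrow> hausdorff_premeasure s \<delta> E \<le> hausdorff_outer s E"
  unfolding hausdorff_outer_def by (rule SUP_upper) auto

lemma hausdorff_outer_mono: "E \<subseteq> E' \<Longrightarrow> hausdorff_outer s E \<le> hausdorff_outer s E'"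
  unfolding hausdorff_outer_def by (rule SUP_mono) (auto intro: hausdorff_premeasure_mono)

lemma hausdorff_outer_empty [simp]: "hausdorff_outer s {} = 0"
proof -
  have "hausdorff_premeasure s \<delta> ({} :: 'a set) = 0" if "\<delta> > 0" for \<delta>
    using hausdorff_premeasure_le[of "{} :: 'a set" "\<lambda>_. {}" \<delta> s] that by (simp add: hcost_def)
  then show ?thesis unfolding hausdorff_outer_def by (intro antisym SUP_least) auto
qed

lemma hausdorff_premeasure_approx:
  assumes "hausdorff_premeasure s \<delta> E < \<infinity>" "e > 0"
  shows "\<exists>C. E \<subseteq> (\<Union>i. C i) \<and> (\<forall>i. bounded (C i) \<and> diameter (C i) \<le> \<delta>) \<and>
    (\<Sum>i. hcost s (C i)) \<le> hausdorff_premeasure s \<delta> E + ennreal e"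
proof -
  have "hausdorff_premeasure s \<delta> E < hausdorff_premeasure s \<delta> E + ennreal e"
    using assms ennreal_add_left_cancel_less[of "hausdorff_premeasure s \<delta> E" 0 "ennreal e"] by (simp add: ennreal_less_zero_iff less_top)
  then obtain C where "C \<in> {C. E \<subseteq> (\<Union>i. C i) \<and> (\<forall>i. bounded (C i) \<and> diameter (C i) \<le> \<delta>)}"
    "(\<Sum>i. hcost s (C i)) < hausdorff_premeasure s \<delta> E + ennreal e"
    unfolding hausdorff_premeasure_eq[of s \<delta> E] INF_less_iff by blast
  then show ?thesis by (intro exI[of _ C]) auto
qed

lemma hausdorff_outer_subadditive:
  "hausdorff_outer s (\<Union>n. E n) \<le> (\<Sum>n. hausdorff_outer s (E n))"
  unfolding hausdorff_outer_def[of s "\<Union>n. E n"]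
proof (rule SUP_least)
  fix \<delta> :: real assume "\<delta> \<in> {0<..}"
  then have \<delta>: "\<delta> > 0" by simp
  have "hausdorff_premeasure s \<delta> (\<Union>n. E n) \<le> (\<Sum>n. hausdorff_premeasure s \<delta> (E n))"
  proof (cases "\<forall>n. hausdorff_premeasure s \<delta> (E n) < \<infinity>")
    case True
    show ?thesis
    proof (rule ennreal_le_epsilon)
      fix e :: real assume e: "e > 0"
      have "\<exists>C. E n \<subseteq> (\<Union>i. C i) \<and> (\<forall>i. bounded (C i) \<and> diameter (C i) \<le> \<delta>) \<and>
        (\<Sum>i. hcost s (C i)) \<le> hausdorff_premeasure s \<delta> (E n) + ennreal (e * (1/2) ^ Suc n)" for n
        by (rule hausdorff_premeasure_approx) (use True e in auto)
      then obtain C where C: "\<And>n. E n \<subseteq> (\<Union>i. C n i)" "\<And>n i. bounded (C n i)" "\<And>n i. diameter (C n i) \<le> \<delta>"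
        "\<And>n. (\<Sum>i. hcost s (C n i)) \<le> hausdorff_premeasure s \<delta> (E n) + ennreal (e * (1/2) ^ Suc n)" by metis
      \<comment> \<open>The pairing bijection merges the countably many covers into one sequence;
        their errors e / 2^(n+1) add up to e.\<close>
      define D where "D k = C (fst (prod_decode k)) (snd (prod_decode k))" for k
      have "(\<Union>n. E n) \<subseteq> (\<Union>k. D k)"
      proof
        fix x assume "x \<in> (\<Union>n. E n)"
        then obtain n i where "x \<in> C n i" using C(1) by blast
        then show "x \<in> (\<Union>k. D k)" by (intro UN_I[of "prod_encode (n, i)"]) (auto simp: D_def)
      qed
      then have "hausdorff_premeasure s \<delta> (\<Union>n. E n) \<le> (\<Sum>k. hcost s (D k))"
        by (rule hausdorff_premeasure_le) (auto simp: D_def C)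
      also have "\<dots> = (\<Sum>n. \<Sum>i. hcost s (C n i))"
        using suminf_ennreal_2dimen[of "\<lambda>n. \<Sum>i. hcost s (C n i)" "\<lambda>p. hcost s (C (fst p) (snd p))"]
        by (simp add: D_def)
      also have "\<dots> \<le> (\<Sum>n. hausdorff_premeasure s \<delta> (E n) + ennreal (e * (1/2) ^ Suc n))"
        by (intro suminf_le C) auto
      also have "\<dots> = (\<Sum>n. hausdorff_premeasure s \<delta> (E n)) + (\<Sum>n. ennreal (e * (1/2) ^ Suc n))"
        by (rule suminf_add[symmetric]) auto
      also have "(\<Sum>n. ennreal (e * (1/2) ^ Suc n)) = ennreal e"
      proof (rule suminf_ennreal_eq)
        show "0 \<le> e * (1/2) ^ Suc n" for n using e by (intro mult_nonneg_nonneg zero_le_power) auto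
        show "(\<lambda>n. e * (1/2) ^ Suc n) sums e" using sums_mult[OF power_half_series, of e] by (simp only: mult_1_right)
      qed
      finally show "hausdorff_premeasure s \<delta> (\<Union>n. E n) \<le> (\<Sum>n. hausdorff_premeasure s \<delta> (E n)) + ennreal e" .
    qed
  next
    case False
    then obtain n where "hausdorff_premeasure s \<delta> (E n) = \<infinity>" by (metis infinity_ennreal_def less_top)
    moreover have "hausdorff_premeasure s \<delta> (E n) \<le> (\<Sum>n. hausdorff_premeasure s \<delta> (E n))"
      using sum_le_suminf[of "\<lambda>n. hausdorff_premeasure s \<delta> (E n)" "{n}"] by auto
    ultimately show ?thesis by (simp add: top_unique)
  qed
  also have "\<dots> \<le> (\<Sum>n. hausdorff_outer s (E n))"
    by (intro suminf_le hausdorff_premeasure_le_outer \<delta>) auto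
  finally show "hausdorff_premeasure s \<delta> (\<Union>n. E n) \<le> (\<Sum>n. hausdorff_outer s (E n))" .
qed

lemma hausdorff_outer_subadditive2: "hausdorff_outer s (A \<union> B) \<le> hausdorff_outer s A + hausdorff_outer s B"
proof -
  have "hausdorff_outer s (A \<union> B) = hausdorff_outer s (\<Union>n. binaryset A B n)" by (simp add: UN_binaryset_eq)
  also have "\<dots> \<le> (\<Sum>n. hausdorff_outer s (binaryset A B n))" by (rule hausdorff_outer_subadditive)
  also have "\<dots> = hausdorff_outer s A + hausdorff_outer s B" by (rule suminf_binaryset_eq) simp
  finally show ?thesis .
qed

text \<open>Once \<delta> < d no covering set meets both A and B, so a cover of the union splits.
  The two suprema are taken one after the other, hence the independent \<delta>1 and \<delta>2,
  which are refined to a common scale.\<close>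

lemma hausdorff_outer_metric:
  assumes d: "d > 0" "\<And>x y. x \<in> A \<Longrightarrow> y \<in> B \<Longrightarrow> dist x y \<ge> d"
  shows "hausdorff_outer s A + hausdorff_outer s B \<le> hausdorff_outer s (A \<union> B)"
proof -
  have pre: "hausdorff_premeasure s \<delta> A + hausdorff_premeasure s \<delta> B \<le> hausdorff_premeasure s \<delta> (A \<union> B)" if "\<delta> < d" for \<delta>
    unfolding hausdorff_premeasure_eq[of s \<delta> "A \<union> B"]
  proof (rule INF_greatest)
    fix C :: "nat \<Rightarrow> 'a set" assume "C \<in> {C. A \<union> B \<subseteq> (\<Union>i. C i) \<and> (\<forall>i. bounded (C i) \<and> diameter (C i) \<le> \<delta>)}"
    then have C: "A \<union> B \<subseteq> (\<Union>i. C i)" "\<And>i. bounded (C i)" "\<And>i. diameter (C i) \<le> \<delta>" by auto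
    have \<delta>0: "\<delta> \<ge> 0" using C(2,3) diameter_ge_0 order_trans by blast
    define CA where "CA i = (if C i \<inter> A = {} then {} else C i)" for i
    define CB where "CB i = (if C i \<inter> B = {} then {} else C i)" for i
    have "hausdorff_premeasure s \<delta> A \<le> (\<Sum>i. hcost s (CA i))"
    proof (rule hausdorff_premeasure_le)
      show "A \<subseteq> (\<Union>i. CA i)" using C(1) by (fastforce simp: CA_def)
    qed (use C \<delta>0 in \<open>auto simp: CA_def\<close>)
    moreover have "hausdorff_premeasure s \<delta> B \<le> (\<Sum>i. hcost s (CB i))"
    proof (rule hausdorff_premeasure_le)
      show "B \<subseteq> (\<Union>i. CB i)" using C(1) by (fastforce simp: CB_def)
    qed (use C \<delta>0 in \<open>auto simp: CB_def\<close>)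
    ultimately have "hausdorff_premeasure s \<delta> A + hausdorff_premeasure s \<delta> B \<le> (\<Sum>i. hcost s (CA i)) + (\<Sum>i. hcost s (CB i))"
      by (rule add_mono)
    also have "\<dots> = (\<Sum>i. hcost s (CA i) + hcost s (CB i))" by (rule suminf_add) auto
    also have "\<dots> \<le> (\<Sum>i. hcost s (C i))"
    proof (rule suminf_le)
      fix i
      have "C i \<inter> A = {} \<or> C i \<inter> B = {}"
      proof (rule ccontr)
        assume "\<not> ?thesis"
        then obtain x y where "x \<in> C i" "x \<in> A" "y \<in> C i" "y \<in> B" by blast
        then show False using d(2)[of x y] diameter_bounded_bound[OF C(2)[of i], of x y] C(3)[of i] that by linarith
      qed
      then show "hcost s (CA i) + hcost s (CB i) \<le> hcost s (C i)" by (auto simp: CA_def CB_def hcost_def)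
    qed auto
    finally show "hausdorff_premeasure s \<delta> A + hausdorff_premeasure s \<delta> B \<le> (\<Sum>i. hcost s (C i))" .
  qed
  have "hausdorff_premeasure s \<delta>1 A + hausdorff_premeasure s \<delta>2 B \<le> hausdorff_outer s (A \<union> B)" if "\<delta>1 > 0" "\<delta>2 > 0" for \<delta>1 \<delta>2
  proof -
    define \<delta> where "\<delta> = min (min \<delta>1 \<delta>2) (d / 2)"
    have \<delta>: "\<delta> > 0" "\<delta> \<le> \<delta>1" "\<delta> \<le> \<delta>2" "\<delta> < d" using that d(1) by (auto simp: \<delta>_def)
    have "hausdorff_premeasure s \<delta>1 A + hausdorff_premeasure s \<delta>2 B \<le> hausdorff_premeasure s \<delta> A + hausdorff_premeasure s \<delta> B"
      by (intro add_mono hausdorff_premeasure_antimono \<delta>)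
    also have "\<dots> \<le> hausdorff_premeasure s \<delta> (A \<union> B)" by (rule pre[OF \<delta>(4)])
    also have "\<dots> \<le> hausdorff_outer s (A \<union> B)" by (rule hausdorff_premeasure_le_outer[OF \<delta>(1)])
    finally show ?thesis .
  qed
  then have "hausdorff_outer s A + hausdorff_premeasure s \<delta>2 B \<le> hausdorff_outer s (A \<union> B)" if "\<delta>2 > 0" for \<delta>2
    unfolding hausdorff_outer_def[of s A] using that
    by (subst ennreal_SUP_add_left[symmetric]) (auto intro!: SUP_least)
  then show ?thesis
    unfolding hausdorff_outer_def[of s B]
    by (subst ennreal_SUP_add_right) (auto intro!: SUP_least)
qed

text \<open>The shells R k around F of equal parity have positive distance from each other, so their
  measures are summable.\<close>

lemma hausdorff_outer_closed:
  fixes F T :: "'a::metric_space set"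
  assumes F: "closed F"
  shows "hausdorff_outer s (T \<inter> F) + hausdorff_outer s (T - F) \<le> hausdorff_outer s T"
proof (cases "F = {} \<or> hausdorff_outer s T = \<infinity>")
  case True
  then show ?thesis by auto
next
  case False
  then have ne: "F \<noteq> {}" and fin: "hausdorff_outer s T < \<infinity>" by (auto simp: less_top)
  let ?H = "hausdorff_outer s"
  define U where "U k = {x \<in> T - F. 1 / real (Suc k) \<le> infdist x F}" for k
  define R where "R k = {x \<in> T - F. 1 / real (Suc (Suc k)) \<le> infdist x F \<and> infdist x F < 1 / real (Suc k)}" for k
  have lip: "infdist x F \<le> infdist y F + dist x y" for x y by (rule infdist_triangle)
  \<comment> \<open>\<open>infdist\<close> is 1-Lipschitz in the point, so skipping one shell leaves
    a positive gap between consecutive reciprocals.\<close>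
  have sep: "?H (R i) + ?H Y \<le> ?H (R i \<union> Y)" if "\<And>y. y \<in> Y \<Longrightarrow> infdist y F < 1 / real (Suc (Suc (Suc i)))" for i Y
  proof (rule hausdorff_outer_metric)
    show "1 / real (Suc (Suc i)) - 1 / real (Suc (Suc (Suc i))) > 0"
      using frac_less2[of 1 1 "real (Suc (Suc i))" "real (Suc (Suc (Suc i)))"] by simp
    fix x y assume "x \<in> R i" "y \<in> Y"
    then show "1 / real (Suc (Suc i)) - 1 / real (Suc (Suc (Suc i))) \<le> dist x y"
      using lip[of x y] that[of y] by (auto simp: R_def)
  qed
  have step: "(\<Sum>j<m. ?H (R (i + 2 * j))) \<le> ?H (\<Union>j<m. R (i + 2 * j))" for m i
  proof (induction m arbitrary: i)
    case (Suc m)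
    let ?Y = "\<Union>j<m. R (i + 2 + 2 * j)"
    have "(\<Sum>j<Suc m. ?H (R (i + 2 * j))) = ?H (R i) + (\<Sum>j<m. ?H (R (i + 2 + 2 * j)))"
      by (subst sum.lessThan_Suc_shift) (simp add: algebra_simps)
    also have "\<dots> \<le> ?H (R i) + ?H ?Y" by (rule add_left_mono[OF Suc])
    also have "\<dots> \<le> ?H (R i \<union> ?Y)"
    proof (rule sep)
      fix y assume "y \<in> ?Y"
      then obtain j where "infdist y F < 1 / real (Suc (i + 2 + 2 * j))" by (auto simp: R_def)
      also have "\<dots> \<le> 1 / real (Suc (Suc (Suc i)))" by (intro divide_left_mono) auto
      finally show "infdist y F < 1 / real (Suc (Suc (Suc i)))" .
    qed
    also have "R i \<union> ?Y = (\<Union>j<Suc m. R (i + 2 * j))"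
      by (subst lessThan_Suc_eq_insert_0) (simp add: algebra_simps)
    finally show ?case .
  qed simp
  have part: "(\<Sum>j. ?H (R (i + 2 * j))) \<le> ?H T" for i
  proof (rule suminf_le_const)
    fix m
    have "(\<Sum>j<m. ?H (R (i + 2 * j))) \<le> ?H (\<Union>j<m. R (i + 2 * j))" by (rule step)
    also have "\<dots> \<le> ?H T" by (rule hausdorff_outer_mono) (auto simp: R_def)
    finally show "(\<Sum>j<m. ?H (R (i + 2 * j))) \<le> ?H T" .
  qed simp
  define S where "S = (\<Sum>j. ?H (R j))"
  \<comment> \<open>Even and odd shells are summed separately, each family by \<open>part\<close> to
    at most the measure of T.\<close>
  have Sfin: "S < \<infinity>"
  proof -
    have "(\<Sum>j<k. ?H (R j)) \<le> ?H T + ?H T" for k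
    proof -
      have "(\<Sum>j<k. ?H (R j)) \<le> (\<Sum>j<2 * k. ?H (R j))" by (intro sum_mono2) auto
      also have "\<dots> = (\<Sum>j<k. ?H (R (0 + 2 * j))) + (\<Sum>j<k. ?H (R (1 + 2 * j)))"
        by (induction k) (auto simp: algebra_simps)
      also have "\<dots> \<le> (\<Sum>j. ?H (R (0 + 2 * j))) + (\<Sum>j. ?H (R (1 + 2 * j)))"
        by (intro add_mono sum_le_suminf) auto
      also have "\<dots> \<le> ?H T + ?H T" by (intro add_mono part)
      finally show ?thesis .
    qed
    then have "S \<le> ?H T + ?H T" unfolding S_def by (intro suminf_le_const) auto
    also have "\<dots> < \<infinity>" using fin by simp
    finally show ?thesis .
  qed
  \<comment> \<open>The tail of the series is expressed by adding the partial sum on the left, which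
    avoids subtraction in \<open>ennreal\<close>.\<close>
  have tail: "?H (T - F) + (\<Sum>j<k. ?H (R j)) \<le> ?H (U k) + S" for k
  proof -
    have "T - F \<subseteq> U k \<union> (\<Union>j. R (k + j))"
    proof
      fix x assume x: "x \<in> T - F"
      then have pos: "infdist x F > 0"
        using F ne infdist_pos_not_in_closed[of F x] by auto
      show "x \<in> U k \<union> (\<Union>j. R (k + j))"
      proof (cases "1 / real (Suc k) \<le> infdist x F")
        case False
        obtain N where "1 / real (Suc N) < infdist x F" using pos by (metis nat_approx_posE)
        then have ex: "\<exists>n. 1 / real (Suc n) \<le> infdist x F" by (auto intro: less_imp_le)
        define n where "n = (LEAST n. 1 / real (Suc n) \<le> infdist x F)"
        have n: "1 / real (Suc n) \<le> infdist x F" unfolding n_def by (rule LeastI_ex[OF ex])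
        have "n > k"
        proof (rule ccontr)
          assume "\<not> n > k"
          then have "1 / real (Suc k) \<le> 1 / real (Suc n)" by (intro divide_left_mono) auto
          then show False using n False by linarith
        qed
        then obtain j where j: "n = Suc (k + j)" using less_iff_Suc_add by blast
        have "\<not> 1 / real (Suc (k + j)) \<le> infdist x F"
          using not_less_Least[of "k + j" "\<lambda>n. 1 / real (Suc n) \<le> infdist x F"] j n_def by auto
        then have "x \<in> R (k + j)" using n x by (simp add: R_def j)
        then show ?thesis by blast
      qed (use x in \<open>auto simp: U_def\<close>)
    qed
    then have "?H (T - F) \<le> ?H (U k \<union> (\<Union>j. R (k + j)))" by (rule hausdorff_outer_mono)
    also have "\<dots> \<le> ?H (U k) + ?H (\<Union>j. R (k + j))" by (rule hausdorff_outer_subadditive2)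
    also have "\<dots> \<le> ?H (U k) + (\<Sum>j. ?H (R (k + j)))" by (intro add_left_mono hausdorff_outer_subadditive)
    finally have "?H (T - F) + (\<Sum>j<k. ?H (R j)) \<le> ?H (U k) + ((\<Sum>j. ?H (R (j + k))) + (\<Sum>j<k. ?H (R j)))"
      by (simp add: add.assoc[symmetric] add.commute[of k] add_right_mono)
    also have "(\<Sum>j. ?H (R (j + k))) + (\<Sum>j<k. ?H (R j)) = S"
      unfolding S_def by (rule suminf_offset[symmetric]) simp
    finally show ?thesis .
  qed
  have all: "?H (T \<inter> F) + ?H (T - F) + (\<Sum>j<k. ?H (R j)) \<le> ?H T + S" for k
  proof -
    have "?H (T \<inter> F) + ?H (T - F) + (\<Sum>j<k. ?H (R j)) \<le> ?H (T \<inter> F) + (?H (U k) + S)"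
      using add_left_mono[OF tail[of k]] by (simp add: add.assoc)
    also have "\<dots> = (?H (T \<inter> F) + ?H (U k)) + S" by (simp add: add.assoc)
    also have "?H (T \<inter> F) + ?H (U k) \<le> ?H ((T \<inter> F) \<union> U k)"
    proof (rule hausdorff_outer_metric)
      show "1 / real (Suc k) > 0" by simp
      fix x y assume "x \<in> T \<inter> F" "y \<in> U k"
      then show "1 / real (Suc k) \<le> dist x y"
        using infdist_le[of x F y] by (auto simp: U_def dist_commute)
    qed
    also have "?H ((T \<inter> F) \<union> U k) \<le> ?H T" by (rule hausdorff_outer_mono) (auto simp: U_def)
    finally show ?thesis by (simp add: add_right_mono)
  qed
  \<comment> \<open>In the limit the partial sums become S, which is finite and cancels.\<close>
  have "(\<lambda>k. ?H (T \<inter> F) + ?H (T - F) + (\<Sum>j<k. ?H (R j))) \<longlonglongrightarrow> ?H (T \<inter> F) + ?H (T - F) + S"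
    unfolding S_def by (intro tendsto_add tendsto_const summable_LIMSEQ) simp
  then have "?H (T \<inter> F) + ?H (T - F) + S \<le> ?H T + S"
    by (rule LIMSEQ_le_const2) (use all in blast)
  then have "S + (?H (T \<inter> F) + ?H (T - F)) \<le> S + ?H T" by (simp only: add.commute)
  then show ?thesis using Sfin by (auto simp: ennreal_add_left_cancel_le)
qed

text \<open>Closed sets satisfy Caratheodory's criterion by \<open>hausdorff_outer_closed\<close>,
  and they generate the Borel sets.\<close>

lemma measure_space_hausdorff_outer: "measure_space UNIV (sets (borel :: 'a::metric_space measure)) (hausdorff_outer s)"
proof -
  let ?H = "hausdorff_outer s :: 'a set \<Rightarrow> ennreal"
  interpret sigma_algebra "UNIV :: 'a set" "Pow UNIV" by (rule sigma_algebra_Pow)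
  have "outer_measure_space (Pow UNIV) ?H"
    unfolding outer_measure_space_def positive_def increasing_def countably_subadditive_def
    by (auto intro: hausdorff_outer_mono hausdorff_outer_subadditive)
  from caratheodory_lemma[OF this]
  have L: "measure_space UNIV (lambda_system UNIV (Pow UNIV) ?H) ?H" by simp
  then interpret L: sigma_algebra UNIV "lambda_system UNIV (Pow UNIV) ?H" by (simp add: measure_space_def)
  have "Collect closed \<subseteq> lambda_system UNIV (Pow UNIV) ?H"
  proof
    fix F :: "'a set" assume "F \<in> Collect closed"
    then have "?H (T \<inter> F) + ?H (T - F) \<le> ?H T" for T using hausdorff_outer_closed by blast
    moreover have "?H T \<le> ?H (T \<inter> F) + ?H (T - F)" for T
      using hausdorff_outer_subadditive2[of s "T \<inter> F" "T - F"] by (simp add: Int_Diff_Un)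
    ultimately show "F \<in> lambda_system UNIV (Pow UNIV) ?H"
      unfolding lambda_system_eq by (auto intro: antisym)
  qed
  then have "sigma_sets UNIV (Collect closed) \<subseteq> lambda_system UNIV (Pow UNIV) ?H"
    by (rule L.sigma_sets_subset)
  then have sub: "sets (borel :: 'a measure) \<subseteq> lambda_system UNIV (Pow UNIV) ?H"
    by (simp add: borel_eq_closed)
  have "sigma_algebra UNIV (sets (borel :: 'a measure))" using sets.sigma_algebra_axioms[of borel] by simp
  moreover have "positive (sets (borel :: 'a measure)) ?H" by (simp add: positive_def)
  moreover have "countably_additive (sets (borel :: 'a measure)) ?H"
    using L sub unfolding measure_space_def countably_additive_def by blast
  ultimately show ?thesis by (simp add: measure_space_def)
qed

lemma emeasure_hausdorff_measure:
  fixes X :: "'a::metric_space set"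
  assumes "X \<in> sets borel" shows "emeasure (hausdorff_measure s) X = hausdorff_outer s X"
  using assms measure_space_hausdorff_outer[of s, where 'a = 'a] sets.sigma_sets_eq[of "borel :: 'a measure"]
  unfolding hausdorff_measure_def emeasure_measure_of_conv by simp


section \<open>The cube and complex exponentials\<close>

text \<open>The test domain for necessity: its faces are parallel to coordinate hyperplanes, which
  makes the comparison with Lebesgue measure explicit.\<close>

definition cube :: "(real^'n) set" where
  "cube = {x. \<forall>i. \<bar>x $ i\<bar> < 1}"

lemma cube_box: "cube = box (\<chi> i. -1) (\<chi> i. (1 :: real))"
  by (auto simp: cube_def mem_box_cart abs_less_iff)

lemma closure_cube: "closure cube \<subseteq> {x :: real^'n. \<forall>i. \<bar>x $ i\<bar> \<le> 1}"
proof (rule closure_minimal)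
  show "closed {x :: real^'n. \<forall>i. \<bar>x $ i\<bar> \<le> 1}"
    by (intro closed_Collect_all closed_Collect_le continuous_intros)
qed (auto simp: cube_def less_imp_le)

lemma Max_image_lipschitz:
  fixes f :: "'i \<Rightarrow> 'a::metric_space \<Rightarrow> real"
  assumes I: "finite I" "I \<noteq> {}" and f: "\<And>i. i \<in> I \<Longrightarrow> L-lipschitz_on S (f i)"
  shows "L-lipschitz_on S (\<lambda>x. Max ((\<lambda>i. f i x) ` I))"
proof (rule lipschitz_onI)
  obtain i where "i \<in> I" using I by blast
  then show "L \<ge> 0" using f lipschitz_on_nonneg by blast
  have *: "Max ((\<lambda>i. f i x) ` I) \<le> Max ((\<lambda>i. f i y) ` I) + L * dist x y" if "x \<in> S" "y \<in> S" for x y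
  proof (rule Max.boundedI)
    fix a assume "a \<in> (\<lambda>i. f i x) ` I"
    then obtain i where i: "i \<in> I" "a = f i x" by blast
    have "f i x \<le> f i y + L * dist x y"
      using lipschitz_onD[OF f[OF i(1)] that] by (auto simp: dist_real_def)
    also have "f i y \<le> Max ((\<lambda>i. f i y) ` I)" using I i by auto
    finally show "a \<le> Max ((\<lambda>i. f i y) ` I) + L * dist x y" using i by simp
  qed (use I in auto)
  show "dist (Max ((\<lambda>i. f i x) ` I)) (Max ((\<lambda>i. f i y) ` I)) \<le> L * dist x y" if "x \<in> S" "y \<in> S" for x y
    using *[OF that] *[OF that(2,1)] by (auto simp: dist_real_def dist_commute abs_le_iff)
qed

text \<open>At a boundary point \<open>x0\<close> with active coordinates I, the cube is the epigraph over the diagonal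
  direction \<open>- x0 / sqrt (card I)\<close> in the coordinates I: along it every active constraint
  decreases at the same rate.\<close>

lemma lipschitz_domain_cube: "lipschitz_domain (cube :: (real^'n::finite) set)"
  unfolding lipschitz_domain_def
proof (intro conjI ballI)
  show op: "open (cube :: (real^'n) set)" unfolding cube_box by (rule open_box)
  show "connected (cube :: (real^'n) set)" unfolding cube_box by (intro convex_connected convex_box)
  have "(0 :: real^'n) \<in> cube" by (simp add: cube_def)
  then show "(cube :: (real^'n) set) \<noteq> {}" by blast
  fix x0 :: "real^'n" assume x0: "x0 \<in> frontier cube"
  define I where "I = {i. \<bar>x0 $ i\<bar> = 1}"
  have le1: "\<bar>x0 $ i\<bar> \<le> 1" for i using x0 closure_cube by (auto simp: frontier_def)
  have "x0 \<notin> cube" using x0 op by (simp add: frontier_def interior_open)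
  then obtain i where "\<not> \<bar>x0 $ i\<bar> < 1" by (auto simp: cube_def)
  then have "i \<in> I" using le1[of i] by (simp add: I_def)
  then have ne: "I \<noteq> {}" by blast
  have sq: "x0 $ i * x0 $ i = 1" if "i \<in> I" for i
    using that by (auto simp: I_def abs_if split: if_splits)
  define k where "k = sqrt (real (card I))"
  have "card I > 0" using ne by (simp add: card_gt_0_iff)
  then have k: "k > 0" "k * k = real (card I)" by (auto simp: k_def)
  define \<nu> :: "real^'n" where "\<nu> = (\<chi> i. if i \<in> I then - x0 $ i / k else 0)"
  \<comment> \<open>With y = z + \<tau> \<nu> the active constraint x0_i y_i < 1 reads x0_i z_i -
    \<tau> / k < 1, that is, \<tau> > k (x0_i z_i - 1).\<close>
  define \<gamma> where "\<gamma> z = Max ((\<lambda>i. k * (x0 $ i * z $ i - 1)) ` I)" for z :: "real^'n"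
  \<comment> \<open>Within r of x0 the inactive constraints hold by themselves, and r \<le> 1 keeps
    an active coordinate away from the opposite face.\<close>
  define r where "r = Min (insert 1 ((\<lambda>i. 1 - \<bar>x0 $ i\<bar>) ` (- I)))"
  have "\<bar>x0 $ i\<bar> < 1" if "i \<notin> I" for i using le1[of i] that by (simp add: I_def)
  then have "r > 0" unfolding r_def by (subst Min_gr_iff) auto
  moreover have "r \<le> 1" "\<And>i. i \<notin> I \<Longrightarrow> r \<le> 1 - \<bar>x0 $ i\<bar>"
    unfolding r_def by (auto intro!: Min_le)
  ultimately have r: "r > 0" "r \<le> 1" "\<And>i. i \<notin> I \<Longrightarrow> r \<le> 1 - \<bar>x0 $ i\<bar>" by auto
  have "\<nu> \<bullet> \<nu> = (\<Sum>i\<in>UNIV. if i \<in> I then 1 / (k * k) else 0)"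
    unfolding inner_vec_def by (intro sum.cong) (auto simp: \<nu>_def sq)
  also have "\<dots> = 1" using k ne by (simp add: sum.If_cases)
  finally have n: "norm \<nu> = 1" by (simp add: norm_eq_sqrt_inner)
  have "k-lipschitz_on {z. z \<bullet> \<nu> = 0} \<gamma>"
    unfolding \<gamma>_def
  proof (rule Max_image_lipschitz)
    fix i assume i: "i \<in> I"
    show "k-lipschitz_on {z. z \<bullet> \<nu> = 0} (\<lambda>z. k * (x0 $ i * z $ i - 1))"
    proof (rule lipschitz_onI)
      fix x y :: "real^'n"
      have "\<bar>k * (x0 $ i * x $ i - 1) - k * (x0 $ i * y $ i - 1)\<bar> = \<bar>k * (x0 $ i * (x - y) $ i)\<bar>"
        by (simp add: algebra_simps)
      also have "\<dots> = k * \<bar>(x - y) $ i\<bar>" using k i by (simp add: abs_mult I_def)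
      also have "\<dots> \<le> k * norm (x - y)" using k component_le_norm_cart[of "x - y" i] by (intro mult_left_mono) auto
      finally show "dist (k * (x0 $ i * x $ i - 1)) (k * (x0 $ i * y $ i - 1)) \<le> k * dist x y"
        by (simp add: dist_real_def dist_norm)
    qed (use k in simp)
  qed (use ne in auto)
  moreover have "cube \<inter> ball x0 r = {y \<in> ball x0 r. \<gamma> (y - (y \<bullet> \<nu>) *\<^sub>R \<nu>) < y \<bullet> \<nu>}"
  proof -
    have "y \<in> cube \<longleftrightarrow> \<gamma> (y - (y \<bullet> \<nu>) *\<^sub>R \<nu>) < y \<bullet> \<nu>" if y: "y \<in> ball x0 r" for y
    proof -
      have near: "\<bar>y $ i - x0 $ i\<bar> < r" for i
        using component_le_norm_cart[of "y - x0" i] y by (simp add: dist_norm norm_minus_commute)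
      have "\<gamma> (y - (y \<bullet> \<nu>) *\<^sub>R \<nu>) < y \<bullet> \<nu> \<longleftrightarrow> (\<forall>i\<in>I. k * (x0 $ i * (y - (y \<bullet> \<nu>) *\<^sub>R \<nu>) $ i - 1) < y \<bullet> \<nu>)"
        unfolding \<gamma>_def using ne by (subst Max_less_iff) auto
      also have "\<dots> \<longleftrightarrow> (\<forall>i\<in>I. x0 $ i * y $ i < 1)"
      proof (rule ball_cong[OF refl])
        fix i assume i: "i \<in> I"
        have "x0 $ i * (y - (y \<bullet> \<nu>) *\<^sub>R \<nu>) $ i = x0 $ i * y $ i + (y \<bullet> \<nu>) * (x0 $ i * x0 $ i) / k"
          using i by (simp add: \<nu>_def algebra_simps)
        then have "k * (x0 $ i * (y - (y \<bullet> \<nu>) *\<^sub>R \<nu>) $ i - 1) = k * (x0 $ i * y $ i - 1) + y \<bullet> \<nu>"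
          using k sq[OF i] by (simp add: field_simps)
        moreover have "k * (x0 $ i * y $ i - 1) < 0 \<longleftrightarrow> x0 $ i * y $ i < 1"
          using k by (simp add: mult_less_0_iff)
        ultimately show "(k * (x0 $ i * (y - (y \<bullet> \<nu>) *\<^sub>R \<nu>) $ i - 1) < y \<bullet> \<nu>) \<longleftrightarrow> x0 $ i * y $ i < 1"
          by linarith
      qed
      also have "\<dots> \<longleftrightarrow> y \<in> cube"
      proof -
        have "\<bar>y $ i\<bar> < 1" if "i \<notin> I" for i using near[of i] r(3)[OF that] by linarith
        moreover have "\<bar>y $ i\<bar> < 1 \<longleftrightarrow> x0 $ i * y $ i < 1" if "i \<in> I" for i
        proof -
          have "x0 $ i = 1 \<or> x0 $ i = -1" using that by (auto simp: I_def abs_if split: if_splits)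
          then show ?thesis using near[of i] r(2) by auto
        qed
        ultimately show ?thesis unfolding cube_def by blast
      qed
      finally show ?thesis by blast
    qed
    then show ?thesis by blast
  qed
  ultimately show "\<exists>r>0. \<exists>\<nu> \<gamma> L. norm \<nu> = 1 \<and> L-lipschitz_on {z. z \<bullet> \<nu> = 0} \<gamma> \<and>
     cube \<inter> ball x0 r = {y \<in> ball x0 r. \<gamma> (y - (y \<bullet> \<nu>) *\<^sub>R \<nu>) < y \<bullet> \<nu>}"
    using r(1) n by blast
qed

section \<open>Exponential solutions of the homogeneous equation\<close>

definition wave :: "complex^'n::finite \<Rightarrow> real \<Rightarrow> real^'n \<Rightarrow> complex" where
  "wave \<xi> t x = exp (of_real t * (\<Sum>l\<in>UNIV. \<xi> $ l * of_real (x $ l)))"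

definition wave_field :: "complex^'n::finite \<Rightarrow> real \<Rightarrow> complex^'N \<Rightarrow> real^'n \<Rightarrow> real^'N" where
  "wave_field \<xi> t \<eta> x = (\<chi> j. Re (wave \<xi> t x * \<eta> $ j))"

lemma wave_has_derivative:
  "(wave \<xi> t has_derivative (\<lambda>v. wave \<xi> t x * (of_real t * (\<Sum>l\<in>UNIV. \<xi> $ l * of_real (v $ l))))) (at x)"
proof -
  have "((\<lambda>x. of_real t * (\<Sum>l\<in>UNIV. \<xi> $ l * of_real (x $ l))) has_derivative
      (\<lambda>v. of_real t * (\<Sum>l\<in>UNIV. \<xi> $ l * of_real (v $ l)))) (at x)"
    by (intro bounded_linear_imp_has_derivative bounded_linear_const_mult bounded_linear_sum
        bounded_linear_compose[OF bounded_linear_of_real bounded_linear_vec_nth])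
  moreover have "(exp has_derivative (\<lambda>w. exp z * w)) (at z)" for z :: complex
    using DERIV_exp[of z] by (simp add: has_field_derivative_def)
  ultimately show ?thesis
    unfolding wave_def using has_derivative_compose by fastforce
qed

lemma wave_field_has_derivative:
  "(wave_field \<xi> t \<eta> has_derivative
     (\<lambda>v. \<chi> j. Re (wave \<xi> t x * (of_real t * (\<Sum>l\<in>UNIV. \<xi> $ l * of_real (v $ l))) * \<eta> $ j))) (at x)"
proof -
  have "((\<lambda>x. Re (wave \<xi> t x * \<eta> $ j)) has_derivative
      (\<lambda>v. Re (wave \<xi> t x * (of_real t * (\<Sum>l\<in>UNIV. \<xi> $ l * of_real (v $ l))) * \<eta> $ j))) (at x)" for j
    by (intro has_derivative_Re has_derivative_mult_left wave_has_derivative)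
  then show ?thesis
    unfolding wave_field_def[abs_def]
    by (subst has_derivative_componentwise_within) (auto simp: Basis_vec_def inner_axis)
qed

lemma partial_wave_field:
  fixes \<xi> :: "complex^'n::finite"
  shows "partial l (wave_field \<xi> t \<eta>) x = wave_field \<xi> t (\<chi> j. of_real t * \<xi> $ l * \<eta> $ j) x"
proof -
  have s: "(\<Sum>l'\<in>UNIV. \<xi> $ l' * of_real ((axis l 1 :: real^'n) $ l')) = \<xi> $ l"
  proof -
    have "(\<Sum>l'\<in>UNIV. \<xi> $ l' * of_real ((axis l 1 :: real^'n) $ l')) = (\<Sum>l'\<in>UNIV. if l' = l then \<xi> $ l else 0)"
      by (intro sum.cong) (auto simp: axis_def)
    then show ?thesis by simp
  qed
  show ?thesis
    unfolding partial_def frechet_derivative_at[OF wave_field_has_derivative, symmetric]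
    by (simp add: wave_field_def s mult.assoc)
qed

lemma wave_field_continuous: "continuous_on S (wave_field \<xi> t \<eta>)"
  by (meson wave_field_has_derivative has_derivative_continuous continuous_at_imp_continuous_on)

lemma C1_on_wave_field: "C1_on S (wave_field \<xi> t \<eta>)"
proof -
  have "wave_field \<xi> t \<eta> differentiable (at x)" for x
    unfolding differentiable_def using wave_field_has_derivative by blast
  moreover have "partial l (wave_field \<xi> t \<eta>) = wave_field \<xi> t (\<chi> j. of_real t * \<xi> $ l * \<eta> $ j)" for l
    by (rule ext) (rule partial_wave_field)
  ultimately show ?thesis unfolding C1_on_def by (simp add: wave_field_continuous)
qed

text \<open>Differentiation in direction l brings down t \<xi>_l, so the operator produces the real
  part of a scalar multiple of \<open>op_symbol A \<xi> \<eta>\<close>.\<close>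

lemma diff_op_wave_field:
  assumes lin: "\<And>l. linear (A l)" and ker: "op_symbol A \<xi> \<eta> = 0"
  shows "diff_op A (wave_field \<xi> t \<eta>) x = 0"
proof -
  note linA = linear_nth_expansion[OF lin]
  have "diff_op A (wave_field \<xi> t \<eta>) x $ \<kappa> = 0" for \<kappa>
  proof -
    let ?a = "\<lambda>l j. A l (axis j 1) $ \<kappa>"
    have "diff_op A (wave_field \<xi> t \<eta>) x $ \<kappa> = (\<Sum>l\<in>UNIV. \<Sum>j\<in>UNIV. Re (wave \<xi> t x * (of_real t * \<xi> $ l * \<eta> $ j)) * ?a l j)"
      unfolding diff_op_def partial_wave_field sum_component
      by (subst linA) (simp add: wave_field_def)
    also have "\<dots> = (\<Sum>l\<in>UNIV. \<Sum>j\<in>UNIV. Re (wave \<xi> t x * of_real t * (\<xi> $ l * of_real (?a l j) * \<eta> $ j)))"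
    proof (intro sum.cong refl)
      fix l j
      have "Re (wave \<xi> t x * (of_real t * \<xi> $ l * \<eta> $ j)) * ?a l j = Re (wave \<xi> t x * (of_real t * \<xi> $ l * \<eta> $ j) * of_real (?a l j))"
        by simp
      also have "wave \<xi> t x * (of_real t * \<xi> $ l * \<eta> $ j) * of_real (?a l j) = wave \<xi> t x * of_real t * (\<xi> $ l * of_real (?a l j) * \<eta> $ j)"
        by (simp only: mult_ac)
      finally show "Re (wave \<xi> t x * (of_real t * \<xi> $ l * \<eta> $ j)) * ?a l j = Re (wave \<xi> t x * of_real t * (\<xi> $ l * of_real (?a l j) * \<eta> $ j))" .
    qed
    also have "\<dots> = (\<Sum>j\<in>UNIV. \<Sum>l\<in>UNIV. Re (wave \<xi> t x * of_real t * (\<xi> $ l * of_real (?a l j) * \<eta> $ j)))"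
      by (rule sum.swap)
    also have "\<dots> = Re (wave \<xi> t x * of_real t * (op_symbol A \<xi> \<eta> $ \<kappa>))"
      unfolding op_symbol_nth[OF lin] by (simp only: sum_distrib_left sum_distrib_right Re_sum)
    finally show ?thesis by (simp add: ker)
  qed
  then show ?thesis by (simp add: vec_eq_iff)
qed

lemma norm_wave: "norm (wave \<xi> t x) = exp (t * ((\<chi> l. Re (\<xi> $ l)) \<bullet> x))"
  by (simp add: wave_def inner_vec_def)

lemma norm_wave_field_le: "norm (wave_field \<xi> t \<eta> x) \<le> norm (wave \<xi> t x) * norm \<eta>"
proof -
  have "norm (wave_field \<xi> t \<eta> x) \<le> norm (\<chi> j. wave \<xi> t x * \<eta> $ j)"
    unfolding norm_vec_def
    by (intro L2_set_mono) (simp_all only: wave_field_def vec_lambda_beta real_norm_def abs_Re_le_cmod norm_ge_zero)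
  also have "\<dots> = norm (wave \<xi> t x) * norm \<eta>"
    unfolding norm_vec_def by (simp add: norm_mult L2_set_right_distrib)
  finally show ?thesis .
qed

text \<open>A real field alone may vanish at some points. The field for -i \<eta> is the imaginary
  part of the same complex vector, and the two together control its modulus.\<close>

lemma norm_wave_field_ge:
  "norm (wave \<xi> t x) * norm \<eta> \<le> norm (wave_field \<xi> t \<eta> x) + norm (wave_field \<xi> t (\<chi> j. - \<i> * \<eta> $ j) x)"
proof -
  have "norm (wave \<xi> t x) * norm \<eta> = norm (\<chi> j. wave \<xi> t x * \<eta> $ j)"
    unfolding norm_vec_def by (simp add: norm_mult L2_set_right_distrib)
  also have "\<dots> \<le> L2_set (\<lambda>j. \<bar>wave_field \<xi> t \<eta> x $ j\<bar> + \<bar>wave_field \<xi> t (\<chi> j. - \<i> * \<eta> $ j) x $ j\<bar>) UNIV"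
    unfolding norm_vec_def
  proof (intro L2_set_mono)
    fix j
    have "Re (wave \<xi> t x * (- \<i> * \<eta> $ j)) = Im (wave \<xi> t x * \<eta> $ j)" by simp
    then show "norm ((\<chi> j. wave \<xi> t x * \<eta> $ j) $ j) \<le> \<bar>wave_field \<xi> t \<eta> x $ j\<bar> + \<bar>wave_field \<xi> t (\<chi> j. - \<i> * \<eta> $ j) x $ j\<bar>"
      using cmod_le[of "wave \<xi> t x * \<eta> $ j"] by (simp only: wave_field_def vec_lambda_beta)
  qed simp
  also have "\<dots> \<le> norm (wave_field \<xi> t \<eta> x) + norm (wave_field \<xi> t (\<chi> j. - \<i> * \<eta> $ j) x)"
    using L2_set_triangle_ineq[of "\<lambda>j. \<bar>wave_field \<xi> t \<eta> x $ j\<bar>" _ UNIV] by (simp add: norm_vec_def)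
  finally show ?thesis .
qed


section \<open>Failure of the trace inequality\<close>

definition face_proj :: "'n \<Rightarrow> real^'n \<Rightarrow> real^'n" where
  "face_proj i x = (\<chi> l. if l = i then 1 else x $ l)"

lemma continuous_on_face_proj: "continuous_on S (face_proj i)"
proof -
  have "continuous_on S (\<lambda>x. if l = i then 1 else x $ l)" for l
    by (cases "l = i") (auto intro!: continuous_intros)
  then show ?thesis unfolding face_proj_def by (intro continuous_intros)
qed

lemma measurable_face_proj [measurable]: "face_proj i \<in> borel_measurable borel"
  by (rule borel_measurable_continuous_onI) (rule continuous_on_face_proj)

lemma open_cube: "open (cube :: (real^'n) set)"
  unfolding cube_box by (rule open_box)

lemma cube_borel [measurable]: "(cube :: (real^'n) set) \<in> sets borel"
  by (rule borel_open[OF open_cube])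

lemma frontier_cube_borel [measurable]: "frontier (cube :: (real^'n) set) \<in> sets borel"
  by (rule borel_closed[OF frontier_closed])

lemma face_proj_frontier:
  assumes "x \<in> cube" shows "face_proj i x \<in> frontier cube"
proof -
  have "face_proj i x \<notin> cube" by (auto simp: cube_def face_proj_def)
  moreover have "face_proj i x \<in> closure cube"
  proof (rule closure_approachable[THEN iffD2], intro allI impI)
    fix e :: real assume e: "e > 0"
    define d where "d = min (1/2) (e/2)"
    have d: "0 < d" "d < 1" "d < e" using e by (auto simp: d_def)
    let ?y = "face_proj i x - d *\<^sub>R axis i 1"
    have "?y $ l = (if l = i then 1 - d else x $ l)" for l by (simp add: face_proj_def axis_def)
    then have "?y \<in> cube" using assms d by (auto simp: cube_def)
    moreover have "dist ?y (face_proj i x) < e" using d by (simp add: dist_norm)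
    ultimately show "\<exists>y\<in>cube. dist y (face_proj i x) < e" by blast
  qed
  ultimately show ?thesis by (simp add: frontier_def interior_open[OF open_cube])
qed

text \<open>The points projecting into a set of diameter d lie in a box with side 2 in direction i
  and side 2 d in the others. Its volume is 2 (2 d)^(n-1) = 2 4^(n-1) (d/2)^(n-1), whence the
  constant.\<close>

lemma emeasure_face_shadow_cover:
  fixes X :: "(real^'n::finite) set"
  assumes bd: "bounded X"
  shows "\<exists>B \<in> sets borel. {x \<in> cube. face_proj i x \<in> X} \<subseteq> B \<and>
    emeasure lborel B \<le> ennreal (2 * 4 ^ (CARD('n) - 1) / unit_ball_vol (real (CARD('n) - 1))) * hcost (CARD('n) - 1) X"
proof (cases "X = {}")
  case True
  then show ?thesis by (intro bexI[of _ "{}"]) (auto simp: hcost_def)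
next
  case False
  then obtain c where c: "c \<in> X" by blast
  let ?d = "diameter X" and ?m = "CARD('n) - 1"
  define a b :: "real^'n" where "a = (\<chi> l. if l = i then -1 else c $ l - ?d)" and "b = (\<chi> l. if l = i then 1 else c $ l + ?d)"
  have d0: "?d \<ge> 0" by (rule diameter_ge_0[OF bd])
  have "{x \<in> cube. face_proj i x \<in> X} \<subseteq> cbox a b"
  proof
    fix x assume "x \<in> {x \<in> cube. face_proj i x \<in> X}"
    then have x: "x \<in> cube" "face_proj i x \<in> X" by auto
    have "\<bar>x $ l - c $ l\<bar> \<le> ?d" if "l \<noteq> i" for l
      using component_le_norm_cart[of "face_proj i x - c" l] diameter_bounded_bound[OF bd x(2) c] that
      by (simp add: face_proj_def dist_norm)
    then show "x \<in> cbox a b" using x(1)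
      by (auto simp: mem_box_cart a_def b_def cube_def abs_le_iff abs_less_iff algebra_simps less_imp_le)
  qed
  moreover have "emeasure lborel (cbox a b) = ennreal (2 * 4 ^ ?m / unit_ball_vol (real ?m)) * hcost ?m X"
  proof -
    have "a \<in> cbox a b" using d0 by (simp add: mem_box_cart a_def b_def)
    then have ne: "cbox a b \<noteq> {}" by blast
    have "measure lborel (cbox a b) = (\<Prod>l\<in>UNIV. b $ l - a $ l)" by (rule content_cbox_cart[OF ne])
    also have "\<dots> = (b $ i - a $ i) * (\<Prod>l\<in>UNIV - {i}. b $ l - a $ l)" by (subst prod.remove[of _ i]) auto
    also have "(\<Prod>l\<in>UNIV - {i}. b $ l - a $ l) = (\<Prod>l\<in>UNIV - {i}. 2 * ?d)"
      by (intro prod.cong) (auto simp: a_def b_def)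
    also have "\<dots> = (2 * ?d) ^ ?m" by simp
    also have "(b $ i - a $ i) * (2 * ?d) ^ ?m = 2 * 4 ^ ?m / unit_ball_vol (real ?m) * (unit_ball_vol (real ?m) * (?d / 2) ^ ?m)"
    proof -
      define v where "v = unit_ball_vol (real ?m)"
      define e where "e = ?d / 2"
      have "v > 0" by (simp add: v_def)
      moreover have "2 * ?d = 4 * e" "b $ i - a $ i = 2" by (simp_all add: e_def a_def b_def)
      ultimately show ?thesis unfolding v_def[symmetric] e_def[symmetric] by (simp add: power_mult_distrib)
    qed
    finally have m: "measure lborel (cbox a b) = 2 * 4 ^ ?m / unit_ball_vol (real ?m) * (unit_ball_vol (real ?m) * (?d / 2) ^ ?m)" .
    have "emeasure lborel (cbox a b) = ennreal (measure lborel (cbox a b))"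
      using emeasure_lborel_cbox_finite[of a b] by (intro emeasure_eq_ennreal_measure) simp
    also have "\<dots> = ennreal (2 * 4 ^ ?m / unit_ball_vol (real ?m)) * ennreal (unit_ball_vol (real ?m) * (?d / 2) ^ ?m)"
      unfolding m using d0 by (intro ennreal_mult) auto
    finally show ?thesis using False by (simp only: hcost_def if_False)
  qed
  ultimately show ?thesis by (intro bexI[of _ "cbox a b"]) auto
qed

text \<open>This is the lower bound for the Hausdorff measure: every cover of E yields boxes
  covering the points that project into E. Covers of diameter at most 1 suffice, as the premeasure
  at any scale lies below the outer measure.\<close>

lemma emeasure_face_shadow:
  fixes E :: "(real^'n::finite) set"
  assumes E: "E \<in> sets borel"
  shows "emeasure lborel {x \<in> cube. face_proj i x \<in> E} \<le>
    ennreal (2 * 4 ^ (CARD('n) - 1) / unit_ball_vol (real (CARD('n) - 1))) * emeasure (hausdorff_measure (CARD('n) - 1)) E"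
proof -
  let ?m = "CARD('n) - 1"
  let ?c = "ennreal (2 * 4 ^ ?m / unit_ball_vol (real ?m))"
  have "emeasure lborel {x \<in> cube. face_proj i x \<in> E} \<le> ?c * (\<Sum>j. hcost ?m (C j))"
    if C: "E \<subseteq> (\<Union>j. C j)" "\<And>j. bounded (C j)" for C
  proof -
    define Q where "Q j B \<longleftrightarrow> B \<in> sets borel \<and> {x \<in> cube. face_proj i x \<in> C j} \<subseteq> B \<and> emeasure lborel B \<le> ?c * hcost ?m (C j)" for j B
    have "\<exists>B. Q j B" for j
      using emeasure_face_shadow_cover[OF C(2), of i j] unfolding Q_def by (simp only: Bex_def)
    then obtain B where "\<And>j. Q j (B j)" by metis
    then have B: "B j \<in> sets borel" "{x \<in> cube. face_proj i x \<in> C j} \<subseteq> B j"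
      "emeasure lborel (B j) \<le> ?c * hcost ?m (C j)" for j unfolding Q_def by blast+
    have "{x \<in> cube. face_proj i x \<in> E} \<subseteq> (\<Union>j. B j)"
    proof
      fix x assume x: "x \<in> {x \<in> cube. face_proj i x \<in> E}"
      then obtain j where "face_proj i x \<in> C j" using C(1) by blast
      then show "x \<in> (\<Union>j. B j)" using B(2)[of j] x by blast
    qed
    moreover have Bs: "range B \<subseteq> sets lborel" using B(1) by auto
    moreover from Bs have "(\<Union>j. B j) \<in> sets lborel" by (rule sets.countable_UN)
    ultimately have "emeasure lborel {x \<in> cube. face_proj i x \<in> E} \<le> emeasure lborel (\<Union>j. B j)"
      by (intro emeasure_mono)
    also have "\<dots> \<le> (\<Sum>j. emeasure lborel (B j))"
      using Bs by (rule emeasure_subadditive_countably)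
    also have "\<dots> \<le> (\<Sum>j. ?c * hcost ?m (C j))" by (intro suminf_le B) auto
    finally show ?thesis by simp
  qed
  note cover = this
  define c where "c = 2 * 4 ^ ?m / unit_ball_vol (real ?m)"
  have c: "c > 0" using unit_ball_vol_pos[of "real ?m"] by (simp add: c_def)
  have cc: "ennreal (1 / c) * (ennreal c * y) = y" "ennreal c * (ennreal (1 / c) * y) = y" for y
    using c by (simp_all add: mult.assoc[symmetric] ennreal_mult[symmetric])
  \<comment> \<open>Dividing by c first lets the infimum be bounded cover by cover.\<close>
  have "ennreal (1 / c) * emeasure lborel {x \<in> cube. face_proj i x \<in> E} \<le> hausdorff_premeasure ?m 1 E"
    unfolding hausdorff_premeasure_eq
  proof (rule INF_greatest)
    fix C :: "nat \<Rightarrow> (real^'n) set" assume "C \<in> {C. E \<subseteq> (\<Union>i. C i) \<and> (\<forall>i. bounded (C i) \<and> diameter (C i) \<le> 1)}"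
    then have "emeasure lborel {x \<in> cube. face_proj i x \<in> E} \<le> ennreal c * (\<Sum>j. hcost ?m (C j))"
      unfolding c_def by (intro cover) auto
    then have "ennreal (1 / c) * emeasure lborel {x \<in> cube. face_proj i x \<in> E} \<le> ennreal (1 / c) * (ennreal c * (\<Sum>j. hcost ?m (C j)))"
      by (rule mult_left_mono) simp
    then show "ennreal (1 / c) * emeasure lborel {x \<in> cube. face_proj i x \<in> E} \<le> (\<Sum>j. hcost ?m (C j))"
      by (simp only: cc)
  qed
  then have "ennreal c * (ennreal (1 / c) * emeasure lborel {x \<in> cube. face_proj i x \<in> E}) \<le> ennreal c * hausdorff_premeasure ?m 1 E"
    by (rule mult_left_mono) simp
  then have "emeasure lborel {x \<in> cube. face_proj i x \<in> E} \<le> ?c * hausdorff_premeasure ?m 1 E"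
    unfolding cc(2) c_def[symmetric] .
  also have "\<dots> \<le> ?c * hausdorff_outer ?m E"
    by (intro mult_left_mono hausdorff_premeasure_le_outer) auto
  finally show ?thesis by (simp add: emeasure_hausdorff_measure[OF E])
qed

text \<open>\<open>emeasure_face_shadow\<close> says that the push-forward of Lebesgue measure on
  the cube is dominated by a multiple of the Hausdorff measure on the boundary; integrating f
  against both passes from sets to functions.\<close>

lemma nn_integral_face_shadow:
  fixes f :: "real^'n::finite \<Rightarrow> ennreal"
  assumes [measurable]: "f \<in> borel_measurable borel"
  shows "(\<integral>\<^sup>+x\<in>cube. f (face_proj i x) \<partial>lborel) \<le>
    ennreal (2 * 4 ^ (CARD('n) - 1) / unit_ball_vol (real (CARD('n) - 1))) * (\<integral>\<^sup>+x\<in>frontier cube. f x \<partial>hausdorff_measure (CARD('n) - 1))"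
proof -
  let ?m = "CARD('n) - 1"
  let ?c = "ennreal (2 * 4 ^ ?m / unit_ball_vol (real ?m))"
  let ?H = "hausdorff_measure ?m :: (real^'n) measure"
  let ?M = "distr (density lborel (indicator cube)) borel (face_proj i)"
  let ?N = "density ?H (\<lambda>x. ?c * indicator (frontier cube) x)"
  have "(\<integral>\<^sup>+x\<in>cube. f (face_proj i x) \<partial>lborel) = (\<integral>\<^sup>+x. indicator cube x * f (face_proj i x) \<partial>lborel)"
    by (simp add: mult.commute)
  also have "\<dots> = (\<integral>\<^sup>+x. f (face_proj i x) \<partial>density lborel (indicator cube))"
    by (subst nn_integral_density) auto
  also have "\<dots> = (\<integral>\<^sup>+x. f x \<partial>?M)" by (subst nn_integral_distr) auto
  also have "\<dots> \<le> (\<integral>\<^sup>+x. f x \<partial>?N)"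
  proof (rule nn_integral_mono_measure)
    show "?M \<le> ?N"
    proof (rule le_measure[THEN iffD2])
      show "\<forall>E\<in>sets ?M. emeasure ?M E \<le> emeasure ?N E"
      proof
        fix E assume "E \<in> sets ?M"
        then have E[measurable]: "E \<in> sets borel" by simp
        have "emeasure ?M E = emeasure (density lborel (indicator cube)) (face_proj i -` E)"
          by (subst emeasure_distr) auto
        also have "\<dots> = (\<integral>\<^sup>+x. indicator cube x * indicator (face_proj i -` E) x \<partial>lborel)"
          using measurable_sets[OF measurable_face_proj E, of i] by (subst emeasure_density) auto
        also have "\<dots> = (\<integral>\<^sup>+x. indicator {x \<in> cube. face_proj i x \<in> E \<inter> frontier cube} x \<partial>lborel)"
          by (intro nn_integral_cong) (auto simp: indicator_def face_proj_frontier)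
        also have "\<dots> = emeasure lborel {x \<in> cube. face_proj i x \<in> E \<inter> frontier cube}"
          by (rule nn_integral_indicator) measurable
        also have "\<dots> \<le> ?c * emeasure ?H (E \<inter> frontier cube)" by (rule emeasure_face_shadow) auto
        also have "\<dots> = (\<integral>\<^sup>+x. ?c * indicator (E \<inter> frontier cube) x \<partial>?H)"
          by (subst nn_integral_cmult_indicator) auto
        also have "\<dots> = (\<integral>\<^sup>+x. ?c * indicator (frontier cube) x * indicator E x \<partial>?H)"
          by (intro nn_integral_cong) (auto simp: indicator_def)
        also have "\<dots> = emeasure ?N E" by (subst emeasure_density) auto
        finally show "emeasure ?M E \<le> emeasure ?N E" .
      qed
    qed auto
  qed simp
  also have "\<dots> = (\<integral>\<^sup>+x. ?c * indicator (frontier cube) x * f x \<partial>?H)"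
    by (subst nn_integral_density) auto
  also have "\<dots> = ?c * (\<integral>\<^sup>+x\<in>frontier cube. f x \<partial>?H)"
    by (subst nn_integral_cmult[symmetric]) (auto simp: mult_ac)
  finally show ?thesis .
qed

lemma axis_in_Basis: "axis i (1::real) \<in> Basis"
  by (auto simp: Basis_vec_def)

lemma axis_nth: "axis i a $ l = (if l = i then a else 0)"
  by (simp add: axis_def)

text \<open>The affine map T compresses the cube in direction i onto the slab. Its Jacobian is d /
  2, and it leaves \<open>face_proj i\<close> unchanged.\<close>

lemma nn_integral_slab:
  fixes f :: "real^'n::finite \<Rightarrow> ennreal"
  assumes [measurable]: "f \<in> borel_measurable borel" and d: "0 < d" "d \<le> 2"
  shows "(\<integral>\<^sup>+x\<in>{x \<in> cube. x $ i > 1 - d}. f (face_proj i x) \<partial>lborel) = ennreal (d / 2) * (\<integral>\<^sup>+x\<in>cube. f (face_proj i x) \<partial>lborel)"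
proof -
  define c where "c j = (if j = axis i 1 then d / 2 else 1)" for j :: "real^'n"
  define t where "t = (1 - d / 2) *\<^sub>R (axis i 1 :: real^'n)"
  define T where "T x = t + (\<Sum>j\<in>Basis. (c j * (x \<bullet> j)) *\<^sub>R j)" for x
  have T: "T x $ l = (if l = i then (1 - d / 2) + d / 2 * x $ i else x $ l)" for x l
  proof -
    have "T x $ l = T x \<bullet> axis l 1" by (simp add: inner_axis)
    also have "\<dots> = t \<bullet> axis l 1 + c (axis l 1) * (x \<bullet> axis l 1)"
      unfolding T_def inner_add_left by (subst inner_sum_left_Basis) (simp_all add: axis_in_Basis)
    also have "\<dots> = (if l = i then (1 - d / 2) + d / 2 * x $ i else x $ l)"
      by (cases "l = i") (auto simp: t_def c_def inner_axis axis_eq_axis axis_nth)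
    finally show ?thesis .
  qed
  have [measurable]: "T \<in> borel_measurable borel" unfolding T_def by measurable
  have P: "face_proj i (T x) = face_proj i x" for x by (simp add: face_proj_def T vec_eq_iff)
  let ?S = "{x :: real^'n. x \<in> cube \<and> x $ i > 1 - d}"
  have S: "T x \<in> ?S \<longleftrightarrow> x \<in> cube" for x
  proof -
    have "\<bar>(1 - d / 2) + d / 2 * x $ i\<bar> < 1 \<and> (1 - d / 2) + d / 2 * x $ i > 1 - d \<longleftrightarrow> \<bar>x $ i\<bar> < 1"
    proof -
      have 1: "(1 - d / 2) + d / 2 * x $ i > 1 - d \<longleftrightarrow> x $ i > -1"
      proof -
        have "(1 - d / 2) + d / 2 * x $ i - (1 - d) = d / 2 * (x $ i + 1)" by (simp add: algebra_simps)
        then have "(1 - d / 2) + d / 2 * x $ i > 1 - d \<longleftrightarrow> d / 2 * (x $ i + 1) > 0" by linarith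
        also have "\<dots> \<longleftrightarrow> x $ i > -1" using d by (simp add: zero_less_mult_iff) linarith
        finally show ?thesis .
      qed
      have 2: "(1 - d / 2) + d / 2 * x $ i < 1 \<longleftrightarrow> x $ i < 1"
      proof -
        have "1 - ((1 - d / 2) + d / 2 * x $ i) = d / 2 * (1 - x $ i)" by (simp add: algebra_simps)
        then have "(1 - d / 2) + d / 2 * x $ i < 1 \<longleftrightarrow> d / 2 * (1 - x $ i) > 0" by linarith
        also have "\<dots> \<longleftrightarrow> x $ i < 1" using d by (simp add: zero_less_mult_iff)
        finally show ?thesis .
      qed
      show ?thesis using 1 2 d by (auto simp: abs_less_iff)
    qed
    then have "T x \<in> ?S \<longleftrightarrow> (\<forall>l. l \<noteq> i \<longrightarrow> \<bar>x $ l\<bar> < 1) \<and> \<bar>x $ i\<bar> < 1"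
      by (auto simp: cube_def T split: if_splits)
    then show ?thesis by (auto simp: cube_def)
  qed
  have prod: "(\<Prod>j\<in>Basis. \<bar>c j\<bar>) = d / 2"
  proof -
    have "(\<Prod>j\<in>Basis. \<bar>c j\<bar>) = (\<Prod>j\<in>{axis i 1}. \<bar>c j\<bar>)"
      by (rule prod.mono_neutral_right) (auto simp: c_def axis_in_Basis)
    then show ?thesis using d by (simp add: c_def)
  qed
  have lb: "lborel = density (distr lborel borel T) (\<lambda>_. ennreal (d / 2))"
    using lborel_affine_euclidean[of c t] d unfolding prod T_def by (simp add: c_def)
  have [measurable]: "?S \<in> sets borel" by measurable
  have "(\<integral>\<^sup>+x\<in>?S. f (face_proj i x) \<partial>lborel) = (\<integral>\<^sup>+x. ennreal (d / 2) * (f (face_proj i (T x)) * indicator ?S (T x)) \<partial>lborel)"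
    by (subst lb, subst nn_integral_density, measurable, subst nn_integral_distr) auto
  also have "\<dots> = (\<integral>\<^sup>+x. ennreal (d / 2) * (f (face_proj i x) * indicator cube x) \<partial>lborel)"
  proof -
    have "indicator ?S (T x) = (indicator cube x :: ennreal)" for x using S[of x] by (simp add: indicator_def)
    then show ?thesis by (simp only: P)
  qed
  also have "\<dots> = ennreal (d / 2) * (\<integral>\<^sup>+x\<in>cube. f (face_proj i x) \<partial>lborel)"
    by (rule nn_integral_cmult) measurable
  finally show ?thesis .
qed

text \<open>The slab next to the face carries a small fraction of the integral of \<open>exp (t (a \<bullet> x))\<close> with \<open>x\<close>
  projected to the face, and away from it the exponential is small.\<close>

lemma exponential_no_trace:
  fixes a :: "real^'n::finite" and D :: real
  assumes a: "a $ i > 0" and D: "D > 0"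
    and le: "\<And>t. t > 0 \<Longrightarrow> (\<integral>\<^sup>+x\<in>frontier cube. ennreal (exp (t * (a \<bullet> x))) \<partial>hausdorff_measure (CARD('n) - 1))
      \<le> ennreal D * (\<integral>\<^sup>+x\<in>cube. ennreal (exp (t * (a \<bullet> x))) \<partial>lborel)"
  shows False
proof -
  define C where "C = 2 * 4 ^ (CARD('n) - 1) / unit_ball_vol (real (CARD('n) - 1))"
  have C: "C > 0" using unit_ball_vol_pos[of "real (CARD('n) - 1)"] by (simp add: C_def)
  define B where "B = C * D"
  have B: "B > 0" using C D by (simp add: B_def)
  \<comment> \<open>The slab carries the fraction d / 2 of X, which after multiplication by the
    total constant B is at most 1/4.\<close>
  define d where "d = min 1 (1 / (2 * B))"
  have d: "0 < d" "d \<le> 1" "B * (d / 2) \<le> 1/4"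
  proof -
    show "0 < d" "d \<le> 1" using B by (auto simp: d_def)
    have "d \<le> 1 / (2 * B)" by (simp add: d_def)
    then show "B * (d / 2) \<le> 1/4" using B by (simp add: field_simps)
  qed
  \<comment> \<open>Off the slab the exponential loses the factor exp (- t a_i d), and t is taken so
    large that B times this factor is at most 1/4. The summands 1 and |ln (4 B)| ensure t >
    0.\<close>
  define t where "t = (ln (4 * B) + 1 + \<bar>ln (4 * B)\<bar>) / (a $ i * d)"
  have t: "t > 0" unfolding t_def using a d by (intro divide_pos_pos) auto
  have ex: "B * exp (- t * a $ i * d) \<le> 1/4"
  proof -
    have "t * a $ i * d = ln (4 * B) + 1 + \<bar>ln (4 * B)\<bar>" using a d by (simp add: t_def)
    then have "ln (4 * B) \<le> t * a $ i * d" by linarith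
    then have "exp (ln (4 * B)) \<le> exp (t * a $ i * d)" by (simp only: exp_le_cancel_iff)
    then have "4 * B \<le> exp (t * a $ i * d)" using B by simp
    then show ?thesis by (simp add: exp_minus field_simps)
  qed
  define f where "f x = ennreal (exp (t * (a \<bullet> x)))" for x
  have f[measurable]: "f \<in> borel_measurable borel" unfolding f_def by measurable
  define X where "X = (\<integral>\<^sup>+x\<in>cube. f (face_proj i x) \<partial>lborel)"
  have Px: "a \<bullet> x = a \<bullet> face_proj i x - a $ i * (1 - x $ i)" for x
  proof -
    have eq: "face_proj i x = x + (1 - x $ i) *\<^sub>R axis i 1" by (simp add: vec_eq_iff face_proj_def axis_def)
    show ?thesis unfolding eq by (simp add: inner_add_right inner_axis algebra_simps)
  qed
  have split: "f x * indicator cube x \<le> f (face_proj i x) * indicator {x \<in> cube. x $ i > 1 - d} x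
      + ennreal (exp (- t * a $ i * d)) * (f (face_proj i x) * indicator cube x)" for x
  proof (cases "x \<in> cube")
    case True
    then have x1: "1 - x $ i > 0" by (auto simp: cube_def abs_less_iff)
    show ?thesis
    proof (cases "x $ i > 1 - d")
      case slab: True
      have "t * (a \<bullet> x) \<le> t * (a \<bullet> face_proj i x)" using Px[of x] t a x1 by (intro mult_left_mono) auto
      then have "f x \<le> f (face_proj i x)" unfolding f_def by (intro ennreal_leI) simp
      then show ?thesis using True slab by (simp add: add_increasing2)
    next
      case False
      have "t * (a $ i * (1 - x $ i)) \<ge> t * (a $ i * d)" using t a False by (intro mult_left_mono) auto
      then have "t * (a \<bullet> x) \<le> - t * a $ i * d + t * (a \<bullet> face_proj i x)" unfolding Px[of x] by (simp add: algebra_simps)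
      then have "exp (t * (a \<bullet> x)) \<le> exp (- t * a $ i * d) * exp (t * (a \<bullet> face_proj i x))"
        by (simp flip: exp_add)
      then have "f x \<le> ennreal (exp (- t * a $ i * d)) * f (face_proj i x)"
        unfolding f_def by (simp add: ennreal_leI flip: ennreal_mult)
      then show ?thesis using True False by simp
    qed
  qed simp
  have "(\<integral>\<^sup>+x\<in>cube. f x \<partial>lborel) \<le> (\<integral>\<^sup>+x. f (face_proj i x) * indicator {x \<in> cube. x $ i > 1 - d} x
      + ennreal (exp (- t * a $ i * d)) * (f (face_proj i x) * indicator cube x) \<partial>lborel)"
    by (intro nn_integral_mono split)
  also have "\<dots> = (\<integral>\<^sup>+x. f (face_proj i x) * indicator {x \<in> cube. x $ i > 1 - d} x \<partial>lborel)
      + (\<integral>\<^sup>+x. ennreal (exp (- t * a $ i * d)) * (f (face_proj i x) * indicator cube x) \<partial>lborel)"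
    by (rule nn_integral_add) measurable
  also have "(\<integral>\<^sup>+x. ennreal (exp (- t * a $ i * d)) * (f (face_proj i x) * indicator cube x) \<partial>lborel) = ennreal (exp (- t * a $ i * d)) * X"
    unfolding X_def by (rule nn_integral_cmult) measurable
  also have "(\<integral>\<^sup>+x. f (face_proj i x) * indicator {x \<in> cube. x $ i > 1 - d} x \<partial>lborel) = ennreal (d / 2) * X"
    unfolding X_def by (rule nn_integral_slab) (use d in auto)
  finally have vol: "(\<integral>\<^sup>+x\<in>cube. f x \<partial>lborel) \<le> (ennreal (d / 2) + ennreal (exp (- t * a $ i * d))) * X"
    by (simp add: distrib_right)
  have "X \<le> ennreal C * (\<integral>\<^sup>+x\<in>frontier cube. f x \<partial>hausdorff_measure (CARD('n) - 1))"
    unfolding X_def C_def by (rule nn_integral_face_shadow[OF f])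
  also have "\<dots> \<le> ennreal C * (ennreal D * (\<integral>\<^sup>+x\<in>cube. f x \<partial>lborel))"
    using le[OF t] unfolding f_def by (intro mult_left_mono) auto
  also have "\<dots> \<le> ennreal C * (ennreal D * ((ennreal (d / 2) + ennreal (exp (- t * a $ i * d))) * X))"
    by (intro mult_left_mono vol) auto
  also have "\<dots> = ennreal (B * (d / 2) + B * exp (- t * a $ i * d)) * X"
    using C D d by (simp add: B_def ennreal_plus[symmetric] ennreal_mult[symmetric] mult.assoc[symmetric] distrib_left del: ennreal_plus)
  also have "\<dots> \<le> ennreal (1/2) * X" using d(3) ex by (intro mult_right_mono ennreal_leI) auto
  finally have half: "X \<le> ennreal (1/2) * X" .
  \<comment> \<open>The exponent is bounded on the cube, so X is positive and finite, which
    contradicts \<open>half\<close>.\<close>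
  define m where "m = t * (\<Sum>l\<in>UNIV. \<bar>a $ l\<bar>)"
  have bnd: "\<bar>t * (a \<bullet> face_proj i x)\<bar> \<le> m" if "x \<in> cube" for x
  proof -
    have "\<bar>a \<bullet> face_proj i x\<bar> \<le> (\<Sum>l\<in>UNIV. \<bar>a $ l * face_proj i x $ l\<bar>)"
      unfolding inner_vec_def by (simp add: sum_abs)
    also have "\<dots> \<le> (\<Sum>l\<in>UNIV. \<bar>a $ l\<bar>)"
    proof (rule sum_mono)
      fix l
      have "\<bar>face_proj i x $ l\<bar> \<le> 1" using that by (simp add: face_proj_def cube_def less_imp_le)
      then show "\<bar>a $ l * face_proj i x $ l\<bar> \<le> \<bar>a $ l\<bar>" by (simp add: abs_mult mult_left_le)
    qed
    finally show ?thesis using t by (simp add: m_def abs_mult)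
  qed
  have vcube: "emeasure lborel (cube :: (real^'n) set) \<noteq> \<infinity>" "emeasure lborel (cube :: (real^'n) set) \<noteq> 0"
  proof -
    have e: "emeasure lborel (cube :: (real^'n) set) = (\<Prod>b\<in>Basis. ((\<chi> i. 1) - (\<chi> i. - 1) :: real^'n) \<bullet> b)"
      unfolding cube_box by (rule emeasure_lborel_box) (auto simp: Basis_vec_def inner_axis)
    then show "emeasure lborel (cube :: (real^'n) set) \<noteq> \<infinity>" by simp
    have "(\<Prod>b\<in>Basis. ((\<chi> i. 1) - (\<chi> i. - 1) :: real^'n) \<bullet> b) > 0"
      by (intro prod_pos) (auto simp: Basis_vec_def inner_axis)
    then show "emeasure lborel (cube :: (real^'n) set) \<noteq> 0"
      unfolding e by (metis ennreal_eq_0_iff not_less)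
  qed
  have "X \<le> (\<integral>\<^sup>+x. ennreal (exp m) * indicator (cube :: (real^'n) set) x \<partial>lborel)"
    unfolding X_def f_def
  proof (intro nn_integral_mono)
    fix x :: "real^'n"
    show "ennreal (exp (t * (a \<bullet> face_proj i x))) * indicator cube x \<le> ennreal (exp m) * indicator cube x"
      using bnd[of x] by (cases "x \<in> cube") (auto simp: abs_le_iff intro!: ennreal_leI)
  qed
  also have "\<dots> = ennreal (exp m) * emeasure lborel (cube :: (real^'n) set)" by (rule nn_integral_cmult_indicator) simp
  also have "\<dots> < \<infinity>" using vcube(1) by (auto simp: ennreal_mult_less_top less_top)
  finally have fin: "X < \<infinity>" .
  have "ennreal (exp (- m)) * emeasure lborel (cube :: (real^'n) set) = (\<integral>\<^sup>+x. ennreal (exp (- m)) * indicator (cube :: (real^'n) set) x \<partial>lborel)"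
    by (rule nn_integral_cmult_indicator[symmetric]) simp
  also have "\<dots> \<le> X"
    unfolding X_def f_def
  proof (intro nn_integral_mono)
    fix x :: "real^'n"
    show "ennreal (exp (- m)) * indicator cube x \<le> ennreal (exp (t * (a \<bullet> face_proj i x))) * indicator cube x"
      using bnd[of x] by (cases "x \<in> cube") (auto simp: abs_le_iff intro!: ennreal_leI)
  qed
  finally have pos: "X \<noteq> 0" using vcube(2) by auto
  obtain r where r: "X = ennreal r" "r \<ge> 0" using fin by (cases X) auto
  then have "r \<le> 1/2 * r" using half by (simp add: ennreal_mult[symmetric] del: ennreal_half)
  then show False using pos r by simp
qed

lemma trace_imp_C_elliptic:
  fixes A :: "'n::finite \<Rightarrow> real^'N::finite \<Rightarrow> real^'K::finite"
  assumes lin: "\<And>\<alpha>. linear (A \<alpha>)" and c: "c > 0"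
    and trace: "\<And>u :: real^'n \<Rightarrow> real^'N. continuous_on (closure cube) u \<Longrightarrow> C1_on cube u \<Longrightarrow>
      L1_norm (hausdorff_measure (CARD('n) - 1)) (frontier cube) u \<le> ennreal c * (L1_norm lborel cube u + L1_norm lborel cube (diff_op A u))"
  shows "C_elliptic A"
proof (rule ccontr)
  assume "\<not> C_elliptic A"
  then obtain \<xi>0 where \<xi>0: "\<xi>0 \<noteq> 0" "\<not> inj (op_symbol A \<xi>0)" by (auto simp: C_elliptic_def)
  then obtain \<eta>1 \<eta>2 where \<eta>12: "\<eta>1 \<noteq> \<eta>2" "op_symbol A \<xi>0 \<eta>1 = op_symbol A \<xi>0 \<eta>2" by (auto simp: inj_on_def)
  define \<eta> where "\<eta> = \<eta>1 - \<eta>2"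
  obtain i where i: "\<xi>0 $ i \<noteq> 0" using \<xi>0(1) by (auto simp: vec_eq_iff)
  \<comment> \<open>Multiplying by the conjugate of a nonzero component keeps \<eta> in the kernel
    and makes the i-th component |\<xi>0_i|^2 > 0, so that the exponential grows towards the face
    x_i = 1.\<close>
  define \<xi> where "\<xi> = (\<chi> l. cnj (\<xi>0 $ i) * \<xi>0 $ l)"
  define a where "a = (\<chi> l. Re (\<xi> $ l))"
  have "a $ i = (cmod (\<xi>0 $ i))\<^sup>2"
    by (simp add: a_def \<xi>_def cmod_power2) (simp add: power2_eq_square)
  then have ai: "a $ i > 0" using i by simp
  have \<eta>: "norm \<eta> > 0" using \<eta>12 by (simp add: \<eta>_def)
  \<comment> \<open>Applied with z = 1 and z = -i, whose fields are the real and the imaginary part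
    of the complex solution.\<close>
  have scaled: "op_symbol A \<xi> (\<chi> j. z * \<eta> $ j) = 0" for z
  proof -
    have "op_symbol A \<xi> (\<chi> j. z * \<eta> $ j) $ \<kappa> = cnj (\<xi>0 $ i) * z * (op_symbol A \<xi>0 \<eta>1 $ \<kappa> - op_symbol A \<xi>0 \<eta>2 $ \<kappa>)" for \<kappa>
      unfolding op_symbol_nth[OF lin] \<eta>_def \<xi>_def
      by (simp add: sum_distrib_left sum_distrib_right sum_subtractf algebra_simps)
    then show ?thesis using \<eta>12(2) by (simp add: vec_eq_iff)
  qed
  let ?H = "hausdorff_measure (CARD('n) - 1) :: (real^'n) measure"
  \<comment> \<open>The modulus of the complex exponential is bounded by the two real fields, each
    obeying the trace inequality with constant c; hence 2 c. The factor \<open>norm \<eta>\<close>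
    on both sides is cancelled at the end.\<close>
  have "(\<integral>\<^sup>+x\<in>frontier cube. ennreal (exp (t * (a \<bullet> x))) \<partial>?H) \<le> ennreal (2 * c) * (\<integral>\<^sup>+x\<in>cube. ennreal (exp (t * (a \<bullet> x))) \<partial>lborel)"
    if "t > 0" for t
  proof -
    let ?f = "\<lambda>x. ennreal (exp (t * (a \<bullet> x)))"
    have nw: "norm (wave \<xi> t x) = exp (t * (a \<bullet> x))" for x by (simp add: norm_wave a_def)
    have one: "L1_norm ?H (frontier cube) (wave_field \<xi> t (\<chi> j. z * \<eta> $ j)) \<le> ennreal c * ((\<integral>\<^sup>+x\<in>cube. ?f x \<partial>lborel) * ennreal (norm \<eta>))"
      if z: "cmod z = 1" for z
    proof -
      let ?u = "wave_field \<xi> t (\<chi> j. z * \<eta> $ j)"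
      have "norm (\<chi> j. z * \<eta> $ j) = norm \<eta>" by (simp add: norm_vec_def norm_mult z)
      then have nu: "norm (?u x) \<le> exp (t * (a \<bullet> x)) * norm \<eta>" for x using norm_wave_field_le[of \<xi> t "\<chi> j. z * \<eta> $ j" x] by (simp add: nw)
      have "L1_norm lborel cube (diff_op A ?u) = 0"
        by (simp add: L1_norm_def diff_op_wave_field[OF lin scaled])
      moreover have "L1_norm lborel cube ?u \<le> (\<integral>\<^sup>+x. ?f x * indicator cube x * ennreal (norm \<eta>) \<partial>lborel)"
        unfolding L1_norm_def using nu
        by (intro nn_integral_mono) (auto simp: indicator_def intro!: ennreal_leI simp flip: ennreal_mult)
      moreover have "\<dots> = (\<integral>\<^sup>+x\<in>cube. ?f x \<partial>lborel) * ennreal (norm \<eta>)" by (rule nn_integral_multc) measurable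
      ultimately have "L1_norm lborel cube ?u + L1_norm lborel cube (diff_op A ?u) \<le> (\<integral>\<^sup>+x\<in>cube. ?f x \<partial>lborel) * ennreal (norm \<eta>)" by simp
      then show ?thesis using trace[OF wave_field_continuous C1_on_wave_field, of \<xi> t "\<chi> j. z * \<eta> $ j"]
        by (meson mult_left_mono order_trans zero_le)
    qed
    have wm: "(\<lambda>x. ennreal (norm (wave_field \<xi> t \<zeta> x)) * indicator (frontier cube) x) \<in> borel_measurable ?H" for \<zeta> :: "complex^'N"
    proof -
      have "(\<lambda>x. norm (wave_field \<xi> t \<zeta> x)) \<in> borel_measurable borel"
        by (intro borel_measurable_continuous_onI continuous_on_norm wave_field_continuous)
      then have "(\<lambda>x. ennreal (norm (wave_field \<xi> t \<zeta> x)) * indicator (frontier cube) x) \<in> borel_measurable borel"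
        by measurable
      then show ?thesis by (simp only: measurable_cong_sets[OF sets_hausdorff_measure refl])
    qed
    have "(\<integral>\<^sup>+x\<in>frontier cube. ?f x \<partial>?H) * ennreal (norm \<eta>) = (\<integral>\<^sup>+x. ?f x * indicator (frontier cube) x * ennreal (norm \<eta>) \<partial>?H)"
      by (rule nn_integral_multc[symmetric]) measurable
    also have "\<dots> \<le> (\<integral>\<^sup>+x. ennreal (norm (wave_field \<xi> t (\<chi> j. 1 * \<eta> $ j) x)) * indicator (frontier cube) x +
        ennreal (norm (wave_field \<xi> t (\<chi> j. - \<i> * \<eta> $ j) x)) * indicator (frontier cube) x \<partial>?H)"
    proof (intro nn_integral_mono)
      fix x
      have "exp (t * (a \<bullet> x)) * norm \<eta> \<le> norm (wave_field \<xi> t \<eta> x) + norm (wave_field \<xi> t (\<chi> j. - \<i> * \<eta> $ j) x)"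
        using norm_wave_field_ge[of \<xi> t x \<eta>] by (simp only: nw)
      then have "?f x * ennreal (norm \<eta>) \<le> ennreal (norm (wave_field \<xi> t \<eta> x)) + ennreal (norm (wave_field \<xi> t (\<chi> j. - \<i> * \<eta> $ j) x))"
        by (simp add: ennreal_leI flip: ennreal_mult ennreal_plus)
      then show "?f x * indicator (frontier cube) x * ennreal (norm \<eta>) \<le> ennreal (norm (wave_field \<xi> t (\<chi> j. 1 * \<eta> $ j) x)) * indicator (frontier cube) x +
        ennreal (norm (wave_field \<xi> t (\<chi> j. - \<i> * \<eta> $ j) x)) * indicator (frontier cube) x"
        by (cases "x \<in> frontier cube") simp_all
    qed
    also have "\<dots> = L1_norm ?H (frontier cube) (wave_field \<xi> t (\<chi> j. 1 * \<eta> $ j)) + L1_norm ?H (frontier cube) (wave_field \<xi> t (\<chi> j. - \<i> * \<eta> $ j))"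
      unfolding L1_norm_def by (rule nn_integral_add[OF wm wm])
    also have "\<dots> \<le> ennreal c * ((\<integral>\<^sup>+x\<in>cube. ?f x \<partial>lborel) * ennreal (norm \<eta>)) + ennreal c * ((\<integral>\<^sup>+x\<in>cube. ?f x \<partial>lborel) * ennreal (norm \<eta>))"
      by (intro add_mono one) auto
    also have "\<dots> = (ennreal (2 * c) * (\<integral>\<^sup>+x\<in>cube. ?f x \<partial>lborel)) * ennreal (norm \<eta>)"
      using c by (simp add: ennreal_mult mult_ac mult_2[symmetric])
    finally show ?thesis using \<eta> by (simp add: ennreal_mult_le_mult_iff mult.commute[of _ "ennreal (norm \<eta>)"])
  qed
  then show False using exponential_no_trace[OF ai, of "2 * c"] c by simp
qed

theorem theorem1p1:
  fixes A :: "'n::finite \<Rightarrow> real^'N::finite \<Rightarrow> real^'K::finite"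
  assumes "\<And>\<alpha>. linear (A \<alpha>)"
  shows "(\<forall>\<Omega> :: (real^'n) set. open \<Omega> \<and> bounded \<Omega> \<and> lipschitz_domain \<Omega> \<longrightarrow>
            (\<exists>c::real. c > 0 \<and>
              (\<forall>u :: real^'n \<Rightarrow> real^'N. continuous_on (closure \<Omega>) u \<and> C1_on \<Omega> u \<longrightarrow>
                 L1_norm (hausdorff_measure (CARD('n) - 1)) (frontier \<Omega>) u
                   \<le> ennreal c * (L1_norm lborel \<Omega> u + L1_norm lborel \<Omega> (diff_op A u)))))
         \<longleftrightarrow> C_elliptic A"
    (is "?trace \<longleftrightarrow> _")
proof
  assume ?trace
  moreover have "open (cube :: (real^'n) set) \<and> bounded (cube :: (real^'n) set) \<and> lipschitz_domain (cube :: (real^'n) set)"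
    using open_cube lipschitz_domain_cube by (simp add: cube_box)
  ultimately obtain c where "c > 0" "\<forall>u :: real^'n \<Rightarrow> real^'N. continuous_on (closure cube) u \<and> C1_on cube u \<longrightarrow>
                 L1_norm (hausdorff_measure (CARD('n) - 1)) (frontier cube) u
                   \<le> ennreal c * (L1_norm lborel cube u + L1_norm lborel cube (diff_op A u))" by blast
  then show "C_elliptic A" by (intro trace_imp_C_elliptic[OF assms]) auto
next
  assume "C_elliptic A"
  then show ?trace by (intro allI impI C_elliptic_trace assms) auto
qed

end
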